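(* Let $(M^n,g,\xi,\lambda,\rho)$ be a compact almost Ricci-Bourguignon soliton with $n>2$, and let $S$ be the scalar curvature of $g$. Then $(M^n,g,\xi,\lambda,\rho)$ is a trivial Ricci-Bourguignon soliton if and only if the function $n(\lambda+\rho S)-S$ is constant on the integral curves of the potential field $\xi$.
   Context: Manifolds are smooth, connected and without boundary. An almost Ricci-Bourguignon (almost RB) soliton $(M^n,g,\xi,\lambda,\rho)$ is an $n$-dimensional Riemannian manifold $(M^n,g)$ with a smooth vector field $\xi$ (the potential field), a smooth function $\lambda$ on $M$ (the soliton function) and a real constant $\rho$ such that $\operatorname{Ric}+\frac12\mathcal{L}_\xi g=(\lambda+\rho S)g$, where $\operatorname{Ric}$ is the Ricci tensor, $S$ the scalar curvature and $\mathcal{L}_\xi$ the Lie derivative. It is a Ricci-Bourguignon (RB) soliton if $\lambda$ is constant, and a trivial RB-soliton if $\lambda$ is constant and $\xi$ is a Killing vector field. A function $h$ is constant on the integral curves of $\xi$ if $\xi(h)=0$. *)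

theory Defs
  imports "HOL-Analysis.Analysis"
begin

section \<open>Smooth maps between normed spaces\<close>

text \<open>Only used for open sets \<open>S\<close> of a finite-dimensional domain, where \<open>C^k\<close> can be tested on
  iterated directional derivatives.\<close>

primrec C_k_on :: "nat \<Rightarrow> ('e::real_normed_vector \<Rightarrow> 'f::real_normed_vector) \<Rightarrow> 'e set \<Rightarrow> bool" where
  "C_k_on 0 f S \<longleftrightarrow> continuous_on S f"
| "C_k_on (Suc k) f S \<longleftrightarrow>
     (\<forall>x\<in>S. f differentiable (at x)) \<and>
     (\<forall>v. C_k_on k (\<lambda>x. frechet_derivative f (at x) v) S)"

definition smooth_on :: "('e::real_normed_vector \<Rightarrow> 'f::real_normed_vector) \<Rightarrow> 'e set \<Rightarrow> bool" where
  "smooth_on f S \<longleftrightarrow> (\<forall>k. C_k_on k f S)"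

section \<open>Smooth manifolds\<close>

text \<open>A chart is a pair of its domain and its coordinate map; the values of the coordinate map
  outside the domain are irrelevant. The dimension of the manifold is \<open>CARD('n)\<close>.\<close>

type_synonym ('a, 'n) chart = "'a set \<times> ('a \<Rightarrow> real ^ 'n)"

definition chart_image :: "('a, 'n::finite) chart \<Rightarrow> (real ^ 'n) set" where
  "chart_image c = snd c ` fst c"

definition chart_inv :: "('a, 'n::finite) chart \<Rightarrow> real ^ 'n \<Rightarrow> 'a" where
  "chart_inv c = inv_into (fst c) (snd c)"

definition is_chart :: "'a topology \<Rightarrow> ('a, 'n::finite) chart \<Rightarrow> bool" where
  "is_chart M c \<longleftrightarrow>
     openin M (fst c) \<and> open (chart_image c) \<and>
     homeomorphic_map (subtopology M (fst c)) (top_of_set (chart_image c)) (snd c)"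

definition transition :: "('a, 'n::finite) chart \<Rightarrow> ('a, 'n) chart \<Rightarrow> real ^ 'n \<Rightarrow> real ^ 'n" where
  "transition c d = snd d \<circ> chart_inv c"

definition overlap :: "('a, 'n::finite) chart \<Rightarrow> ('a, 'n) chart \<Rightarrow> (real ^ 'n) set" where
  "overlap c d = snd c ` (fst c \<inter> fst d)"

definition smooth_atlas :: "'a topology \<Rightarrow> ('a, 'n::finite) chart set \<Rightarrow> bool" where
  "smooth_atlas M A \<longleftrightarrow>
     (\<forall>c\<in>A. is_chart M c) \<and>
     (\<Union>c\<in>A. fst c) = topspace M \<and>
     (\<forall>c\<in>A. \<forall>d\<in>A. smooth_on (transition c d) (overlap c d))"

definition connected_smooth_manifold :: "'a topology \<Rightarrow> ('a, 'n::finite) chart set \<Rightarrow> bool" where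
  "connected_smooth_manifold M A \<longleftrightarrow>
     Hausdorff_space M \<and> second_countable M \<and> connected_space M \<and> smooth_atlas M A"

definition smooth_function :: "('a, 'n::finite) chart set \<Rightarrow> ('a \<Rightarrow> real) \<Rightarrow> bool" where
  "smooth_function A f \<longleftrightarrow> (\<forall>c\<in>A. smooth_on (f \<circ> chart_inv c) (chart_image c))"

text \<open>Tensor fields are given by their components in each chart \<open>c\<close> of the atlas, regarded as
  functions on \<open>chart_image c\<close>; on overlaps the components obey the tensor transformation law.\<close>

definition smooth_vector_field ::
  "('a, 'n::finite) chart set \<Rightarrow> (('a, 'n) chart \<Rightarrow> real ^ 'n \<Rightarrow> real ^ 'n) \<Rightarrow> bool" where
  "smooth_vector_field A \<xi> \<longleftrightarrow>
     (\<forall>c\<in>A. smooth_on (\<xi> c) (chart_image c)) \<and>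
     (\<forall>c\<in>A. \<forall>d\<in>A. \<forall>x\<in>overlap c d.
        \<xi> d (transition c d x) = jacobian (transition c d) (at x) *v \<xi> c x)"

definition riemannian_metric ::
  "('a, 'n::finite) chart set \<Rightarrow> (('a, 'n) chart \<Rightarrow> real ^ 'n \<Rightarrow> real ^ 'n ^ 'n) \<Rightarrow> bool" where
  "riemannian_metric A g \<longleftrightarrow>
     (\<forall>c\<in>A. smooth_on (g c) (chart_image c)) \<and>
     (\<forall>c\<in>A. \<forall>x\<in>chart_image c.
        transpose (g c x) = g c x \<and> (\<forall>v. v \<noteq> 0 \<longrightarrow> v \<bullet> (g c x *v v) > 0)) \<and>
     (\<forall>c\<in>A. \<forall>d\<in>A. \<forall>x\<in>overlap c d.
        g c x = transpose (jacobian (transition c d) (at x)) ** g d (transition c d x)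
                  ** jacobian (transition c d) (at x))"

section \<open>Curvature and Lie derivative in local coordinates\<close>

text \<open>In this section \<open>g\<close> and \<open>\<xi>\<close> are the components of a metric and of a vector field in one
  fixed chart.\<close>

definition partial :: "'n::finite \<Rightarrow> (real ^ 'n \<Rightarrow> real) \<Rightarrow> real ^ 'n \<Rightarrow> real" where
  "partial i f x = frechet_derivative f (at x) (axis i 1)"

text \<open>\<open>christoffel g k i j\<close> is \<open>\<Gamma>\<^sup>k\<^sub>i\<^sub>j\<close> of the Levi-Civita connection.\<close>

definition christoffel ::
  "(real ^ 'n \<Rightarrow> real ^ 'n ^ 'n) \<Rightarrow> 'n::finite \<Rightarrow> 'n \<Rightarrow> 'n \<Rightarrow> real ^ 'n \<Rightarrow> real" where
  "christoffel g k i j x =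
     (1 / 2) * (\<Sum>l\<in>UNIV. matrix_inv (g x) $ k $ l *
        (partial i (\<lambda>y. g y $ j $ l) x + partial j (\<lambda>y. g y $ i $ l) x
          - partial l (\<lambda>y. g y $ i $ j) x))"

text \<open>\<open>riemann g l i j k\<close> is the \<open>l\<close>-th component of \<open>R(\<partial>\<^sub>i, \<partial>\<^sub>j) \<partial>\<^sub>k\<close>, with
  \<open>R(X, Y) Z = \<nabla>\<^sub>X \<nabla>\<^sub>Y Z - \<nabla>\<^sub>Y \<nabla>\<^sub>X Z - \<nabla>\<^sub>[\<^sub>X\<^sub>,\<^sub>Y\<^sub>] Z\<close>. The Ricci tensor is
  \<open>Ric(Y, Z) = tr (X \<mapsto> R(X, Y) Z)\<close>, hence positive on round spheres.\<close>

definition riemann ::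
  "(real ^ 'n \<Rightarrow> real ^ 'n ^ 'n) \<Rightarrow> 'n::finite \<Rightarrow> 'n \<Rightarrow> 'n \<Rightarrow> 'n \<Rightarrow> real ^ 'n \<Rightarrow> real" where
  "riemann g l i j k x =
     partial i (christoffel g l j k) x - partial j (christoffel g l i k) x
     + (\<Sum>m\<in>UNIV. christoffel g m j k x * christoffel g l i m x
                 - christoffel g m i k x * christoffel g l j m x)"

definition ricci :: "(real ^ 'n \<Rightarrow> real ^ 'n ^ 'n) \<Rightarrow> real ^ 'n::finite \<Rightarrow> real ^ 'n ^ 'n" where
  "ricci g x = (\<chi> j k. \<Sum>i\<in>UNIV. riemann g i i j k x)"

definition local_scalar_curvature ::
  "(real ^ 'n \<Rightarrow> real ^ 'n ^ 'n) \<Rightarrow> real ^ 'n::finite \<Rightarrow> real" where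
  "local_scalar_curvature g x =
     (\<Sum>j\<in>UNIV. \<Sum>k\<in>UNIV. matrix_inv (g x) $ j $ k * ricci g x $ j $ k)"

definition lie_derivative_metric ::
  "(real ^ 'n \<Rightarrow> real ^ 'n) \<Rightarrow> (real ^ 'n \<Rightarrow> real ^ 'n ^ 'n) \<Rightarrow> real ^ 'n::finite \<Rightarrow> real ^ 'n ^ 'n" where
  "lie_derivative_metric \<xi> g x =
     (\<chi> i j. \<Sum>k\<in>UNIV. \<xi> x $ k * partial k (\<lambda>y. g y $ i $ j) x
                      + g x $ k $ j * partial i (\<lambda>y. \<xi> y $ k) x
                      + g x $ i $ k * partial j (\<lambda>y. \<xi> y $ k) x)"

section \<open>Almost Ricci-Bourguignon solitons\<close>

text \<open>The value at \<open>p\<close> does not depend on which chart around \<open>p\<close> is chosen.\<close>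

definition scalar_curvature ::
  "('a, 'n::finite) chart set \<Rightarrow> (('a, 'n) chart \<Rightarrow> real ^ 'n \<Rightarrow> real ^ 'n ^ 'n) \<Rightarrow> 'a \<Rightarrow> real" where
  "scalar_curvature A g p =
     (let c = (SOME c. c \<in> A \<and> p \<in> fst c) in local_scalar_curvature (g c) (snd c p))"

definition almost_RB_soliton ::
  "'a topology \<Rightarrow> ('a, 'n::finite) chart set \<Rightarrow> (('a, 'n) chart \<Rightarrow> real ^ 'n \<Rightarrow> real ^ 'n ^ 'n)
    \<Rightarrow> (('a, 'n) chart \<Rightarrow> real ^ 'n \<Rightarrow> real ^ 'n) \<Rightarrow> ('a \<Rightarrow> real) \<Rightarrow> real \<Rightarrow> bool" where
  "almost_RB_soliton M A g \<xi> lam \<rho> \<longleftrightarrow>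
     connected_smooth_manifold M A \<and> riemannian_metric A g \<and>
     smooth_vector_field A \<xi> \<and> smooth_function A lam \<and>
     (\<forall>c\<in>A. \<forall>p\<in>fst c.
        ricci (g c) (snd c p) + (1 / 2) *\<^sub>R lie_derivative_metric (\<xi> c) (g c) (snd c p)
        = (lam p + \<rho> * scalar_curvature A g p) *\<^sub>R g c (snd c p))"

definition RB_soliton ::
  "'a topology \<Rightarrow> ('a, 'n::finite) chart set \<Rightarrow> (('a, 'n) chart \<Rightarrow> real ^ 'n \<Rightarrow> real ^ 'n ^ 'n)
    \<Rightarrow> (('a, 'n) chart \<Rightarrow> real ^ 'n \<Rightarrow> real ^ 'n) \<Rightarrow> ('a \<Rightarrow> real) \<Rightarrow> real \<Rightarrow> bool" where
  "RB_soliton M A g \<xi> lam \<rho> \<longleftrightarrow>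
     almost_RB_soliton M A g \<xi> lam \<rho> \<and> lam constant_on topspace M"

definition killing_field ::
  "('a, 'n::finite) chart set \<Rightarrow> (('a, 'n) chart \<Rightarrow> real ^ 'n \<Rightarrow> real ^ 'n ^ 'n)
    \<Rightarrow> (('a, 'n) chart \<Rightarrow> real ^ 'n \<Rightarrow> real ^ 'n) \<Rightarrow> bool" where
  "killing_field A g \<xi> \<longleftrightarrow>
     smooth_vector_field A \<xi> \<and>
     (\<forall>c\<in>A. \<forall>x\<in>chart_image c. lie_derivative_metric (\<xi> c) (g c) x = 0)"

definition trivial_RB_soliton ::
  "'a topology \<Rightarrow> ('a, 'n::finite) chart set \<Rightarrow> (('a, 'n) chart \<Rightarrow> real ^ 'n \<Rightarrow> real ^ 'n ^ 'n)
    \<Rightarrow> (('a, 'n) chart \<Rightarrow> real ^ 'n \<Rightarrow> real ^ 'n) \<Rightarrow> ('a \<Rightarrow> real) \<Rightarrow> real \<Rightarrow> bool" where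
  "trivial_RB_soliton M A g \<xi> lam \<rho> \<longleftrightarrow>
     RB_soliton M A g \<xi> lam \<rho> \<and> killing_field A g \<xi>"

text \<open>In a chart, the function \<open>\<xi>(h)\<close> is the derivative of the coordinate expression of \<open>h\<close> in
  the direction of \<open>\<xi>\<close>.\<close>

definition constant_on_integral_curves ::
  "('a, 'n::finite) chart set \<Rightarrow> (('a, 'n) chart \<Rightarrow> real ^ 'n \<Rightarrow> real ^ 'n) \<Rightarrow> ('a \<Rightarrow> real) \<Rightarrow> bool" where
  "constant_on_integral_curves A \<xi> h \<longleftrightarrow>
     (\<forall>c\<in>A. \<forall>x\<in>chart_image c. frechet_derivative (h \<circ> chart_inv c) (at x) (\<xi> c x) = 0)"

end

theory Submission
  imports Defs
begin

text \<open>
  Let \<open>L\<close> be the Lie derivative of \<open>g\<close> along \<open>\<xi>\<close>. Taking the trace of the soliton equation gives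
  \<open>n (\<lambda> + \<rho> S) - S = div \<xi> = tr(L) / 2 =: h\<close>, which vanishes if \<open>\<xi>\<close> is Killing. Conversely, if
  \<open>\<xi>(h) = 0\<close> then \<open>div (h \<xi>) = h\<^sup>2\<close>, so the divergence theorem yields \<open>h = 0\<close>, and the equation becomes
  \<open>Ric = (S / n) g - L / 2\<close>. By the contracted Bianchi identity \<open>div (S X - 2 Ric(X)) = S div X - \<langle>Ric, L\<^sub>X g\<rangle>\<close>
  for every vector field \<open>X\<close>. For \<open>X = \<xi>\<close> the right-hand side is \<open>\<bar>L\<bar>\<^sup>2 / 2\<close>, and the divergence
  theorem yields \<open>L = 0\<close>. Now \<open>g\<close> is Einstein and \<open>n > 2\<close>, so that \<open>S\<close> and \<open>\<lambda> = S / n - \<rho> S\<close> are constant.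
\<close>

section \<open>Calculus of smooth functions\<close>

text \<open>The field S X - 2 Ric(X) is -2 times the Einstein tensor applied to X. That tensor is
  divergence free, so the divergence of the field sees only the symmetrised derivative of X, that is
  the Lie derivative of g, and no derivative of S survives. Once tr L = 0, pairing Ric = (S / n) g -
  L / 2 with L leaves - |L|^2 / 2, which explains the sign. The same identity for coordinate fields
  gives Schur's lemma with a factor (n - 2) / n, and this is where n > 2 enters. The encoding of
  tensors by their components in charts shapes the development. Curvature identities are proved as
  matrix identities in one chart. Integration takes place in coordinate space with weight sqrt |det
  g|, and the divergence theorem is reduced to the statement that a divergence which is nonnegative
  everywhere vanishes; both applications have this form, with divergences h^2 and |L|^2 / 2. Since S
  is evaluated in an arbitrarily chosen chart, its independence of that choice must be shown before
  it can be differentiated.\<close>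

lemma C_k_on_cong:
  assumes "open S" "\<And>x. x \<in> S \<Longrightarrow> f x = g x" "C_k_on k f S"
  shows "C_k_on k g S"
  using assms(2,3)
proof (induction k arbitrary: f g)
  case 0
  then show ?case using continuous_on_cong by force
next
  case (Suc k)
  have d: "g differentiable (at x) \<and> frechet_derivative f (at x) = frechet_derivative g (at x)"
    if "x \<in> S" for x
  proof -
    have f: "(f has_derivative frechet_derivative f (at x)) (at x)"
      using Suc.prems(2) that by (simp add: frechet_derivative_works)
    have "(g has_derivative frechet_derivative f (at x)) (at x)"
      by (rule has_derivative_transform_within_open[OF f assms(1) that Suc.prems(1)])
    then show ?thesis
      using differentiableI frechet_derivative_at by blast
  qed
  have "C_k_on k (\<lambda>x. frechet_derivative g (at x) v) S" for v
    by (rule Suc.IH[of "\<lambda>x. frechet_derivative f (at x) v"]) (use d Suc.prems in auto)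
  then show ?case using d by auto
qed

lemma C_k_on_Suc_D: "C_k_on (Suc k) f S \<Longrightarrow> C_k_on k f S"
proof (induction k arbitrary: f)
  case 0
  then show ?case
    by (auto intro!: continuous_at_imp_continuous_on differentiable_imp_continuous_within)
next
  case (Suc k)
  then show ?case by (meson C_k_on.simps(2))
qed

text \<open>\<open>frechet_derivative\<close> is defined by choice; this rule lets any explicit
  formula \<open>D\<close> stand in for it. The closure rules for sums, products, inverses and
  square roots are inductions on \<open>k\<close> through it.\<close>

lemma C_k_on_SucI:
  assumes "open S" "\<And>x. x \<in> S \<Longrightarrow> (f has_derivative D x) (at x)"
    "\<And>v. C_k_on k (\<lambda>x. D x v) S"
  shows "C_k_on (Suc k) f S"
proof -
  have "C_k_on k (\<lambda>x. frechet_derivative f (at x) v) S" for v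
    by (rule C_k_on_cong[OF assms(1) _ assms(3)[of v]])
       (use assms(2) frechet_derivative_at in metis)
  with assms(2) show ?thesis by (auto simp: differentiable_def)
qed

lemma C_k_on_Suc_has_derivative:
  "C_k_on (Suc k) f S \<Longrightarrow> x \<in> S \<Longrightarrow> (f has_derivative frechet_derivative f (at x)) (at x)"
  by (simp add: frechet_derivative_works)

lemma C_k_on_subset: "C_k_on k f S \<Longrightarrow> T \<subseteq> S \<Longrightarrow> C_k_on k f T"
  by (induction k arbitrary: f) (auto intro: continuous_on_subset)

lemma C_k_on_const: "C_k_on k (\<lambda>x. c) S"
  by (induction k arbitrary: c) auto

lemma C_k_on_bounded_linear:
  assumes "open S" "bounded_linear h" shows "C_k_on k h S"
proof (cases k)
  case 0
  then show ?thesis using assms by (simp add: linear_continuous_on)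
next
  case (Suc m)
  show ?thesis unfolding Suc
    by (rule C_k_on_SucI[where D="\<lambda>_. h"])
       (use assms in \<open>auto intro: bounded_linear.has_derivative C_k_on_const has_derivative_ident\<close>)
qed

lemma C_k_on_compose_bounded_linear:
  assumes "open S" "bounded_linear h" "C_k_on k f S"
  shows "C_k_on k (\<lambda>x. h (f x)) S"
  using assms(3)
proof (induction k arbitrary: f)
  case 0
  then show ?case using bounded_linear.continuous_on[OF assms(2)] by (simp del: continuous_on_const)
next
  case (Suc k)
  show ?case
    by (rule C_k_on_SucI[OF assms(1) bounded_linear.has_derivative[OF assms(2) C_k_on_Suc_has_derivative[OF Suc.prems]]])
       (use Suc in auto)
qed

lemma C_k_on_add:
  assumes "open S" "C_k_on k f S" "C_k_on k g S"
  shows "C_k_on k (\<lambda>x. f x + g x) S"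
  using assms(2,3)
proof (induction k arbitrary: f g)
  case 0
  then show ?case by (auto intro: continuous_on_add)
next
  case (Suc k)
  show ?case
    by (rule C_k_on_SucI[OF assms(1) has_derivative_add[OF Suc.prems[THEN C_k_on_Suc_has_derivative]]])
       (use Suc in auto)
qed

lemma C_k_on_mult:
  fixes f g :: "'e::real_normed_vector \<Rightarrow> real"
  assumes "open S" "C_k_on k f S" "C_k_on k g S"
  shows "C_k_on k (\<lambda>x. f x * g x) S"
  using assms(2,3)
proof (induction k arbitrary: f g)
  case 0
  then show ?case by (auto intro: continuous_on_mult)
next
  case (Suc k)
  have f: "C_k_on k f S" and g: "C_k_on k g S" using Suc.prems C_k_on_Suc_D by blast+
  show ?case
    by (rule C_k_on_SucI[OF assms(1) has_derivative_mult[OF Suc.prems[THEN C_k_on_Suc_has_derivative]]])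
       (use Suc f g in \<open>auto intro!: C_k_on_add assms(1)\<close>)
qed

lemma C_k_on_sum:
  assumes "open S" "\<And>i. i \<in> I \<Longrightarrow> C_k_on k (f i) S"
  shows "C_k_on k (\<lambda>x. \<Sum>i\<in>I. f i x) S"
  using assms(2)
  by (induction I rule: infinite_finite_induct) (auto intro: C_k_on_const C_k_on_add assms(1))

lemma C_k_on_prod:
  fixes f :: "'i \<Rightarrow> 'e::real_normed_vector \<Rightarrow> real"
  assumes "open S" "\<And>i. i \<in> I \<Longrightarrow> C_k_on k (f i) S"
  shows "C_k_on k (\<lambda>x. \<Prod>i\<in>I. f i x) S"
  using assms(2)
  by (induction I rule: infinite_finite_induct) (auto intro: C_k_on_const C_k_on_mult assms(1))

lemma C_k_on_uminus: "open S \<Longrightarrow> C_k_on k f S \<Longrightarrow> C_k_on k (\<lambda>x. - f x) S"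
  by (rule C_k_on_compose_bounded_linear[OF _ bounded_linear_minus[OF bounded_linear_ident]])

lemma C_k_on_diff:
  "open S \<Longrightarrow> C_k_on k f S \<Longrightarrow> C_k_on k g S \<Longrightarrow> C_k_on k (\<lambda>x. f x - g x) S"
  using C_k_on_add[of S k f "\<lambda>x. - g x"] C_k_on_uminus[of S k g] by simp

text \<open>The derivative of 1 / f is - f' / f^2, a product of f' with copies of 1 / f itself, so
  regularity of order \<open>k\<close>, known by induction, gives order
  \<open>Suc k\<close>.\<close>

lemma C_k_on_inverse:
  fixes f :: "'e::real_normed_vector \<Rightarrow> real"
  assumes "open S" "C_k_on k f S" "\<And>x. x \<in> S \<Longrightarrow> f x \<noteq> 0"
  shows "C_k_on k (\<lambda>x. inverse (f x)) S"
  using assms(2)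
proof (induction k)
  case 0
  then show ?case using assms(3) by (auto intro: continuous_on_inverse)
next
  case (Suc k)
  have i: "C_k_on k (\<lambda>x. inverse (f x)) S" using Suc C_k_on_Suc_D by blast
  show ?case
    by (rule C_k_on_SucI[OF assms(1) Deriv.has_derivative_inverse[OF assms(3) C_k_on_Suc_has_derivative[OF Suc.prems]]])
       (use Suc i in \<open>auto intro!: C_k_on_mult C_k_on_uminus assms(1)\<close>)
qed

lemma C_k_on_sqrt:
  fixes f :: "'e::real_normed_vector \<Rightarrow> real"
  assumes "open S" "C_k_on k f S" "\<And>x. x \<in> S \<Longrightarrow> f x > 0"
  shows "C_k_on k (\<lambda>x. sqrt (f x)) S"
  using assms(2)
proof (induction k)
  case 0
  then show ?case by (auto intro: continuous_on_real_sqrt)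
next
  case (Suc k)
  \<comment> \<open>The derivative of sqrt f is f' / (2 sqrt f), so the induction hypothesis is
    first passed through the inverse.\<close>
  have i: "C_k_on k (\<lambda>x. inverse (sqrt (f x))) S"
  proof (rule C_k_on_inverse[OF assms(1)])
    show "C_k_on k (\<lambda>x. sqrt (f x)) S" using Suc C_k_on_Suc_D by blast
    show "sqrt (f x) \<noteq> 0" if "x \<in> S" for x using assms(3)[OF that] by simp
  qed
  have d: "((\<lambda>x. sqrt (f x)) has_derivative
      (\<lambda>v. frechet_derivative f (at x) v * (inverse (sqrt (f x)) * (1/2)))) (at x)" if "x \<in> S" for x
    using assms(3)[OF that]
    by (auto intro!: derivative_eq_intros C_k_on_Suc_has_derivative[OF Suc.prems that] simp: divide_simps)
  have D: "C_k_on k (\<lambda>x. frechet_derivative f (at x) v * (inverse (sqrt (f x)) * (1/2))) S" for v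
    using Suc.prems i by (intro C_k_on_mult C_k_on_const assms(1)) simp_all
  show ?case by (rule C_k_on_SucI[OF assms(1) d D])
qed

lemma smooth_on_const: "smooth_on (\<lambda>x. c) S"
  and smooth_on_bounded_linear: "open S \<Longrightarrow> bounded_linear L \<Longrightarrow> smooth_on L S"
  and smooth_on_compose_bounded_linear:
    "open S \<Longrightarrow> bounded_linear h \<Longrightarrow> smooth_on f S \<Longrightarrow> smooth_on (\<lambda>x. h (f x)) S"
  and smooth_on_add: "open S \<Longrightarrow> smooth_on f S \<Longrightarrow> smooth_on f' S \<Longrightarrow> smooth_on (\<lambda>x. f x + f' x) S"
  and smooth_on_diff: "open S \<Longrightarrow> smooth_on f S \<Longrightarrow> smooth_on f' S \<Longrightarrow> smooth_on (\<lambda>x. f x - f' x) S"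
  and smooth_on_uminus: "open S \<Longrightarrow> smooth_on f S \<Longrightarrow> smooth_on (\<lambda>x. - f x) S"
  and smooth_on_sum: "open S \<Longrightarrow> (\<And>i. i \<in> I \<Longrightarrow> smooth_on (F i) S) \<Longrightarrow> smooth_on (\<lambda>x. \<Sum>i\<in>I. F i x) S"
  and smooth_on_cong: "open S \<Longrightarrow> (\<And>x. x \<in> S \<Longrightarrow> f x = f' x) \<Longrightarrow> smooth_on f S \<Longrightarrow> smooth_on f' S"
  and smooth_on_subset: "smooth_on f S \<Longrightarrow> T \<subseteq> S \<Longrightarrow> smooth_on f T"
  unfolding smooth_on_def
proof (goal_cases)
  case 1 show ?case using C_k_on_const by blast
next
  case 2 then show ?case using C_k_on_bounded_linear by blast
next
  case 3 then show ?case using C_k_on_compose_bounded_linear by blast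
next
  case 4 then show ?case using C_k_on_add by blast
next
  case 5 then show ?case using C_k_on_diff by blast
next
  case 6 then show ?case using C_k_on_uminus by blast
next
  case 7 then show ?case using C_k_on_sum[of S I] by blast
next
  case 8 then show ?case using C_k_on_cong by blast
next
  case 9 then show ?case using C_k_on_subset by blast
qed

lemma smooth_on_mult: "open S \<Longrightarrow> smooth_on p S \<Longrightarrow> smooth_on q S \<Longrightarrow> smooth_on (\<lambda>x. p x * q x) S"
  and smooth_on_prod: "open S \<Longrightarrow> (\<And>i. i \<in> I \<Longrightarrow> smooth_on (P i) S) \<Longrightarrow> smooth_on (\<lambda>x. \<Prod>i\<in>I. P i x) S"
  and smooth_on_inverse: "open S \<Longrightarrow> smooth_on p S \<Longrightarrow> (\<And>x. x \<in> S \<Longrightarrow> p x \<noteq> 0) \<Longrightarrow> smooth_on (\<lambda>x. inverse (p x)) S"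
  and smooth_on_sqrt: "open S \<Longrightarrow> smooth_on p S \<Longrightarrow> (\<And>x. x \<in> S \<Longrightarrow> p x > 0) \<Longrightarrow> smooth_on (\<lambda>x. sqrt (p x)) S"
  for p q :: "'e::real_normed_vector \<Rightarrow> real" and P :: "'i \<Rightarrow> 'e \<Rightarrow> real"
  unfolding smooth_on_def
proof (goal_cases)
  case 1 then show ?case using C_k_on_mult by blast
next
  case 2 then show ?case by (auto intro!: C_k_on_prod)
next
  case 3 then show ?case by (auto intro!: C_k_on_inverse)
next
  case 4 then show ?case by (auto intro!: C_k_on_sqrt)
qed

lemma smooth_on_differentiable: "smooth_on f S \<Longrightarrow> x \<in> S \<Longrightarrow> f differentiable (at x)"
  by (metis C_k_on.simps(2) smooth_on_def)

lemma smooth_on_has_derivative: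
  "smooth_on f S \<Longrightarrow> x \<in> S \<Longrightarrow> (f has_derivative frechet_derivative f (at x)) (at x)"
  using smooth_on_differentiable frechet_derivative_works by blast

lemma smooth_on_directional: "smooth_on f S \<Longrightarrow> smooth_on (\<lambda>x. frechet_derivative f (at x) v) S"
  unfolding smooth_on_def by (metis C_k_on.simps(2))

lemma smooth_on_partial: "smooth_on f S \<Longrightarrow> smooth_on (partial i f) S"
  unfolding partial_def[abs_def] by (rule smooth_on_directional)

lemma smooth_on_component: "open S \<Longrightarrow> smooth_on f S \<Longrightarrow> smooth_on (\<lambda>x. f x $ i) S"
  by (rule smooth_on_compose_bounded_linear[where h="\<lambda>v. v $ i", OF _ bounded_linear_vec_nth])

section \<open>Rules for coordinate partial derivatives\<close>

lemma partial_eqI: "(f has_derivative D) (at x) \<Longrightarrow> partial i f x = D (axis i 1)"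
  unfolding partial_def using frechet_derivative_at by metis

lemma partial_cong:
  assumes "open S" "x \<in> S" "\<And>y. y \<in> S \<Longrightarrow> f y = h y" "f differentiable (at x)"
  shows "partial i f x = partial i h x"
  unfolding partial_def using frechet_derivative_transform_within_open[OF assms(4,1,2,3)] by simp

lemma frechet_derivative_eq_sum_partial:
  fixes f :: "real ^ 'n::finite \<Rightarrow> real"
  assumes "f differentiable (at x)"
  shows "frechet_derivative f (at x) v = (\<Sum>i\<in>UNIV. v $ i * partial i f x)"
proof -
  have l: "linear (frechet_derivative f (at x))"
    using assms by (rule linear_frechet_derivative)
  have "v = (\<Sum>i\<in>UNIV. v $ i *\<^sub>R axis i 1)"
    by (metis basis_expansion scalar_mult_eq_scaleR)
  then have "frechet_derivative f (at x) v = (\<Sum>i\<in>UNIV. v $ i *\<^sub>R frechet_derivative f (at x) (axis i 1))"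
    using linear_sum[OF l] linear_cmul[OF l] by (metis (mono_tags, lifting) sum.cong)
  then show ?thesis by (simp add: partial_def)
qed

lemma partial_const [simp]: "partial i (\<lambda>x. c) x = 0"
  by (simp add: partial_def)

lemma partial_add:
  "f differentiable (at x) \<Longrightarrow> h differentiable (at x) \<Longrightarrow>
    partial i (\<lambda>x. f x + h x) x = partial i f x + partial i h x"
  unfolding frechet_derivative_works
  by (subst partial_eqI[OF has_derivative_add]) (auto simp: partial_def)

lemma partial_uminus:
  "f differentiable (at x) \<Longrightarrow> partial i (\<lambda>x. - f x) x = - partial i f x"
  unfolding frechet_derivative_works
  by (subst partial_eqI[OF has_derivative_minus]) (auto simp: partial_def)

lemma partial_diff:
  "f differentiable (at x) \<Longrightarrow> h differentiable (at x) \<Longrightarrow>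
    partial i (\<lambda>x. f x - h x) x = partial i f x - partial i h x"
  unfolding frechet_derivative_works
  by (subst partial_eqI[OF has_derivative_diff]) (auto simp: partial_def)

lemma partial_mult:
  "f differentiable (at x) \<Longrightarrow> h differentiable (at x) \<Longrightarrow>
    partial i (\<lambda>x. f x * h x) x = partial i f x * h x + f x * partial i h x"
  unfolding frechet_derivative_works
  by (subst partial_eqI[OF has_derivative_mult]) (auto simp: partial_def)

lemma partial_cmult:
  "f differentiable (at x) \<Longrightarrow> partial i (\<lambda>x. c * f x) x = c * partial i f x"
  using partial_mult[of "\<lambda>_. c" x f i] by simp

lemma partial_sum:
  assumes "\<And>j. j \<in> J \<Longrightarrow> F j differentiable (at x)"
  shows "partial i (\<lambda>x. \<Sum>j\<in>J. F j x) x = (\<Sum>j\<in>J. partial i (F j) x)"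
proof -
  have "((\<lambda>x. \<Sum>j\<in>J. F j x) has_derivative (\<lambda>v. \<Sum>j\<in>J. frechet_derivative (F j) (at x) v)) (at x)"
    using assms by (intro has_derivative_sum) (simp add: frechet_derivative_works)
  from partial_eqI[OF this] show ?thesis by (simp add: partial_def)
qed

text \<open>The second difference over a parallelogram with sides h u and h v is symmetric in
  \<open>u\<close> and \<open>v\<close>, whereas the right-hand side is one of the two mixed
  derivatives. The mean value theorem is applied once in each direction.\<close>

lemma second_difference_mvt:
  fixes f :: "'e::real_normed_vector \<Rightarrow> real"
  assumes h: "h > 0"
    and S: "\<And>s t. 0 \<le> s \<Longrightarrow> s \<le> h \<Longrightarrow> 0 \<le> t \<Longrightarrow> t \<le> h \<Longrightarrow> x + s *\<^sub>R u + t *\<^sub>R v \<in> S"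
    and f: "C_k_on (Suc (Suc 0)) f S"
  obtains s t where "0 < s" "s < h" "0 < t" "t < h"
    "f (x + h *\<^sub>R u + h *\<^sub>R v) - f (x + h *\<^sub>R u) - f (x + h *\<^sub>R v) + f x =
      h * h * frechet_derivative (\<lambda>y. frechet_derivative f (at y) u) (at (x + s *\<^sub>R u + t *\<^sub>R v)) v"
proof -
  define F where "F s = f (x + s *\<^sub>R u + h *\<^sub>R v) - f (x + s *\<^sub>R u)" for s
  define g where "g = (\<lambda>y. frechet_derivative f (at y) u)"
  have g: "C_k_on (Suc 0) g S" using f unfolding g_def C_k_on.simps(2)[of "Suc 0" f] by blast
  have df: "((\<lambda>s. f (x + s *\<^sub>R u + c *\<^sub>R v)) has_real_derivative g (x + s *\<^sub>R u + c *\<^sub>R v)) (at s)"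
    if "0 \<le> s" "s \<le> h" "0 \<le> c" "c \<le> h" for s c
  proof -
    have d: "(f has_derivative frechet_derivative f (at (x + s *\<^sub>R u + c *\<^sub>R v))) (at (x + s *\<^sub>R u + c *\<^sub>R v))"
      using C_k_on_Suc_has_derivative[OF f S[OF that]] .
    have "((\<lambda>s. f (x + s *\<^sub>R u + c *\<^sub>R v)) has_derivative
      (\<lambda>r. frechet_derivative f (at (x + s *\<^sub>R u + c *\<^sub>R v)) (r *\<^sub>R u))) (at s)"
      by (rule has_derivative_compose[where f="\<lambda>s. x + s *\<^sub>R u + c *\<^sub>R v" and g=f, OF _ d]) (auto intro!: derivative_eq_intros)
    moreover have "frechet_derivative f (at (x + s *\<^sub>R u + c *\<^sub>R v)) (r *\<^sub>R u) = g (x + s *\<^sub>R u + c *\<^sub>R v) * r" for r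
      using linear_cmul[OF has_derivative_linear[OF d]] by (simp add: g_def)
    ultimately show ?thesis by (simp add: has_field_derivative_def)
  qed
  have "\<exists>s>0. s < h \<and> F h - F 0 = (h - 0) * (g (x + s *\<^sub>R u + h *\<^sub>R v) - g (x + s *\<^sub>R u))"
  proof (rule MVT2[OF h])
    fix s assume "0 \<le> s" "s \<le> h"
    then show "(F has_real_derivative g (x + s *\<^sub>R u + h *\<^sub>R v) - g (x + s *\<^sub>R u)) (at s)"
      unfolding F_def using df[of s h] df[of s 0] h by (auto intro!: derivative_eq_intros)
  qed
  then obtain s where s: "0 < s" "s < h" "F h - F 0 = h * (g (x + s *\<^sub>R u + h *\<^sub>R v) - g (x + s *\<^sub>R u))"
    by auto
  have "\<exists>t>0. t < h \<and> g (x + s *\<^sub>R u + h *\<^sub>R v) - g (x + s *\<^sub>R u + 0 *\<^sub>R v) =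
      (h - 0) * frechet_derivative g (at (x + s *\<^sub>R u + t *\<^sub>R v)) v"
  proof (rule MVT2[OF h])
    fix t assume t: "0 \<le> t" "t \<le> h"
    have d: "(g has_derivative frechet_derivative g (at (x + s *\<^sub>R u + t *\<^sub>R v))) (at (x + s *\<^sub>R u + t *\<^sub>R v))"
      using C_k_on_Suc_has_derivative[OF g S] s t by simp
    have "((\<lambda>t. g (x + s *\<^sub>R u + t *\<^sub>R v)) has_derivative
      (\<lambda>r. frechet_derivative g (at (x + s *\<^sub>R u + t *\<^sub>R v)) (r *\<^sub>R v))) (at t)"
      by (rule has_derivative_compose[where f="\<lambda>t. x + s *\<^sub>R u + t *\<^sub>R v" and g=g, OF _ d]) (auto intro!: derivative_eq_intros)
    moreover have "frechet_derivative g (at (x + s *\<^sub>R u + t *\<^sub>R v)) (r *\<^sub>R v) =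
        frechet_derivative g (at (x + s *\<^sub>R u + t *\<^sub>R v)) v * r" for r
      using linear_cmul[OF has_derivative_linear[OF d]] by simp
    ultimately show "((\<lambda>t. g (x + s *\<^sub>R u + t *\<^sub>R v)) has_real_derivative
        frechet_derivative g (at (x + s *\<^sub>R u + t *\<^sub>R v)) v) (at t)"
      by (simp add: has_field_derivative_def)
  qed
  then obtain t where t: "0 < t" "t < h" "g (x + s *\<^sub>R u + h *\<^sub>R v) - g (x + s *\<^sub>R u) =
      h * frechet_derivative g (at (x + s *\<^sub>R u + t *\<^sub>R v)) v"
    by auto
  show thesis
    by (rule that[OF s(1,2) t(1,2)]) (use s(3) t(3) in \<open>simp add: F_def g_def algebra_simps\<close>)
qed

text \<open>Evaluating the second difference in both orders makes the two mixed derivatives agree at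
  two points close to \<open>x\<close>, which continuity forbids if they differ at
  \<open>x\<close>.\<close>

lemma frechet_derivative_commute:
  fixes f :: "'e::real_normed_vector \<Rightarrow> real"
  assumes S: "open S" "x \<in> S" and f: "C_k_on (Suc (Suc 0)) f S"
  shows "frechet_derivative (\<lambda>y. frechet_derivative f (at y) u) (at x) v =
    frechet_derivative (\<lambda>y. frechet_derivative f (at y) v) (at x) u"
proof (rule ccontr)
  define A where "A u v y = frechet_derivative (\<lambda>y. frechet_derivative f (at y) u) (at y) v" for u v y
  assume "\<not> ?thesis"
  then have e: "0 < dist (A u v x) (A v u x) / 2" (is "0 < ?e") by (simp add: A_def)
  have "continuous_on S (A u v)" "continuous_on S (A v u)"
    using f unfolding A_def by auto
  then obtain d1 d2 where "0 < d1" "0 < d2"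
    and d1: "\<And>y. y \<in> S \<Longrightarrow> dist y x < d1 \<Longrightarrow> dist (A u v y) (A u v x) < ?e"
    and d2: "\<And>y. y \<in> S \<Longrightarrow> dist y x < d2 \<Longrightarrow> dist (A v u y) (A v u x) < ?e"
    using S e unfolding continuous_on_iff by metis
  obtain d3 where "0 < d3" and d3: "ball x d3 \<subseteq> S"
    using S open_contains_ball by blast
  define d where "d = min d1 (min d2 d3)"
  \<comment> \<open>Small enough for the parallelogram spanned by h u and h v at \<open>x\<close> to
    stay within distance \<open>d\<close>; the summand 1 keeps the denominator positive when
    \<open>u\<close> and \<open>v\<close> both vanish.\<close>
  define h where "h = d / (2 * (norm u + norm v + 1))"
  have nn: "0 < norm u + norm v + 1" by (smt (verit) norm_ge_zero)
  have d: "0 < d" using \<open>0 < d1\<close> \<open>0 < d2\<close> \<open>0 < d3\<close> by (simp add: d_def)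
  have h: "0 < h" using d nn by (simp add: h_def)
  have close: "dist (x + s *\<^sub>R a + t *\<^sub>R b) x < d" "x + s *\<^sub>R a + t *\<^sub>R b \<in> S"
    if st: "0 \<le> s" "s \<le> h" "0 \<le> t" "t \<le> h" and ab: "{a, b} = {u, v}" for s t a b
  proof -
    have "norm (s *\<^sub>R a + t *\<^sub>R b) \<le> s * norm a + t * norm b"
      using norm_triangle_ineq[of "s *\<^sub>R a" "t *\<^sub>R b"] st by simp
    also have "\<dots> \<le> h * norm a + h * norm b"
      using st by (intro add_mono mult_right_mono) auto
    also have "\<dots> = h * (norm u + norm v)"
      using ab by (auto simp: doubleton_eq_iff algebra_simps)
    also have "\<dots> < h * (2 * (norm u + norm v + 1))"
      using h nn by (intro mult_strict_left_mono) auto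
    also have "\<dots> = d" using nn by (simp add: h_def)
    finally show "dist (x + s *\<^sub>R a + t *\<^sub>R b) x < d" by (simp add: dist_norm add.assoc)
    then show "x + s *\<^sub>R a + t *\<^sub>R b \<in> S"
      using d3 by (auto simp: d_def dist_commute subset_iff)
  qed
  obtain s t where st: "0 < s" "s < h" "0 < t" "t < h"
    and 1: "f (x + h *\<^sub>R u + h *\<^sub>R v) - f (x + h *\<^sub>R u) - f (x + h *\<^sub>R v) + f x =
      h * h * A u v (x + s *\<^sub>R u + t *\<^sub>R v)"
    using second_difference_mvt[OF h close(2) f, of u v] unfolding A_def by blast
  obtain s' t' where st': "0 < s'" "s' < h" "0 < t'" "t' < h"
    and 2: "f (x + h *\<^sub>R v + h *\<^sub>R u) - f (x + h *\<^sub>R v) - f (x + h *\<^sub>R u) + f x =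
      h * h * A v u (x + s' *\<^sub>R v + t' *\<^sub>R u)"
    using second_difference_mvt[OF h close(2) f, of v u] unfolding A_def by blast
  have c: "x + h *\<^sub>R v + h *\<^sub>R u = x + h *\<^sub>R u + h *\<^sub>R v" by simp
  have "h * h * A u v (x + s *\<^sub>R u + t *\<^sub>R v) = h * h * A v u (x + s' *\<^sub>R v + t' *\<^sub>R u)"
    using 1 2[unfolded c] by linarith
  then have "A u v (x + s *\<^sub>R u + t *\<^sub>R v) = A v u (x + s' *\<^sub>R v + t' *\<^sub>R u)"
    using h by simp
  moreover have "dist (A u v (x + s *\<^sub>R u + t *\<^sub>R v)) (A u v x) < ?e"
    using close[of s t u v] st by (intro d1) (auto simp: d_def)
  moreover have "dist (A v u (x + s' *\<^sub>R v + t' *\<^sub>R u)) (A v u x) < ?e"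
    using close[of s' t' v u] st' by (intro d2) (auto simp: d_def)
  ultimately show False by (smt (verit) dist_commute dist_triangle field_sum_of_halves)
qed

lemma partial_commute:
  assumes "open S" "smooth_on f S" "x \<in> S"
  shows "partial i (partial j f) x = partial j (partial i f) x"
  using frechet_derivative_commute[OF assms(1,3), of f] assms(2)
  unfolding partial_def[abs_def] smooth_on_def by blast

section \<open>Matrices and matrix-valued functions\<close>

lemma mat_mult_add_left: "A ** (B + C) = A ** B + A ** C"
  and mat_mult_add_right: "(B + C) ** D = B ** D + C ** D"
  and mat_mult_diff_left: "A ** (B - C) = A ** B - A ** C"
  and mat_mult_diff_right: "(B - C) ** D = B ** D - C ** D"
  and mat_mult_uminus_left: "A ** (- B) = - (A ** B)"
  and mat_mult_uminus_right: "(- B) ** D = - (B ** D)"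
  for A B C D :: "real ^ 'n ^ 'n::finite"
  by (simp_all add: matrix_matrix_mult_def vec_eq_iff sum.distrib sum_subtractf sum_negf algebra_simps)

lemma mat_mult_zero: "0 ** A = 0"
  for A :: "real ^ 'n ^ 'n::finite"
  by (simp_all add: matrix_matrix_mult_def vec_eq_iff)

lemma mat_mult_scaleR_left: "A ** (c *\<^sub>R B) = c *\<^sub>R (A ** B)"
  and mat_mult_scaleR_right: "(c *\<^sub>R B) ** A = c *\<^sub>R (B ** A)"
  for A B :: "real ^ 'n ^ 'n::finite"
  by (simp_all add: matrix_matrix_mult_def vec_eq_iff sum_distrib_left ac_simps)

lemma transpose_add: "transpose (B + C) = transpose B + transpose C"
  and transpose_diff: "transpose (B - C) = transpose B - transpose C"
  and transpose_uminus: "transpose (- B) = - transpose B"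
  for B C :: "real ^ 'n ^ 'n::finite"
  by (simp_all add: transpose_def vec_eq_iff)

lemmas matrix_ring_simps = mat_mult_add_left mat_mult_add_right mat_mult_diff_left mat_mult_diff_right
  mat_mult_uminus_left mat_mult_uminus_right matrix_mul_assoc

lemma transpose_eqD: "transpose A = A \<Longrightarrow> A $ i $ j = A $ j $ i"
  by (simp add: vec_eq_iff transpose_def)

lemma trace_transpose: "trace (transpose A) = trace A"
  by (simp add: trace_def transpose_def)

lemma trace_scaleR: "trace (c *\<^sub>R A) = c * trace A" for A :: "real ^ 'n ^ 'n::finite"
  by (simp add: trace_def sum_distrib_left)

lemma trace_mult_eq_sum: "trace (A ** B) = (\<Sum>i\<in>UNIV. \<Sum>j\<in>UNIV. A $ i $ j * B $ j $ i)"
  by (simp add: trace_def matrix_matrix_mult_def)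

lemma matrix_inv_right_left:
  fixes A :: "real ^ 'n ^ 'n::finite"
  assumes "det A \<noteq> 0"
  shows "A ** matrix_inv A = mat 1" "matrix_inv A ** A = mat 1"
proof -
  obtain B where "A ** B = mat 1 \<and> B ** A = mat 1"
    using assms invertible_det_nz[of A] unfolding invertible_def by blast
  then have "A ** matrix_inv A = mat 1 \<and> matrix_inv A ** A = mat 1"
    unfolding matrix_inv_def by (rule someI)
  then show "A ** matrix_inv A = mat 1" "matrix_inv A ** A = mat 1" by auto
qed

lemma matrix_inv_eqI:
  fixes A B :: "real ^ 'n ^ 'n::finite"
  assumes "A ** B = mat 1"
  shows "matrix_inv A = B"
proof -
  have "det A * det B = 1" using assms by (metis det_I det_mul)
  then have "matrix_inv A ** A = mat 1" by (intro matrix_inv_right_left) auto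
  then show ?thesis using assms by (metis matrix_mul_assoc matrix_mul_lid matrix_mul_rid)
qed

lemma det_nonzero_if_posdef:
  fixes A :: "real ^ 'n ^ 'n::finite"
  assumes "\<And>v. v \<noteq> 0 \<Longrightarrow> v \<bullet> (A *v v) > 0"
  shows "det A \<noteq> 0"
proof -
  have "v = 0" if "A *v v = 0" for v
    using assms[of v] that by (metis inner_zero_right less_irrefl)
  then have "\<exists>B. B ** A = mat 1" by (simp add: matrix_left_invertible_ker)
  then show ?thesis using invertible_det_nz invertible_left_inverse by blast
qed

lemma transpose_matrix_inv:
  fixes A :: "real ^ 'n ^ 'n::finite"
  assumes "det A \<noteq> 0" "transpose A = A"
  shows "transpose (matrix_inv A) = matrix_inv A"
proof -
  have "A ** transpose (matrix_inv A) = transpose (matrix_inv A ** A)"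
    by (simp add: matrix_transpose_mul assms(2))
  also have "\<dots> = mat 1" using matrix_inv_right_left[OF assms(1)] by (simp add: transpose_mat)
  finally show ?thesis using matrix_inv_eqI by metis
qed

lemma matrix_inv_posdef:
  fixes A :: "real ^ 'n ^ 'n::finite"
  assumes "\<And>v. v \<noteq> 0 \<Longrightarrow> v \<bullet> (A *v v) > 0" "v \<noteq> 0"
  shows "v \<bullet> (matrix_inv A *v v) > 0"
proof -
  define u where "u = matrix_inv A *v v"
  have v: "A *v u = v"
    using matrix_inv_right_left[OF det_nonzero_if_posdef[OF assms(1)]]
    by (simp add: u_def matrix_vector_mul_assoc)
  then have "u \<noteq> 0" using assms(2) by auto
  then have "u \<bullet> (A *v u) > 0" by (rule assms(1))
  then show ?thesis by (simp add: v u_def[symmetric] inner_commute)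
qed

lemma psd_gram_on:
  fixes B :: "real ^ 'n ^ 'n::finite"
  assumes "finite I" "transpose B = B" "\<And>v. v \<bullet> (B *v v) \<ge> 0" "\<And>i j. i \<notin> I \<Longrightarrow> B $ i $ j = 0"
  shows "\<exists>p :: 'n \<Rightarrow> real ^ 'n. B = (\<chi> i j. \<Sum>k\<in>I. p k $ i * p k $ j)"
  using assms
proof (induction I arbitrary: B rule: finite_induct)
  case empty
  then show ?case by (auto simp: vec_eq_iff)
next
  case (insert a I)
  have sym: "B $ i $ j = B $ j $ i" for i j
    using insert.prems(1) by (rule transpose_eqD)
  define b where "b = B *v axis a 1"
  have b: "b $ i = B $ i $ a" for i
    by (simp add: b_def matrix_vector_mult_basis column_def)
  have bB: "axis a 1 \<bullet> (B *v v) = b \<bullet> v" for v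
  proof -
    have "axis a 1 \<bullet> (B *v v) = (B *v v) $ a" by (simp add: inner_axis')
    also have "\<dots> = b \<bullet> v" by (simp add: matrix_vector_mult_def inner_vec_def b sym[of a])
    finally show ?thesis .
  qed
  have quad: "(v - t *\<^sub>R axis a 1) \<bullet> (B *v (v - t *\<^sub>R axis a 1)) =
      v \<bullet> (B *v v) - 2 * t * (b \<bullet> v) + t * t * B $ a $ a" for v t
  proof -
    have 1: "B *v (v - t *\<^sub>R axis a 1) = B *v v - t *\<^sub>R b"
      by (simp add: b_def linear_diff[OF matrix_vector_mul_linear] linear_cmul[OF matrix_vector_mul_linear])
    have "axis a 1 \<bullet> b = B $ a $ a" by (simp add: inner_axis' b)
    then show ?thesis
      unfolding 1 by (simp add: inner_diff_left inner_diff_right bB inner_commute[of v b] algebra_simps)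
  qed
  show ?case
  proof (cases "B $ a $ a = 0")
    case True
    \<comment> \<open>A zero diagonal entry forces its whole row to vanish: otherwise the quadratic
      form along e_i - t e_a is affine in t with nonzero slope. The value of t below makes it equal
      to -1.\<close>
    have "B $ i $ a = 0" for i
    proof (rule ccontr)
      assume "B $ i $ a \<noteq> 0"
      then have "axis i 1 \<bullet> (B *v axis i 1) - 2 * ((axis i 1 \<bullet> (B *v axis i 1) + 1) / (2 * B $ i $ a)) * (b \<bullet> axis i 1) = -1"
        by (simp add: inner_axis b field_simps)
      then show False
        using insert.prems(2)[of "axis i 1 - ((axis i 1 \<bullet> (B *v axis i 1) + 1) / (2 * B $ i $ a)) *\<^sub>R axis a 1"]
        unfolding quad True by simp
    qed
    then have "B $ i $ j = 0" if "i \<notin> I" for i j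
      using that insert.prems(3)[of i j] sym[of a j] by (cases "i = a") auto
    then obtain p where p: "B = (\<chi> i j. \<Sum>k\<in>I. p k $ i * p k $ j)"
      using insert.IH[of B] insert.prems by blast
    have "B = (\<chi> i j. \<Sum>k\<in>insert a I. (p(a := 0)) k $ i * (p(a := 0)) k $ j)"
      using insert.hyps by (subst p) (auto simp: vec_eq_iff intro!: sum.cong)
    then show ?thesis by blast
  next
    case False
    have "axis a 1 \<bullet> (B *v axis a 1) = B $ a $ a" by (simp add: b_def[symmetric] inner_axis' b)
    then have pos: "B $ a $ a > 0" using insert.prems(2)[of "axis a 1"] False by simp
    \<comment> \<open>The Schur complement of the pivot: its quadratic form at v is the minimum over
      t of the form of \<open>B\<close> at v - t e_a, hence still nonnegative.\<close>
    define B' where "B' = (\<chi> i j. B $ i $ j - B $ i $ a * B $ j $ a / B $ a $ a)"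
    have "transpose B' = B'"
      by (simp add: vec_eq_iff B'_def transpose_def sym mult.commute)
    moreover have "v \<bullet> (B' *v v) \<ge> 0" for v
    proof -
      have "B' *v v = B *v v - ((b \<bullet> v) / B $ a $ a) *\<^sub>R b"
        by (simp add: vec_eq_iff B'_def matrix_vector_mult_def inner_vec_def b sum_subtractf
            sum_distrib_left sum_divide_distrib algebra_simps)
      then have "v \<bullet> (B' *v v) = v \<bullet> (B *v v) - (b \<bullet> v) * (b \<bullet> v) / B $ a $ a"
        by (simp add: inner_diff_right inner_commute)
      also have "\<dots> = (v - ((b \<bullet> v) / B $ a $ a) *\<^sub>R axis a 1) \<bullet> (B *v (v - ((b \<bullet> v) / B $ a $ a) *\<^sub>R axis a 1))"
        unfolding quad using pos by (simp add: field_simps)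
      finally show ?thesis using insert.prems(2) by simp
    qed
    moreover have "B' $ i $ j = 0" if "i \<notin> I" for i j
      using that insert.prems(3)[of i] pos sym[of a j] by (cases "i = a") (auto simp: B'_def)
    ultimately obtain p where p: "B' = (\<chi> i j. \<Sum>k\<in>I. p k $ i * p k $ j)"
      using insert.IH[of B'] by blast
    define q where "q = p(a := (1 / sqrt (B $ a $ a)) *\<^sub>R b)"
    have "(\<Sum>k\<in>I. q k $ i * q k $ j) = B' $ i $ j" for i j
      using insert.hyps by (subst p) (auto simp: q_def intro!: sum.cong)
    moreover have "q a $ i * q a $ j = B $ i $ a * B $ j $ a / B $ a $ a" for i j
      using pos by (simp add: q_def b)
    ultimately have "B = (\<chi> i j. \<Sum>k\<in>insert a I. q k $ i * q k $ j)"
      using insert.hyps by (simp add: vec_eq_iff B'_def)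
    then show ?thesis by blast
  qed
qed

lemma psd_gram:
  fixes B :: "real ^ 'n ^ 'n::finite"
  assumes "transpose B = B" "\<And>v. v \<bullet> (B *v v) \<ge> 0"
  obtains P :: "real ^ 'n ^ 'n" where "B = P ** transpose P"
proof -
  obtain p :: "'n \<Rightarrow> real ^ 'n" where "B = (\<chi> i j. \<Sum>k\<in>UNIV. p k $ i * p k $ j)"
    using psd_gram_on[OF finite assms] by auto
  then have "B = (\<chi> i k. p k $ i) ** transpose (\<chi> i k. p k $ i)"
    by (simp add: matrix_matrix_mult_def transpose_def)
  then show thesis by (rule that)
qed

text \<open>If \<open>G\<close> is the inverse of a metric, this trace is the squared norm of the
  symmetric 2-tensor \<open>L\<close>. Writing G = P P^T turns it into the sum of the squared
  entries of P^T L P.\<close>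

lemma trace_square_metric:
  fixes G L :: "real ^ 'n ^ 'n::finite"
  assumes G: "transpose G = G" "\<And>v. v \<noteq> 0 \<Longrightarrow> v \<bullet> (G *v v) > 0" and L: "transpose L = L"
  shows "trace (G ** L ** G ** L) \<ge> 0" "trace (G ** L ** G ** L) = 0 \<Longrightarrow> L = 0"
proof -
  have nonneg: "v \<bullet> (G *v v) \<ge> 0" for v
    using G(2)[of v] by (cases "v = 0") auto
  obtain P :: "real ^ 'n ^ 'n" where P: "G = P ** transpose P"
    by (rule psd_gram[OF G(1) nonneg])
  define N where "N = transpose P ** L ** P"
  have "transpose N = N" by (simp add: N_def matrix_transpose_mul L matrix_mul_assoc)
  then have N: "N $ i $ j = N $ j $ i" for i j by (rule transpose_eqD)
  have "trace (G ** L ** G ** L) = trace (P ** (transpose P ** L ** P ** transpose P ** L))"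
    unfolding P by (simp only: matrix_mul_assoc)
  also have "\<dots> = trace ((transpose P ** L ** P ** transpose P ** L) ** P)" by (rule trace_mul_sym)
  also have "\<dots> = trace (N ** N)" unfolding N_def by (simp only: matrix_mul_assoc)
  also have "\<dots> = (\<Sum>i\<in>UNIV. \<Sum>j\<in>UNIV. (N $ i $ j)\<^sup>2)"
    by (simp add: trace_mult_eq_sum power2_eq_square N)
  finally have tr: "trace (G ** L ** G ** L) = (\<Sum>i\<in>UNIV. \<Sum>j\<in>UNIV. (N $ i $ j)\<^sup>2)" .
  show "trace (G ** L ** G ** L) \<ge> 0" by (simp add: tr sum_nonneg)
  show "L = 0" if "trace (G ** L ** G ** L) = 0"
  proof -
    have "N $ i $ j = 0" for i j
      using that unfolding tr by (simp add: sum_nonneg_eq_0_iff sum_nonneg)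
    then have "N = 0" by (simp add: vec_eq_iff)
    moreover have "G ** L ** G = P ** N ** transpose P"
      unfolding N_def P by (simp only: matrix_mul_assoc)
    ultimately have "matrix_inv G ** (G ** L ** G) ** matrix_inv G = 0"
      by (simp add: mat_mult_zero)
    moreover have "matrix_inv G ** (G ** L ** G) ** matrix_inv G =
        (matrix_inv G ** G) ** L ** (G ** matrix_inv G)"
      by (simp add: matrix_mul_assoc)
    ultimately show "L = 0"
      using matrix_inv_right_left[OF det_nonzero_if_posdef[OF G(2)]] by simp
  qed
qed

section \<open>Matrix-valued functions, differentiated entrywise\<close>

definition mat_partial ::
  "'n::finite \<Rightarrow> (real ^ 'n \<Rightarrow> real ^ 'm ^ 'm::finite) \<Rightarrow> real ^ 'n \<Rightarrow> real ^ 'm ^ 'm" where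
  "mat_partial i A x = (\<chi> a b. partial i (\<lambda>y. A y $ a $ b) x)"

definition mat_smooth_on :: "(real ^ 'n::finite \<Rightarrow> real ^ 'm ^ 'm::finite) \<Rightarrow> (real ^ 'n) set \<Rightarrow> bool" where
  "mat_smooth_on A U \<longleftrightarrow> (\<forall>a b. smooth_on (\<lambda>y. A y $ a $ b) U)"

lemma mat_smooth_onD: "mat_smooth_on A U \<Longrightarrow> smooth_on (\<lambda>y. A y $ a $ b) U"
  by (simp add: mat_smooth_on_def)

lemma smooth_on_imp_mat_smooth_on:
  assumes "open U" "smooth_on A U" shows "mat_smooth_on A U"
  unfolding mat_smooth_on_def using smooth_on_component[OF assms(1) smooth_on_component[OF assms]] by blast

lemma mat_smooth_on_mult:
  "open U \<Longrightarrow> mat_smooth_on A U \<Longrightarrow> mat_smooth_on B U \<Longrightarrow> mat_smooth_on (\<lambda>y. A y ** B y) U"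
  by (simp add: mat_smooth_on_def matrix_matrix_mult_def smooth_on_sum smooth_on_mult)

lemma mat_smooth_on_add:
  "open U \<Longrightarrow> mat_smooth_on A U \<Longrightarrow> mat_smooth_on B U \<Longrightarrow> mat_smooth_on (\<lambda>y. A y + B y) U"
  by (simp add: mat_smooth_on_def smooth_on_add)

lemma mat_smooth_on_diff:
  "open U \<Longrightarrow> mat_smooth_on A U \<Longrightarrow> mat_smooth_on B U \<Longrightarrow> mat_smooth_on (\<lambda>y. A y - B y) U"
  by (simp add: mat_smooth_on_def smooth_on_diff)

lemma mat_smooth_on_transpose: "mat_smooth_on A U \<Longrightarrow> mat_smooth_on (\<lambda>y. transpose (A y)) U"
  by (simp add: mat_smooth_on_def transpose_def)

lemma mat_smooth_on_mat_partial: "mat_smooth_on A U \<Longrightarrow> mat_smooth_on (mat_partial i A) U"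
  by (simp add: mat_smooth_on_def mat_partial_def smooth_on_partial)

lemma mat_smooth_on_cong:
  "open U \<Longrightarrow> (\<And>y. y \<in> U \<Longrightarrow> A y = B y) \<Longrightarrow> mat_smooth_on A U \<Longrightarrow> mat_smooth_on B U"
  unfolding mat_smooth_on_def by (metis (mono_tags, lifting) smooth_on_cong)

lemma smooth_on_trace: "open U \<Longrightarrow> mat_smooth_on A U \<Longrightarrow> smooth_on (\<lambda>y. trace (A y)) U"
  by (simp add: mat_smooth_on_def trace_def smooth_on_sum)

lemma mat_smooth_on_mult_vec:
  "open U \<Longrightarrow> mat_smooth_on A U \<Longrightarrow> (\<And>j. smooth_on (\<lambda>y. v y $ j) U) \<Longrightarrow> smooth_on (\<lambda>y. (A y *v v y) $ i) U"
  by (simp add: mat_smooth_on_def matrix_vector_mult_def smooth_on_sum smooth_on_mult)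

context
  fixes U :: "(real ^ 'n::finite) set" and x :: "real ^ 'n"
  assumes U: "open U" "x \<in> U"
begin

lemma mat_partial_mult:
  assumes "mat_smooth_on A U" "mat_smooth_on B U"
  shows "mat_partial i (\<lambda>y. A y ** B y) x = mat_partial i A x ** B x + A x ** mat_partial i B x"
  using assms unfolding mat_smooth_on_def
  by (simp add: mat_partial_def vec_eq_iff matrix_matrix_mult_def partial_sum partial_mult
      smooth_on_differentiable[OF _ U(2)] smooth_on_mult[OF U(1)] sum.distrib)

lemma mat_partial_add:
  assumes "mat_smooth_on A U" "mat_smooth_on B U"
  shows "mat_partial i (\<lambda>y. A y + B y) x = mat_partial i A x + mat_partial i B x"
  using assms unfolding mat_smooth_on_def
  by (simp add: mat_partial_def vec_eq_iff partial_add smooth_on_differentiable[OF _ U(2)])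

lemma mat_partial_diff:
  assumes "mat_smooth_on A U" "mat_smooth_on B U"
  shows "mat_partial i (\<lambda>y. A y - B y) x = mat_partial i A x - mat_partial i B x"
  using assms unfolding mat_smooth_on_def
  by (simp add: mat_partial_def vec_eq_iff partial_diff smooth_on_differentiable[OF _ U(2)])

lemma mat_partial_transpose: "mat_partial i (\<lambda>y. transpose (A y)) x = transpose (mat_partial i A x)"
  by (simp add: mat_partial_def transpose_def)

lemma mat_partial_cong:
  assumes "mat_smooth_on A U" "\<And>y. y \<in> U \<Longrightarrow> A y = B y"
  shows "mat_partial i A x = mat_partial i B x"
proof -
  have "partial i (\<lambda>y. A y $ a $ b) x = partial i (\<lambda>y. B y $ a $ b) x" for a b
    by (rule partial_cong[OF U])
       (use assms(2) smooth_on_differentiable[OF mat_smooth_onD[OF assms(1)] U(2)] in auto)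
  then show ?thesis by (simp add: mat_partial_def)
qed

lemma mat_partial_commute:
  assumes "mat_smooth_on A U"
  shows "mat_partial i (mat_partial j A) x = mat_partial j (mat_partial i A) x"
  using partial_commute[OF U(1) mat_smooth_onD[OF assms] U(2)]
  by (simp add: mat_partial_def[abs_def])

lemma partial_trace:
  assumes "mat_smooth_on A U"
  shows "partial i (\<lambda>y. trace (A y)) x = trace (mat_partial i A x)"
  using assms unfolding mat_smooth_on_def
  by (simp add: mat_partial_def trace_def partial_sum smooth_on_differentiable[OF _ U(2)])

end

section \<open>Derivatives of determinants, inverses and volume densities\<close>

lemma smooth_on_det:
  assumes "open U" "mat_smooth_on A U"
  shows "smooth_on (\<lambda>y. det (A y)) U"
  unfolding det_def
  by (intro smooth_on_sum smooth_on_mult smooth_on_prod smooth_on_const mat_smooth_onD assms)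

text \<open>Cramer's rule writes the (k, l) entry of the inverse as a quotient of determinants;
  \<open>B\<close> is \<open>A\<close> with column \<open>k\<close> replaced by the l-th unit
  vector.\<close>

lemma mat_smooth_on_matrix_inv:
  assumes U: "open U" and A: "mat_smooth_on A U" and d: "\<And>y. y \<in> U \<Longrightarrow> det (A y) \<noteq> 0"
  shows "mat_smooth_on (\<lambda>y. matrix_inv (A y)) U"
  unfolding mat_smooth_on_def
proof (intro allI)
  fix k l
  define B where "B y = (\<chi> i j. if j = k then axis l 1 $ i else A y $ i $ j)" for y
  have e: "det (B y) * inverse (det (A y)) = matrix_inv (A y) $ k $ l" if "y \<in> U" for y
  proof -
    have "A y *v (matrix_inv (A y) *v axis l 1) = axis l 1"
      using matrix_inv_right_left[OF d[OF that]] by (simp add: matrix_vector_mul_assoc)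
    then have "matrix_inv (A y) *v axis l 1 = (\<chi> k. det (\<chi> i j. if j = k then axis l 1 $ i else A y $ i $ j) / det (A y))"
      using cramer[OF d[OF that]] by blast
    then have "(matrix_inv (A y) *v axis l 1) $ k = det (B y) / det (A y)"
      by (simp add: B_def)
    then show ?thesis by (simp add: matrix_vector_mult_basis column_def divide_inverse)
  qed
  have "mat_smooth_on B U"
    unfolding mat_smooth_on_def
  proof (intro allI)
    fix a b show "smooth_on (\<lambda>y. B y $ a $ b) U"
      by (cases "b = k") (simp_all add: B_def smooth_on_const mat_smooth_onD[OF A])
  qed
  then have "smooth_on (\<lambda>y. det (B y) * inverse (det (A y))) U"
    using U d by (intro smooth_on_mult smooth_on_inverse smooth_on_det A) auto
  then show "smooth_on (\<lambda>y. matrix_inv (A y) $ k $ l) U"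
    by (rule smooth_on_cong[OF U, rotated]) (rule e)
qed

text \<open>Jacobi's formula. Differentiating row by row gives determinants in which row
  \<open>i\<close> of \<open>A\<close> is replaced by row \<open>i\<close> of the derivative
  \<open>H\<close>; expanding that row in the rows of \<open>A\<close> keeps only the diagonal
  coefficient.\<close>

lemma partial_det:
  fixes A :: "real ^ 'n::finite \<Rightarrow> real ^ 'm ^ 'm::finite"
  assumes U: "open U" "x \<in> U" and A: "mat_smooth_on A U" and d: "det (A x) \<noteq> 0"
  shows "partial k (\<lambda>y. det (A y)) x = det (A x) * trace (matrix_inv (A x) ** mat_partial k A x)"
proof -
  define H where "H = mat_partial k A x"
  let ?P = "{p. p permutes (UNIV :: 'm set)}"
  have dA: "(\<lambda>y. A y $ i $ j) differentiable (at x)" for i j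
    using smooth_on_differentiable[OF mat_smooth_onD[OF A] U(2)] .
  have "((\<lambda>y. det (A y)) has_derivative (\<lambda>v. \<Sum>p\<in>?P. of_int (sign p) *
      (\<Sum>i\<in>UNIV. frechet_derivative (\<lambda>y. A y $ i $ p i) (at x) v * (\<Prod>j\<in>UNIV - {i}. A x $ j $ p j)))) (at x)"
    unfolding det_def
    using dA by (intro has_derivative_sum has_derivative_mult_right has_derivative_prod)
      (simp add: frechet_derivative_works)
  from partial_eqI[OF this, of k]
  have "partial k (\<lambda>y. det (A y)) x = (\<Sum>p\<in>?P. of_int (sign p) *
      (\<Sum>i\<in>UNIV. H $ i $ p i * (\<Prod>j\<in>UNIV - {i}. A x $ j $ p j)))"
    by (simp add: partial_def H_def mat_partial_def)
  also have "\<dots> = (\<Sum>i\<in>UNIV. \<Sum>p\<in>?P. of_int (sign p) * (H $ i $ p i * (\<Prod>j\<in>UNIV - {i}. A x $ j $ p j)))"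
    by (subst sum.swap) (simp add: sum_distrib_left)
  also have "\<dots> = (\<Sum>i\<in>UNIV. det (\<chi> r. if r = i then H $ i else row r (A x)))"
  proof (intro sum.cong refl)
    fix i
    have "(\<Prod>r\<in>UNIV. (if r = i then H $ i else row r (A x)) $ p r) =
        H $ i $ p i * (\<Prod>j\<in>UNIV - {i}. A x $ j $ p j)" for p
      by (subst prod.remove[of UNIV i]) (auto simp: row_def intro!: prod.cong)
    then show "(\<Sum>p\<in>?P. of_int (sign p) * (H $ i $ p i * (\<Prod>j\<in>UNIV - {i}. A x $ j $ p j))) =
        det (\<chi> r. if r = i then H $ i else row r (A x))"
      by (simp add: det_def)
  qed
  also have "\<dots> = (\<Sum>i\<in>UNIV. (H ** matrix_inv (A x)) $ i $ i * det (A x))"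
  proof (intro sum.cong refl)
    fix i
    \<comment> \<open>The entries of H A^-1 are the coefficients of the rows of \<open>H\<close> in
      the rows of \<open>A\<close>, which is the form that \<open>cramer_lemma_transpose\<close>
      expects.\<close>
    have "H = H ** matrix_inv (A x) ** A x"
      using matrix_inv_right_left[OF d] by (simp add: matrix_mul_assoc[symmetric])
    moreover have "(N ** A x) $ i = (\<Sum>j\<in>UNIV. N $ i $ j *s row j (A x))" for N :: "real ^ 'm ^ 'm"
      by (simp add: vec_eq_iff matrix_matrix_mult_def row_def)
    ultimately have Hi: "H $ i = (\<Sum>j\<in>UNIV. (H ** matrix_inv (A x)) $ i $ j *s row j (A x))"
      by metis
    have "det (\<chi> r. if r = i then H $ i else row r (A x)) =
      det (\<chi> r. if r = i then (\<Sum>j\<in>UNIV. (H ** matrix_inv (A x)) $ i $ j *s row j (A x)) else row r (A x))"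
      by (simp only: Hi)
    also have "\<dots> = (H ** matrix_inv (A x)) $ i $ i * det (A x)"
      by (rule cramer_lemma_transpose)
    finally show "det (\<chi> r. if r = i then H $ i else row r (A x)) = (H ** matrix_inv (A x)) $ i $ i * det (A x)" .
  qed
  also have "\<dots> = trace (H ** matrix_inv (A x)) * det (A x)"
    by (simp add: trace_def sum_distrib_right)
  finally show ?thesis by (simp add: H_def trace_mul_sym[of "matrix_inv (A x)"] mult.commute)
qed

text \<open>Obtained by differentiating A^-1 A = 1.\<close>

lemma mat_partial_matrix_inv:
  assumes U: "open U" "x \<in> U" and A: "mat_smooth_on A U" and d: "\<And>y. y \<in> U \<Longrightarrow> det (A y) \<noteq> 0"
  shows "mat_partial k (\<lambda>y. matrix_inv (A y)) x =
    - (matrix_inv (A x) ** mat_partial k A x ** matrix_inv (A x))"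
proof -
  note I = mat_smooth_on_matrix_inv[OF U(1) A d]
  have "mat_partial k (\<lambda>y. matrix_inv (A y) ** A y) x = mat_partial k (\<lambda>y. mat 1) x"
    by (rule mat_partial_cong[OF U mat_smooth_on_mult[OF U(1) I A]])
       (simp_all add: matrix_inv_right_left d)
  also have "\<dots> = 0" by (simp add: mat_partial_def vec_eq_iff)
  finally have "mat_partial k (\<lambda>y. matrix_inv (A y)) x ** A x = - (matrix_inv (A x) ** mat_partial k A x)"
    by (simp add: mat_partial_mult[OF U I A] eq_neg_iff_add_eq_0)
  then have "mat_partial k (\<lambda>y. matrix_inv (A y)) x ** A x ** matrix_inv (A x) =
      - (matrix_inv (A x) ** mat_partial k A x) ** matrix_inv (A x)" by simp
  then show ?thesis
    using matrix_inv_right_left[OF d[OF U(2)]]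
    by (simp add: matrix_mul_assoc[symmetric] mat_mult_uminus_right)
qed

text \<open>The Riemannian volume density. With the absolute value, det \<noteq> 0 suffices for its
  calculus, and a change of charts contributes the factor |det J|.\<close>

definition volume_density :: "real ^ 'm ^ 'm::finite \<Rightarrow> real" where
  "volume_density A = sqrt \<bar>det A\<bar>"

lemma smooth_on_volume_density:
  assumes "open U" "mat_smooth_on A U" "\<And>y. y \<in> U \<Longrightarrow> det (A y) \<noteq> 0"
  shows "smooth_on (\<lambda>y. volume_density (A y)) U"
proof -
  \<comment> \<open>The absolute value of det is the root of its square, so only square roots at
    positive arguments occur.\<close>
  have "smooth_on (\<lambda>y. sqrt (sqrt (det (A y) * det (A y)))) U"
    using assms by (intro smooth_on_sqrt smooth_on_mult smooth_on_det) (simp_all add: zero_less_mult_iff linorder_neq_iff disj_commute)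
  then show ?thesis by (simp add: volume_density_def real_sqrt_mult_self real_sqrt_abs2)
qed

lemma partial_volume_density:
  assumes U: "open U" "x \<in> U" and A: "mat_smooth_on A U" and d: "det (A x) \<noteq> 0"
  shows "partial k (\<lambda>y. volume_density (A y)) x =
    volume_density (A x) * (trace (matrix_inv (A x) ** mat_partial k A x) / 2)"
proof -
  let ?d = "\<lambda>y. det (A y)"
  have 1: "(?d has_derivative frechet_derivative ?d (at x)) (at x)"
    by (rule smooth_on_has_derivative[OF smooth_on_det[OF U(1) A] U(2)])
  \<comment> \<open>The derivative of sqrt |t| has the same formula for both signs of t, so the two
    signs of the determinant are treated together afterwards.\<close>
  have "((\<lambda>t. sqrt \<bar>t\<bar>) has_real_derivative sqrt \<bar>?d x\<bar> / (2 * ?d x)) (at (?d x))"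
  proof (cases "?d x > 0")
    case True
    have "((\<lambda>t. sqrt t) has_real_derivative sqrt \<bar>?d x\<bar> / (2 * ?d x)) (at (?d x))"
      using True by (auto intro!: derivative_eq_intros simp: field_simps)
    then show ?thesis
      by (rule DERIV_cong_ev[THEN iffD1, rotated 3])
         (use True in \<open>auto simp: eventually_nhds intro!: exI[of _ "{0<..}"]\<close>)
  next
    case False
    then have neg: "?d x < 0" using d by simp
    have "((\<lambda>t. sqrt (- t)) has_real_derivative sqrt \<bar>?d x\<bar> / (2 * ?d x)) (at (?d x))"
      using neg by (auto intro!: derivative_eq_intros simp: field_simps)
    then show ?thesis
      by (rule DERIV_cong_ev[THEN iffD1, rotated 3])
         (use neg in \<open>auto simp: eventually_nhds intro!: exI[of _ "{..<0}"]\<close>)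
  qed
  then have 2: "((\<lambda>t. sqrt \<bar>t\<bar>) has_derivative (\<lambda>r. sqrt \<bar>?d x\<bar> / (2 * ?d x) * r)) (at (?d x))"
    by (simp only: has_field_derivative_def)
  have "partial k (\<lambda>y. sqrt \<bar>?d y\<bar>) x = sqrt \<bar>?d x\<bar> / (2 * ?d x) * partial k ?d x"
    using partial_eqI[OF has_derivative_compose[OF 1 2], of k] by (simp add: partial_def)
  then show ?thesis
    using d by (simp add: volume_density_def partial_det[OF U A d])
qed

section \<open>Local Riemannian geometry and the contracted Bianchi identity\<close>

lemma sum_antisymmetric_eq_0:
  fixes h :: "'i \<Rightarrow> 'i \<Rightarrow> real"
  assumes "\<And>m a. h a m = - h m a"
  shows "(\<Sum>m\<in>I. \<Sum>a\<in>I. h m a) = 0"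
proof -
  have "(\<Sum>m\<in>I. \<Sum>a\<in>I. h m a) = (\<Sum>a\<in>I. \<Sum>m\<in>I. h m a)" by (rule sum.swap)
  also have "\<dots> = - (\<Sum>a\<in>I. \<Sum>m\<in>I. h a m)" by (subst assms) (simp add: sum_negf)
  finally show ?thesis by simp
qed

lemma trace_antisymmetric_symmetric:
  fixes X B :: "real ^ 'n ^ 'n::finite"
  assumes "transpose X = - X" "transpose B = B"
  shows "trace (X ** B) = 0"
proof -
  have "trace (X ** B) = trace (transpose (X ** B))" by (simp add: trace_transpose)
  also have "\<dots> = - trace (B ** X)"
    by (simp add: matrix_transpose_mul assms mat_mult_uminus_left trace_def sum_negf)
  also have "\<dots> = - trace (X ** B)" by (simp add: trace_mul_sym[of B X])
  finally show ?thesis by simp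
qed

text \<open>The entries are \<open>partial\<close> derivatives, so that \<open>jac\<close> matches
  \<open>lie_derivative_metric\<close> term by term; \<open>jacobian_nth\<close> provides the link
  to the library's \<open>jacobian\<close>.\<close>

definition jac :: "(real ^ 'n::finite \<Rightarrow> real ^ 'n) \<Rightarrow> real ^ 'n \<Rightarrow> real ^ 'n ^ 'n" where
  "jac \<xi> x = (\<chi> k j. partial j (\<lambda>y. \<xi> y $ k) x)"

lemma lie_derivative_eq:
  "lie_derivative_metric \<xi> g x =
    (\<Sum>k\<in>UNIV. \<xi> x $ k *\<^sub>R mat_partial k g x) + transpose (jac \<xi> x) ** g x + g x ** jac \<xi> x"
  by (simp add: vec_eq_iff lie_derivative_metric_def mat_partial_def jac_def matrix_matrix_mult_def
      transpose_def sum.distrib mult.commute)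

locale local_metric =
  fixes U :: "(real ^ 'n::finite) set" and g :: "real ^ 'n \<Rightarrow> real ^ 'n ^ 'n"
  assumes open_U: "open U"
    and smooth_g: "mat_smooth_on g U"
    and g_transpose: "\<And>x. x \<in> U \<Longrightarrow> transpose (g x) = g x"
    and g_posdef: "\<And>x v. x \<in> U \<Longrightarrow> v \<noteq> 0 \<Longrightarrow> v \<bullet> (g x *v v) > 0"
begin

section \<open>Inverse metric and Levi-Civita connection in one chart\<close>

definition G :: "real ^ 'n \<Rightarrow> real ^ 'n ^ 'n" where "G x = matrix_inv (g x)"

text \<open>With this index layout, covariant differentiation along the i-th coordinate field acts
  on column vectors as \<open>partial i\<close> plus multiplication by \<open>Gam i\<close>.
  Likewise \<open>curv i j\<close> is the curvature endomorphism of the coordinate fields i and j,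
  so curvature identities become matrix identities.\<close>

definition Gam :: "'n \<Rightarrow> real ^ 'n \<Rightarrow> real ^ 'n ^ 'n" where
  "Gam i x = (\<chi> l k. christoffel g l i k x)"

definition curv :: "'n \<Rightarrow> 'n \<Rightarrow> real ^ 'n \<Rightarrow> real ^ 'n ^ 'n" where
  "curv i j x = (\<chi> l k. riemann g l i j k x)"

lemma det_g: "x \<in> U \<Longrightarrow> det (g x) \<noteq> 0"
  by (rule det_nonzero_if_posdef) (rule g_posdef)

lemma G_g: "x \<in> U \<Longrightarrow> G x ** g x = mat 1" and g_G: "x \<in> U \<Longrightarrow> g x ** G x = mat 1"
  unfolding G_def by (simp_all add: matrix_inv_right_left det_g)

lemma G_transpose: "x \<in> U \<Longrightarrow> transpose (G x) = G x"
  unfolding G_def by (simp add: transpose_matrix_inv det_g g_transpose)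

lemma G_posdef: "x \<in> U \<Longrightarrow> v \<noteq> 0 \<Longrightarrow> v \<bullet> (G x *v v) > 0"
  unfolding G_def by (rule matrix_inv_posdef) (rule g_posdef)

lemma smooth_G: "mat_smooth_on G U"
  unfolding G_def[abs_def] by (rule mat_smooth_on_matrix_inv[OF open_U smooth_g det_g])

lemma partial_g_commute:
  assumes "x \<in> U"
  shows "partial i (\<lambda>y. g y $ a $ b) x = partial i (\<lambda>y. g y $ b $ a) x"
  by (rule partial_cong[OF open_U assms])
     (use assms g_transpose transpose_eqD smooth_on_differentiable[OF mat_smooth_onD[OF smooth_g]] in blast)+

lemma christoffel_commute: "x \<in> U \<Longrightarrow> christoffel g k i j x = christoffel g k j i x"
  by (simp add: christoffel_def partial_g_commute[of x _ i j] add.commute)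

lemma Gam_commute: "x \<in> U \<Longrightarrow> Gam m x $ i $ a = Gam a x $ i $ m"
  by (simp add: Gam_def christoffel_commute)

lemma smooth_christoffel: "smooth_on (christoffel g l i k) U"
  unfolding christoffel_def[abs_def]
  by (intro smooth_on_mult[OF open_U] smooth_on_sum[OF open_U] smooth_on_add[OF open_U]
      smooth_on_diff[OF open_U] smooth_on_const smooth_on_partial mat_smooth_onD[OF smooth_g]
      mat_smooth_onD[OF smooth_G[unfolded G_def[abs_def]]])

lemma smooth_Gam: "mat_smooth_on (Gam i) U"
  by (simp add: mat_smooth_on_def Gam_def smooth_christoffel)

text \<open>Lowering the upper index cancels the inverse metric in \<open>christoffel\<close> and
  leaves the Christoffel symbols of the first kind.\<close>

lemma lower_Gam:
  assumes "x \<in> U"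
  shows "(g x ** Gam i x) $ a $ b = 1 / 2 * (partial i (\<lambda>y. g y $ b $ a) x
    + partial b (\<lambda>y. g y $ i $ a) x - partial a (\<lambda>y. g y $ i $ b) x)"
proof -
  define C where "C = (\<chi> l. partial i (\<lambda>y. g y $ b $ l) x + partial b (\<lambda>y. g y $ i $ l) x
    - partial l (\<lambda>y. g y $ i $ b) x)"
  have Gam: "Gam i x $ l $ b = 1 / 2 * (G x *v C) $ l" for l
    by (simp add: Gam_def christoffel_def matrix_vector_mult_def C_def G_def)
  have "(g x ** Gam i x) $ a $ b = (\<Sum>l\<in>UNIV. g x $ a $ l * Gam i x $ l $ b)"
    by (simp add: matrix_matrix_mult_def)
  also have "\<dots> = 1 / 2 * (g x *v (G x *v C)) $ a"
    unfolding Gam by (simp add: matrix_vector_mult_def[of "g x"] sum_distrib_left mult.left_commute)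
  also have "g x *v (G x *v C) = C" by (simp add: matrix_vector_mul_assoc g_G assms)
  finally show ?thesis by (simp add: C_def)
qed

text \<open>The metric is parallel: when the first-kind symbols are symmetrised, the last two
  derivatives cancel and the halves of the first one add up.\<close>

lemma metric_compatible:
  assumes "x \<in> U"
  shows "mat_partial i g x = transpose (g x ** Gam i x) + g x ** Gam i x"
proof -
  have "partial i (\<lambda>y. g y $ a $ b) x = (g x ** Gam i x) $ b $ a + (g x ** Gam i x) $ a $ b" for a b
  proof -
    have half: "p = 1 / 2 * (p + r - s) + 1 / 2 * (p + s - r)" for p r s :: real
      by (simp add: field_simps)
    show ?thesis
      unfolding lower_Gam[OF assms] partial_g_commute[OF assms, of i b a] by (rule half)
  qed
  then show ?thesis by (simp add: vec_eq_iff mat_partial_def transpose_def)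
qed

section \<open>Curvature symmetries and Bianchi identities\<close>

lemma curv_eq:
  "curv i j x = mat_partial i (Gam j) x - mat_partial j (Gam i) x
    + Gam i x ** Gam j x - Gam j x ** Gam i x"
  by (simp add: vec_eq_iff curv_def riemann_def mat_partial_def Gam_def matrix_matrix_mult_def
      sum_subtractf mult.commute)

lemma curv_swap: "curv j i x = - curv i j x"
  by (simp add: curv_eq)

lemma smooth_curv: "mat_smooth_on (curv i j) U"
  unfolding curv_eq[abs_def]
  by (intro mat_smooth_on_diff mat_smooth_on_add mat_smooth_on_mult mat_smooth_on_mat_partial
      smooth_Gam open_U)

text \<open>Differentiate \<partial>g = K + K^T once more, where \<open>K\<close> is the lowered
  connection. Since second partial derivatives of \<open>g\<close> commute, \<open>D\<close> is
  antisymmetric, and it differs from the lowered curvature only by the antisymmetric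
  \<open>W\<close>.\<close>

lemma lower_curv_antisymmetric:
  assumes x: "x \<in> U"
  shows "transpose (g x ** curv i j x) = - (g x ** curv i j x)"
proof -
  define K where "K j y = g y ** Gam j y" for j y
  define D where "D = mat_partial i (K j) x - mat_partial j (K i) x"
  define W where "W = transpose (K i x) ** Gam j x - transpose (K j x) ** Gam i x"
  have K: "mat_smooth_on (K j) U" for j
    unfolding K_def[abs_def] by (rule mat_smooth_on_mult[OF open_U smooth_g smooth_Gam])
  have "mat_partial i (mat_partial j g) x = transpose (mat_partial i (K j) x) + mat_partial i (K j) x"
    for i j
  proof -
    have "mat_partial i (mat_partial j g) x = mat_partial i (\<lambda>y. transpose (K j y) + K j y) x"
      by (rule mat_partial_cong[OF open_U x mat_smooth_on_mat_partial[OF smooth_g]])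
         (simp add: K_def metric_compatible)
    then show ?thesis
      by (simp add: mat_partial_add[OF open_U x mat_smooth_on_transpose[OF K] K] mat_partial_transpose[OF open_U x])
  qed
  then have DD: "transpose D + D = 0"
    using mat_partial_commute[OF open_U x smooth_g, of i j]
    by (simp add: D_def transpose_diff algebra_simps)
  have dK: "mat_partial i (K j) x = (transpose (K i x) + K i x) ** Gam j x + g x ** mat_partial i (Gam j) x"
    for i j
    unfolding K_def[abs_def] mat_partial_mult[OF open_U x smooth_g smooth_Gam] metric_compatible[OF x] ..
  have D: "D = g x ** curv i j x + W"
    by (simp add: D_def dK curv_eq W_def K_def matrix_ring_simps algebra_simps)
  have "transpose W = - W"
    by (simp add: W_def K_def transpose_diff matrix_transpose_mul g_transpose[OF x] matrix_mul_assoc)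
  then have "transpose (g x ** curv i j x) + g x ** curv i j x = transpose D + D"
    by (simp add: D transpose_add)
  then show ?thesis by (simp add: DD eq_neg_iff_add_eq_0)
qed

lemma curv_G_antisymmetric:
  assumes x: "x \<in> U"
  shows "transpose (curv i j x ** G x) = - (curv i j x ** G x)"
proof -
  have e: "curv i j x ** G x = G x ** (g x ** curv i j x) ** G x"
    using G_g[OF x] by (simp add: matrix_mul_assoc)
  have "transpose (G x ** (g x ** curv i j x) ** G x) = G x ** transpose (g x ** curv i j x) ** G x"
    by (subst matrix_transpose_mul)+ (simp add: G_transpose[OF x] matrix_mul_assoc matrix_transpose_mul)
  then show ?thesis
    unfolding e lower_curv_antisymmetric[OF x] by (simp add: mat_mult_uminus_left mat_mult_uminus_right)
qed

text \<open>The Jacobi identity for the operators \<open>partial m\<close> plus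
  \<open>Gam m\<close>. Only the endomorphism indices are differentiated covariantly: the
  Christoffel terms for the other two indices would cancel in the cyclic sum, as the connection is
  symmetric.\<close>

lemma second_bianchi:
  assumes x: "x \<in> U"
  shows "mat_partial m (curv i j) x + Gam m x ** curv i j x - curv i j x ** Gam m x
    + (mat_partial i (curv j m) x + Gam i x ** curv j m x - curv j m x ** Gam i x)
    + (mat_partial j (curv m i) x + Gam j x ** curv m i x - curv m i x ** Gam j x) = 0"
proof -
  note S = smooth_Gam mat_smooth_on_mat_partial mat_smooth_on_mult[OF open_U]
    mat_smooth_on_diff[OF open_U] mat_smooth_on_add[OF open_U]
  have d: "mat_partial m (curv i j) x = mat_partial m (mat_partial i (Gam j)) x
     - mat_partial m (mat_partial j (Gam i)) x
     + (mat_partial m (Gam i) x ** Gam j x + Gam i x ** mat_partial m (Gam j) x)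
     - (mat_partial m (Gam j) x ** Gam i x + Gam j x ** mat_partial m (Gam i) x)" for m i j
    unfolding curv_eq[abs_def]
    by (simp add: mat_partial_diff[OF open_U x] mat_partial_add[OF open_U x] mat_partial_mult[OF open_U x] S)
  show ?thesis
    unfolding d curv_eq mat_partial_commute[OF open_U x smooth_Gam, of i m]
      mat_partial_commute[OF open_U x smooth_Gam, of j m] mat_partial_commute[OF open_U x smooth_Gam, of j i]
    by (simp add: matrix_ring_simps algebra_simps)
qed

lemma first_bianchi:
  assumes x: "x \<in> U"
  shows "curv i j x $ l $ k + curv j k x $ l $ i + curv k i x $ l $ j = 0"
proof -
  have p: "partial i (christoffel g l j k) x = partial i (christoffel g l k j) x" for i j k
    by (rule partial_cong[OF open_U x christoffel_commute smooth_on_differentiable[OF smooth_christoffel x]])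
  show ?thesis
    using p[of i j k] p[of j k i] p[of k i j] christoffel_commute[OF x, of _ i j]
      christoffel_commute[OF x, of _ j k] christoffel_commute[OF x, of _ k i]
    by (simp add: curv_def riemann_def sum_subtractf)
qed

section \<open>Ricci tensor and scalar curvature\<close>

lemma ricci_eq: "ricci g x $ j $ k = (\<Sum>i\<in>UNIV. curv i j x $ i $ k)"
  by (simp add: ricci_def curv_def)

text \<open>\<open>curv j k x\<close> is traceless, being the product of the antisymmetric
  \<open>curv j k x ** G x\<close> and the symmetric metric. Contracting the first Bianchi identity
  then leaves exactly the difference of the two Ricci entries.\<close>

lemma ricci_commute:
  assumes x: "x \<in> U"
  shows "ricci g x $ j $ k = ricci g x $ k $ j"
proof -
  have "trace (curv j k x) = trace (curv j k x ** G x ** g x)"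
    using G_g[OF x] by (simp add: matrix_mul_assoc[symmetric])
  also have "\<dots> = 0"
    by (rule trace_antisymmetric_symmetric[OF curv_G_antisymmetric[OF x] g_transpose[OF x]])
  finally have "(\<Sum>i\<in>UNIV. curv j k x $ i $ i) = 0" by (simp add: trace_def)
  moreover have "(\<Sum>i\<in>UNIV. curv i j x $ i $ k + curv j k x $ i $ i + curv k i x $ i $ j) = 0"
    by (simp add: first_bianchi[OF x])
  ultimately show ?thesis
    by (simp add: ricci_eq sum.distrib sum_subtractf curv_swap[of k] sum_negf)
qed

lemma ricci_transpose: "x \<in> U \<Longrightarrow> transpose (ricci g x) = ricci g x"
  by (simp add: vec_eq_iff transpose_def ricci_commute)

lemma smooth_ricci: "mat_smooth_on (ricci g) U"
  unfolding mat_smooth_on_def ricci_eq by (intro allI smooth_on_sum open_U mat_smooth_onD smooth_curv)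

lemma local_scalar_curvature_eq: "x \<in> U \<Longrightarrow> local_scalar_curvature g x = trace (G x ** ricci g x)"
  by (simp add: local_scalar_curvature_def trace_mult_eq_sum G_def ricci_commute)

text \<open>The Ricci tensor with an index raised, that is the Ricci operator on vector
  fields.\<close>

definition T :: "real ^ 'n \<Rightarrow> real ^ 'n ^ 'n" where "T x = G x ** ricci g x"

lemma smooth_T: "mat_smooth_on T U"
  unfolding T_def[abs_def] by (rule mat_smooth_on_mult[OF open_U smooth_G smooth_ricci])

lemma smooth_scalar: "smooth_on (local_scalar_curvature g) U"
  by (rule smooth_on_cong[OF open_U _ smooth_on_trace[OF open_U smooth_T]])
     (simp add: local_scalar_curvature_eq T_def)

lemma mat_partial_G:
  assumes x: "x \<in> U"
  shows "mat_partial i G x = - (Gam i x ** G x + G x ** transpose (Gam i x))"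
proof -
  have "mat_partial i G x = - (G x ** mat_partial i g x ** G x)"
    unfolding G_def[abs_def] by (rule mat_partial_matrix_inv[OF open_U x smooth_g det_g])
  also have "G x ** mat_partial i g x ** G x =
      G x ** transpose (Gam i x) ** (g x ** G x) + (G x ** g x) ** Gam i x ** G x"
    by (simp add: metric_compatible[OF x] matrix_transpose_mul g_transpose[OF x] matrix_ring_simps)
  finally show ?thesis by (simp add: G_g[OF x] g_G[OF x])
qed

text \<open>Half of this trace is the logarithmic derivative of the volume density, by
  \<open>partial_volume_density\<close>; the right-hand side contains the contracted Christoffel
  symbol that appears in every divergence.\<close>

lemma trace_G_mat_partial_g:
  assumes x: "x \<in> U"
  shows "trace (G x ** mat_partial a g x) = 2 * (\<Sum>i\<in>UNIV. Gam i x $ i $ a)"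
proof -
  have "G x ** mat_partial a g x = G x ** transpose (Gam a x) ** g x + (G x ** g x) ** Gam a x"
    by (simp add: metric_compatible[OF x] matrix_transpose_mul g_transpose[OF x] matrix_ring_simps)
  then have "trace (G x ** mat_partial a g x) = trace ((G x ** transpose (Gam a x)) ** g x) + trace (Gam a x)"
    by (simp add: trace_add G_g[OF x])
  also have "trace ((G x ** transpose (Gam a x)) ** g x) = trace ((g x ** G x) ** transpose (Gam a x))"
    by (subst trace_mul_sym) (simp add: matrix_mul_assoc)
  finally show ?thesis
    using Gam_commute[OF x] by (simp add: g_G[OF x] trace_transpose) (simp add: trace_def)
qed

text \<open>The second Bianchi identity is contracted with \<open>G\<close> (this is \<open>Q\<close> below). The terms \<open>Z1\<close>, \<open>Z2\<close>, \<open>Z3\<close>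
  coming from the commutators cancel against derivatives of \<open>G\<close> or each other, and contractions of
  the symmetric Christoffel symbols with the antisymmetric matrices \<open>RG\<close> vanish.\<close>

lemma contracted_bianchi:
  assumes x: "x \<in> U"
  shows "2 * ((\<Sum>i\<in>UNIV. partial i (\<lambda>y. T y $ i $ j) x)
      + (\<Sum>a\<in>UNIV. (\<Sum>i\<in>UNIV. Gam i x $ i $ a) * T x $ a $ j)) =
    partial j (local_scalar_curvature g) x + trace (G x ** mat_partial j g x ** G x ** ricci g x)"
proof -
  \<comment> \<open>In invariant terms the claim is 2 div Ric = dS. The last trace is twice the
    contraction of \<open>T\<close> with the Christoffel symbols of the lower index
    \<open>j\<close>, moved to the right-hand side.\<close>
  define H where "H = G x"
  define dH where "dH i = mat_partial i G x" for i
  define ric where "ric j k = ricci g x $ j $ k" for j k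
  define RG where "RG i k = curv i k x ** H" for i k
  \<comment> \<open>Contracts the upper index of the endomorphism with \<open>i\<close>, and its
    lower index with \<open>m\<close> through the inverse metric.\<close>
  define Q where "Q X = (\<Sum>m\<in>UNIV. \<Sum>k\<in>UNIV. H $ m $ k * (\<Sum>i\<in>UNIV. X m i $ i $ k))"
    for X :: "'n \<Rightarrow> 'n \<Rightarrow> real ^ 'n ^ 'n"
  define om where "om a = (\<Sum>i\<in>UNIV. Gam i x $ i $ a)" for a
  define dT where "dT = (\<Sum>i\<in>UNIV. partial i (\<lambda>y. T y $ i $ j) x)"
  define oT where "oT = (\<Sum>a\<in>UNIV. om a * T x $ a $ j)"
  note diff = smooth_on_differentiable[OF _ x]
  note comm = Gam_commute[OF x]
  have H: "H $ a $ b = H $ b $ a" for a b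
    unfolding H_def by (rule transpose_eqD[OF G_transpose[OF x]])
  have ric: "ric a b = ric b a" for a b
    unfolding ric_def by (rule ricci_commute[OF x])
  have RG_anti: "RG i k $ a $ b = - RG i k $ b $ a" for i k a b
  proof -
    have "transpose (RG i k) $ b $ a = (- RG i k) $ b $ a"
      unfolding RG_def H_def curv_G_antisymmetric[OF x] ..
    then show ?thesis by (simp add: transpose_def)
  qed
  have T_ric: "T x $ a $ i = (\<Sum>k\<in>UNIV. H $ a $ k * ric i k)" for a i
    unfolding T_def matrix_matrix_mult_def H_def[symmetric] using ric by (simp add: ric_def)
  have ric_contr: "(\<Sum>i\<in>UNIV. (curv i l x ** N) $ i $ k) = (\<Sum>a\<in>UNIV. ric l a * N $ a $ k)" for l k N
    unfolding matrix_matrix_mult_def ric_def ricci_eq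
    by (simp add: sum_distrib_right) (rule sum.swap)
  have RG_contr1: "(\<Sum>m\<in>UNIV. RG m i $ m $ a) = T x $ a $ i" for i a
    unfolding RG_def ric_contr T_ric using H by (simp add: mult.commute)
  have RG_contr2: "(\<Sum>m\<in>UNIV. RG i m $ a $ m) = T x $ a $ i" for i a
  proof -
    have "RG i m $ a $ m = RG m i $ m $ a" for m
      using RG_anti[of i m a m] by (simp add: RG_def curv_swap[of m i] mat_mult_uminus_right)
    then show ?thesis by (simp add: RG_contr1)
  qed
  have dH: "dH i $ m $ k = - (\<Sum>a\<in>UNIV. Gam i x $ m $ a * H $ a $ k) - (\<Sum>a\<in>UNIV. H $ m $ a * Gam i x $ k $ a)"
    for i m k
    unfolding dH_def mat_partial_G[OF x] H_def[symmetric]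
    by (simp add: matrix_matrix_mult_def transpose_def)
  have Q_add: "Q (\<lambda>m i. X m i + Y m i) = Q X + Q Y" for X Y
    by (simp add: Q_def sum.distrib ring_distribs)
  have Q_diff: "Q (\<lambda>m i. X m i - Y m i) = Q X - Q Y" for X Y
    by (simp add: Q_def sum_subtractf ring_distribs)
  have Q_mult: "Q (\<lambda>m i. N m i ** curv (p m i) (q m i) x) =
      (\<Sum>m\<in>UNIV. \<Sum>i\<in>UNIV. \<Sum>a\<in>UNIV. N m i $ i $ a * RG (p m i) (q m i) $ a $ m)" for N p q
  proof -
    have "Q X = (\<Sum>m\<in>UNIV. \<Sum>i\<in>UNIV. (X m i ** H) $ i $ m)" for X
      unfolding Q_def matrix_matrix_mult_def using H
      by (simp add: sum_distrib_left mult.commute) (rule sum.cong[OF refl sum.swap])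
    then show ?thesis
      by (simp add: RG_def matrix_mul_assoc[symmetric]) (simp add: matrix_matrix_mult_def)
  qed
  have "0 = Q (\<lambda>m i. mat_partial m (curv i j) x + Gam m x ** curv i j x - curv i j x ** Gam m x
    + (mat_partial i (curv j m) x + Gam i x ** curv j m x - curv j m x ** Gam i x)
    + (mat_partial j (curv m i) x + Gam j x ** curv m i x - curv m i x ** Gam j x))"
    unfolding second_bianchi[OF x] by (simp add: Q_def)
  also have "\<dots> = Q (\<lambda>m i. mat_partial m (curv i j) x) + Q (\<lambda>m i. Gam m x ** curv i j x)
      - Q (\<lambda>m i. curv i j x ** Gam m x)
      + (Q (\<lambda>m i. mat_partial i (curv j m) x) + Q (\<lambda>m i. Gam i x ** curv j m x)
      - Q (\<lambda>m i. curv j m x ** Gam i x))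
      + (Q (\<lambda>m i. mat_partial j (curv m i) x) + Q (\<lambda>m i. Gam j x ** curv m i x)
      - Q (\<lambda>m i. curv m i x ** Gam j x))"
    by (simp only: Q_add Q_diff)
  finally have sum0: "0 = \<dots>" .
  define Z1 where "Z1 = (\<Sum>m\<in>UNIV. \<Sum>k\<in>UNIV. \<Sum>a\<in>UNIV. H $ m $ a * Gam m x $ k $ a * ric j k)"
  define Z2 where "Z2 = (\<Sum>m\<in>UNIV. \<Sum>k\<in>UNIV. \<Sum>i\<in>UNIV. \<Sum>a\<in>UNIV. H $ m $ k * (curv j m x $ i $ a * Gam i x $ a $ k))"
  define Z3 where "Z3 = (\<Sum>i\<in>UNIV. \<Sum>a\<in>UNIV. Gam j x $ i $ a * T x $ a $ i)"
  have dric: "partial m (\<lambda>y. ricci g y $ l $ k) x = (\<Sum>i\<in>UNIV. mat_partial m (curv i l) x $ i $ k)" for m l k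
    unfolding ricci_eq mat_partial_def
    by (simp add: partial_sum diff mat_smooth_onD[OF smooth_curv])
  have q1: "Q (\<lambda>m i. mat_partial m (curv i j) x) = dT + oT + Z1"
  proof -
    have "partial m (\<lambda>y. T y $ m $ j) x =
        (\<Sum>k\<in>UNIV. dH m $ m $ k * ric j k) + (\<Sum>k\<in>UNIV. H $ m $ k * partial m (\<lambda>y. ricci g y $ j $ k) x)" for m
    proof -
      have "partial m (\<lambda>y. T y $ m $ j) x = partial m (\<lambda>y. \<Sum>k\<in>UNIV. G y $ m $ k * ricci g y $ j $ k) x"
        by (rule partial_cong[OF open_U x _ diff[OF mat_smooth_onD[OF smooth_T]]])
           (use ricci_commute in \<open>simp add: T_def matrix_matrix_mult_def\<close>)
      then show ?thesis
        by (simp add: partial_sum partial_mult diff mat_smooth_onD[OF smooth_G] mat_smooth_onD[OF smooth_ricci]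
            smooth_on_mult[OF open_U] dH_def mat_partial_def H_def ric_def sum.distrib)
    qed
    then have "Q (\<lambda>m i. mat_partial m (curv i j) x) = dT - (\<Sum>m\<in>UNIV. \<Sum>k\<in>UNIV. dH m $ m $ k * ric j k)"
      by (simp add: Q_def dric[symmetric] dT_def sum.distrib)
    also have "(\<Sum>m\<in>UNIV. \<Sum>k\<in>UNIV. dH m $ m $ k * ric j k) =
        - (\<Sum>m\<in>UNIV. \<Sum>k\<in>UNIV. \<Sum>a\<in>UNIV. Gam m x $ m $ a * H $ a $ k * ric j k) - Z1"
      unfolding dH Z1_def by (simp add: ring_distribs sum_subtractf sum_negf sum_distrib_right sum_distrib_left)
    also have "(\<Sum>m\<in>UNIV. \<Sum>k\<in>UNIV. \<Sum>a\<in>UNIV. Gam m x $ m $ a * H $ a $ k * ric j k) = 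
       (\<Sum>m\<in>UNIV. \<Sum>a\<in>UNIV. Gam m x $ m $ a * T x $ a $ j)"
      unfolding T_ric sum_distrib_left mult.assoc by (rule sum.cong[OF refl sum.swap])
    also have "\<dots> = oT"
      unfolding oT_def om_def sum_distrib_right by (rule sum.swap)
    finally show ?thesis by simp
  qed
  have q2: "Q (\<lambda>m i. Gam m x ** curv i j x) = 0"
  proof -
    have "Q (\<lambda>m i. Gam m x ** curv i j x) =
        (\<Sum>i\<in>UNIV. \<Sum>m\<in>UNIV. \<Sum>a\<in>UNIV. Gam m x $ i $ a * RG i j $ a $ m)"
      unfolding Q_mult by (rule sum.swap)
    moreover have "(\<Sum>m\<in>UNIV. \<Sum>a\<in>UNIV. Gam m x $ i $ a * RG i j $ a $ m) = 0" for i
      by (rule sum_antisymmetric_eq_0) (use comm RG_anti in \<open>metis mult_minus_right\<close>)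
    ultimately show ?thesis by simp
  qed
  have q3: "Q (\<lambda>m i. curv i j x ** Gam m x) = Z1"
    unfolding Q_def ric_contr Z1_def sum_distrib_left
    by (rule sum.cong[OF refl], subst sum.swap) (simp add: ac_simps)
  \<comment> \<open>Here the derivative carries the index \<open>i\<close>, so \<open>T\<close> is
    first rewritten through the other index pair of the curvature; the antisymmetry of the curvature
    times \<open>G\<close> makes both contractions agree.\<close>
  have q4: "Q (\<lambda>m i. mat_partial i (curv j m) x) = dT + Z2"
  proof -
    have "partial i (\<lambda>y. T y $ i $ j) x = (\<Sum>m\<in>UNIV. \<Sum>k\<in>UNIV. mat_partial i (curv j m) x $ i $ k * H $ k $ m
        + curv j m x $ i $ k * dH i $ k $ m)" for i
    proof -
      have "T y $ i $ j = (\<Sum>m\<in>UNIV. \<Sum>k\<in>UNIV. curv j m y $ i $ k * G y $ k $ m)" if y: "y \<in> U" for y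
      proof -
        have "T y $ i $ j = (\<Sum>k\<in>UNIV. (\<Sum>m\<in>UNIV. curv m j y $ m $ k) * G y $ k $ i)"
          using transpose_eqD[OF G_transpose[OF y]] ricci_commute[OF y]
          by (simp add: T_def matrix_matrix_mult_def ricci_eq[symmetric] mult.commute)
        also have "\<dots> = (\<Sum>m\<in>UNIV. (curv m j y ** G y) $ m $ i)"
          by (simp add: matrix_matrix_mult_def sum_distrib_right) (rule sum.swap)
        also have "\<dots> = (\<Sum>m\<in>UNIV. (curv j m y ** G y) $ i $ m)"
        proof (rule sum.cong[OF refl])
          fix m
          have "transpose (curv j m y ** G y) $ m $ i = (- (curv j m y ** G y)) $ m $ i"
            unfolding curv_G_antisymmetric[OF y] ..
          then show "(curv m j y ** G y) $ m $ i = (curv j m y ** G y) $ i $ m"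
            by (simp add: transpose_def curv_swap[of m j] mat_mult_uminus_right)
        qed
        finally show ?thesis by (simp add: matrix_matrix_mult_def)
      qed
      then have "partial i (\<lambda>y. T y $ i $ j) x = partial i (\<lambda>y. \<Sum>m\<in>UNIV. \<Sum>k\<in>UNIV. curv j m y $ i $ k * G y $ k $ m) x"
        by (rule partial_cong[OF open_U x _ diff[OF mat_smooth_onD[OF smooth_T]]])
      then show ?thesis
        by (simp add: partial_sum partial_mult diff mat_smooth_onD[OF smooth_G] mat_smooth_onD[OF smooth_curv]
            smooth_on_mult[OF open_U] smooth_on_sum[OF open_U] dH_def mat_partial_def H_def)
    qed
    then have "dT = (\<Sum>i\<in>UNIV. \<Sum>m\<in>UNIV. \<Sum>k\<in>UNIV. mat_partial i (curv j m) x $ i $ k * H $ k $ m)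
        + (\<Sum>i\<in>UNIV. \<Sum>m\<in>UNIV. \<Sum>k\<in>UNIV. curv j m x $ i $ k * dH i $ k $ m)"
      by (simp add: dT_def sum.distrib)
    also have "(\<Sum>i\<in>UNIV. \<Sum>m\<in>UNIV. \<Sum>k\<in>UNIV. mat_partial i (curv j m) x $ i $ k * H $ k $ m) =
        Q (\<lambda>m i. mat_partial i (curv j m) x)"
      unfolding Q_def sum_distrib_left
      by (subst sum.swap, rule sum.cong[OF refl], subst sum.swap) (use H in \<open>simp add: mult.commute\<close>)
    also have "(\<Sum>i\<in>UNIV. \<Sum>m\<in>UNIV. \<Sum>k\<in>UNIV. curv j m x $ i $ k * dH i $ k $ m) =
       - (\<Sum>i\<in>UNIV. \<Sum>m\<in>UNIV. \<Sum>k\<in>UNIV. \<Sum>a\<in>UNIV. curv j m x $ i $ k * (Gam i x $ k $ a * H $ a $ m))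
       - (\<Sum>i\<in>UNIV. \<Sum>m\<in>UNIV. \<Sum>k\<in>UNIV. \<Sum>a\<in>UNIV. curv j m x $ i $ k * (H $ k $ a * Gam i x $ m $ a))"
      unfolding dH by (simp add: ring_distribs sum_subtractf sum_negf sum_distrib_left)
    also have "(\<Sum>i\<in>UNIV. \<Sum>m\<in>UNIV. \<Sum>k\<in>UNIV. \<Sum>a\<in>UNIV. curv j m x $ i $ k * (Gam i x $ k $ a * H $ a $ m)) = Z2"
    proof -
      have "(\<Sum>i\<in>UNIV. \<Sum>k\<in>UNIV. \<Sum>a\<in>UNIV. curv j m x $ i $ k * (Gam i x $ k $ a * H $ a $ m)) =
        (\<Sum>k\<in>UNIV. \<Sum>i\<in>UNIV. \<Sum>a\<in>UNIV. H $ m $ k * (curv j m x $ i $ a * Gam i x $ a $ k))" for m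
      proof -
        have "(\<Sum>k\<in>UNIV. \<Sum>a\<in>UNIV. curv j m x $ i $ k * (Gam i x $ k $ a * H $ a $ m)) =
          (\<Sum>k\<in>UNIV. \<Sum>a\<in>UNIV. H $ m $ k * (curv j m x $ i $ a * Gam i x $ a $ k))" for i
          by (subst sum.swap) (use H in \<open>simp add: ac_simps\<close>)
        then show ?thesis by simp (rule sum.swap)
      qed
      then show ?thesis unfolding Z2_def by (subst sum.swap) simp
    qed
    also have "(\<Sum>i\<in>UNIV. \<Sum>m\<in>UNIV. \<Sum>k\<in>UNIV. \<Sum>a\<in>UNIV. curv j m x $ i $ k * (H $ k $ a * Gam i x $ m $ a)) = 0"
    proof -
      have "(\<Sum>i\<in>UNIV. \<Sum>k\<in>UNIV. \<Sum>a\<in>UNIV. curv j m x $ i $ k * (H $ k $ a * Gam i x $ m $ a)) = 0" for m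
      proof -
        have "(\<Sum>k\<in>UNIV. \<Sum>a\<in>UNIV. curv j m x $ i $ k * (H $ k $ a * Gam i x $ m $ a)) =
            (\<Sum>a\<in>UNIV. RG j m $ i $ a * Gam i x $ m $ a)" for i
          unfolding RG_def matrix_matrix_mult_def
          by (subst sum.swap) (simp add: sum_distrib_right mult.assoc)
        moreover have "(\<Sum>i\<in>UNIV. \<Sum>a\<in>UNIV. RG j m $ i $ a * Gam i x $ m $ a) = 0"
          by (rule sum_antisymmetric_eq_0) (use comm RG_anti in \<open>metis mult_minus_left\<close>)
        ultimately show ?thesis by simp
      qed
      then show ?thesis by (subst sum.swap) simp
    qed
    finally show ?thesis by simp
  qed
  have q5: "Q (\<lambda>m i. Gam i x ** curv j m x) = oT"
  proof -
    have "Q (\<lambda>m i. Gam i x ** curv j m x) =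
        (\<Sum>i\<in>UNIV. \<Sum>m\<in>UNIV. \<Sum>a\<in>UNIV. Gam i x $ i $ a * RG j m $ a $ m)"
      unfolding Q_mult by (rule sum.swap)
    also have "\<dots> = (\<Sum>i\<in>UNIV. \<Sum>a\<in>UNIV. Gam i x $ i $ a * T x $ a $ j)"
      unfolding RG_contr2[symmetric] sum_distrib_left by (rule sum.cong[OF refl sum.swap])
    also have "\<dots> = oT" unfolding oT_def om_def sum_distrib_right by (rule sum.swap)
    finally show ?thesis .
  qed
  have q6: "Q (\<lambda>m i. curv j m x ** Gam i x) = Z2"
    unfolding Q_def Z2_def matrix_matrix_mult_def by (simp add: sum_distrib_left)
  \<comment> \<open>\<open>curv m i\<close> contracts to minus the Ricci tensor, so this is minus
    the derivative of the scalar curvature, corrected by the derivative of the inverse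
    metric.\<close>
  have q7: "Q (\<lambda>m i. mat_partial j (curv m i) x) =
      - partial j (local_scalar_curvature g) x - trace (G x ** mat_partial j g x ** G x ** ricci g x)"
  proof -
    have "partial j (local_scalar_curvature g) x = partial j (\<lambda>y. trace (T y)) x"
      by (rule partial_cong[OF open_U x _ diff[OF smooth_scalar]]) (simp add: local_scalar_curvature_eq T_def)
    also have "\<dots> = trace (mat_partial j T x)" by (rule partial_trace[OF open_U x smooth_T])
    also have "\<dots> = trace (dH j ** ricci g x) + trace (H ** mat_partial j (ricci g) x)"
      unfolding T_def[abs_def] mat_partial_mult[OF open_U x smooth_G smooth_ricci] dH_def H_def by (rule trace_add)
    also have "dH j = - (G x ** mat_partial j g x ** G x)"
      unfolding dH_def G_def[abs_def] by (rule mat_partial_matrix_inv[OF open_U x smooth_g det_g])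
    also have "trace (H ** mat_partial j (ricci g) x) = - Q (\<lambda>m i. mat_partial j (curv m i) x)"
    proof -
      have sw: "mat_partial j (curv m i) x = - mat_partial j (curv i m) x" for m i
        unfolding curv_swap[of m i, abs_def] using mat_smooth_onD[OF smooth_curv]
        by (simp add: mat_partial_def vec_eq_iff partial_uminus diff)
      have "(\<Sum>i\<in>UNIV. mat_partial j (curv m i) x $ i $ k) = - partial j (\<lambda>y. ricci g y $ m $ k) x" for m k
        unfolding dric sum_negf[symmetric] by (rule sum.cong[OF refl]) (subst sw, simp)
      then have "Q (\<lambda>m i. mat_partial j (curv m i) x) = - (\<Sum>m\<in>UNIV. \<Sum>k\<in>UNIV. H $ m $ k * partial j (\<lambda>y. ricci g y $ m $ k) x)"
        by (simp add: Q_def sum_negf)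
      also have "(\<Sum>m\<in>UNIV. \<Sum>k\<in>UNIV. H $ m $ k * partial j (\<lambda>y. ricci g y $ m $ k) x) = trace (H ** mat_partial j (ricci g) x)"
        unfolding trace_mult_eq_sum mat_partial_def using H by (subst sum.swap) simp
      finally show ?thesis by simp
    qed
    finally show ?thesis by (simp add: mat_mult_uminus_right trace_def sum_negf)
  qed
  have q8: "Q (\<lambda>m i. Gam j x ** curv m i x) = - Z3"
  proof -
    have "Q (\<lambda>m i. Gam j x ** curv m i x) =
        (\<Sum>i\<in>UNIV. \<Sum>m\<in>UNIV. \<Sum>a\<in>UNIV. Gam j x $ i $ a * RG m i $ a $ m)"
      unfolding Q_mult by (rule sum.swap)
    also have "\<dots> = (\<Sum>i\<in>UNIV. \<Sum>a\<in>UNIV. Gam j x $ i $ a * (\<Sum>m\<in>UNIV. RG m i $ a $ m))"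
      unfolding sum_distrib_left by (rule sum.cong[OF refl sum.swap])
    moreover have "(\<Sum>m\<in>UNIV. RG m i $ a $ m) = - T x $ a $ i" for i a
      unfolding RG_contr1[symmetric] sum_negf[symmetric] by (rule sum.cong[OF refl RG_anti])
    ultimately show ?thesis by (simp add: Z3_def sum_negf)
  qed
  have q9: "Q (\<lambda>m i. curv m i x ** Gam j x) = - Z3"
  proof -
    have "(\<Sum>i\<in>UNIV. (curv m i x ** Gam j x) $ i $ k) = - (\<Sum>a\<in>UNIV. ric m a * Gam j x $ a $ k)" for m k
      unfolding ric_contr[symmetric] curv_swap[of m] by (simp add: mat_mult_uminus_right sum_negf)
    then have "Q (\<lambda>m i. curv m i x ** Gam j x) =
        - (\<Sum>m\<in>UNIV. \<Sum>k\<in>UNIV. \<Sum>a\<in>UNIV. H $ m $ k * (ric m a * Gam j x $ a $ k))"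
      by (simp add: Q_def sum_negf sum_distrib_left)
    also have "(\<Sum>m\<in>UNIV. \<Sum>k\<in>UNIV. \<Sum>a\<in>UNIV. H $ m $ k * (ric m a * Gam j x $ a $ k)) =
        (\<Sum>k\<in>UNIV. \<Sum>m\<in>UNIV. \<Sum>a\<in>UNIV. Gam j x $ a $ k * (H $ k $ m * ric a m))"
      by (subst sum.swap) (use H ric in \<open>simp add: ac_simps\<close>)
    also have "\<dots> = (\<Sum>k\<in>UNIV. \<Sum>a\<in>UNIV. Gam j x $ a $ k * T x $ k $ a)"
      unfolding T_ric sum_distrib_left by (rule sum.cong[OF refl sum.swap])
    also have "\<dots> = Z3" unfolding Z3_def by (rule sum.swap)
    finally show ?thesis .
  qed
  show ?thesis
    using sum0 unfolding q1 q2 q3 q4 q5 q6 q7 q8 q9 by (simp add: dT_def oT_def om_def)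
qed

section \<open>Divergence formulas with respect to the volume density\<close>

abbreviation vol :: "real ^ 'n \<Rightarrow> real" where "vol x \<equiv> volume_density (g x)"

lemma vol_pos: "x \<in> U \<Longrightarrow> vol x > 0"
  by (simp add: volume_density_def det_g)

lemma smooth_vol: "smooth_on vol U"
  by (rule smooth_on_volume_density[OF open_U smooth_g det_g])

lemma partial_vol:
  assumes x: "x \<in> U"
  shows "partial a vol x = vol x * (\<Sum>i\<in>UNIV. Gam i x $ i $ a)"
  using partial_volume_density[OF open_U x smooth_g det_g[OF x], of a] trace_G_mat_partial_g[OF x, of a]
  by (simp add: G_def)

text \<open>The two Jacobian terms of the Lie derivative are transposes of each other, so a
  symmetric \<open>B\<close> gives them equal traces.\<close>

lemma trace_lie:
  assumes x: "x \<in> U" and S: "transpose B = B"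
  shows "trace (B ** lie_derivative_metric \<xi> g x) =
    (\<Sum>k\<in>UNIV. \<xi> x $ k * trace (B ** mat_partial k g x)) + 2 * trace (B ** g x ** jac \<xi> x)"
proof -
  have "B ** (\<Sum>k\<in>I. \<xi> x $ k *\<^sub>R mat_partial k g x) = (\<Sum>k\<in>I. \<xi> x $ k *\<^sub>R (B ** mat_partial k g x))"
    if "finite I" for I
    using that by induction (simp_all add: mat_mult_zero mat_mult_add_left mat_mult_scaleR_left)
  then have 1: "trace (B ** (\<Sum>k\<in>UNIV. \<xi> x $ k *\<^sub>R mat_partial k g x)) =
      (\<Sum>k\<in>UNIV. \<xi> x $ k * trace (B ** mat_partial k g x))"
    by (simp add: trace_def sum_distrib_left) (rule sum.swap)
  have 2: "trace (B ** (transpose (jac \<xi> x) ** g x)) = trace (B ** g x ** jac \<xi> x)"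
  proof -
    have "trace (B ** (transpose (jac \<xi> x) ** g x)) = trace ((B ** transpose (jac \<xi> x)) ** g x)"
      by (simp add: matrix_mul_assoc)
    also have "\<dots> = trace (transpose ((B ** transpose (jac \<xi> x)) ** g x))"
      by (rule trace_transpose[symmetric])
    also have "\<dots> = trace ((g x ** jac \<xi> x) ** B)"
      by (simp add: matrix_transpose_mul g_transpose[OF x] S matrix_mul_assoc)
    also have "\<dots> = trace (B ** (g x ** jac \<xi> x))" by (rule trace_mul_sym)
    finally show ?thesis by (simp add: matrix_mul_assoc)
  qed
  show ?thesis
    unfolding lie_derivative_eq mat_mult_add_left trace_add 1 2 by (simp add: matrix_mul_assoc)
qed

text \<open>The left-hand side is \<open>vol\<close> times the divergence of f \<xi>, and half the
  trace of the Lie derivative is div \<xi>. The contracted Christoffel symbols in it come, on the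
  left, from differentiating \<open>vol\<close>.\<close>

lemma divergence_scaled:
  assumes x: "x \<in> U" and \<xi>: "\<And>k. smooth_on (\<lambda>y. \<xi> y $ k) U" and f: "smooth_on f U"
  shows "(\<Sum>k\<in>UNIV. partial k (\<lambda>y. vol y * (f y * \<xi> y $ k)) x) =
    vol x * (f x * (trace (G x ** lie_derivative_metric \<xi> g x) / 2) + (\<Sum>k\<in>UNIV. \<xi> x $ k * partial k f x))"
proof -
  note diff = smooth_on_differentiable[OF _ x]
  have "trace (G x ** lie_derivative_metric \<xi> g x) / 2 =
      (\<Sum>k\<in>UNIV. \<xi> x $ k * (\<Sum>i\<in>UNIV. Gam i x $ i $ k)) + trace (jac \<xi> x)"
    by (subst trace_lie[OF x])
       (simp_all add: G_g[OF x] G_transpose[OF x] trace_G_mat_partial_g[OF x] sum_distrib_left[symmetric] mult.left_commute)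
  then show ?thesis
    using \<xi> f smooth_vol
    by (simp add: partial_mult diff smooth_on_mult[OF open_U] partial_vol[OF x] trace_def jac_def
        sum.distrib algebra_simps sum_distrib_left)
qed

text \<open>In invariant terms, div Ric(\<xi>) is half of \<xi>(S) plus the pairing of Ric with the
  Lie derivative. The contracted Bianchi identity handles the derivatives of \<open>T\<close>; its
  trace term with derivatives of \<open>g\<close> is what completes the Jacobian term to the full
  Lie derivative.\<close>

lemma divergence_ricci:
  assumes x: "x \<in> U" and \<xi>: "\<And>k. smooth_on (\<lambda>y. \<xi> y $ k) U"
  shows "(\<Sum>k\<in>UNIV. partial k (\<lambda>y. vol y * (T y *v \<xi> y) $ k) x) =
    vol x * ((\<Sum>j\<in>UNIV. \<xi> x $ j * partial j (local_scalar_curvature g) x)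
      + trace (G x ** ricci g x ** G x ** lie_derivative_metric \<xi> g x)) / 2"
proof -
  note diff = smooth_on_differentiable[OF _ x]
  have pk: "partial k (\<lambda>y. vol y * (T y *v \<xi> y) $ k) x =
      (\<Sum>j\<in>UNIV. vol x * \<xi> x $ j * (partial k (\<lambda>y. T y $ k $ j) x + (\<Sum>i\<in>UNIV. Gam i x $ i $ k) * T x $ k $ j))
      + (\<Sum>j\<in>UNIV. vol x * (T x $ k $ j * jac \<xi> x $ j $ k))" for k
    using \<xi> smooth_vol mat_smooth_onD[OF smooth_T]
    by (simp add: matrix_vector_mult_def partial_mult partial_sum diff smooth_on_mult[OF open_U]
        smooth_on_sum[OF open_U] partial_vol[OF x] jac_def sum.distrib sum_distrib_left algebra_simps)
  have cb: "(\<Sum>k\<in>UNIV. partial k (\<lambda>y. T y $ k $ j) x)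
        + (\<Sum>k\<in>UNIV. (\<Sum>i\<in>UNIV. Gam i x $ i $ k) * T x $ k $ j) = (partial j (local_scalar_curvature g) x
        + trace (G x ** ricci g x ** G x ** mat_partial j g x)) / 2" for j
  proof -
    have "trace ((G x ** mat_partial j g x) ** (G x ** ricci g x)) = trace ((G x ** ricci g x) ** (G x ** mat_partial j g x))"
      by (rule trace_mul_sym)
    then show ?thesis using contracted_bianchi[OF x, of j] by (simp add: matrix_mul_assoc)
  qed
  have tT: "trace (T x ** jac \<xi> x) = (trace (G x ** ricci g x ** G x ** lie_derivative_metric \<xi> g x)
      - (\<Sum>j\<in>UNIV. \<xi> x $ j * trace (G x ** ricci g x ** G x ** mat_partial j g x))) / 2"
  proof -
    have GRG: "G x ** ricci g x ** G x ** g x = G x ** ricci g x"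
      using G_g[OF x] by (simp add: matrix_mul_assoc[symmetric])
    have "transpose (G x ** ricci g x ** G x) = G x ** ricci g x ** G x"
      by (simp add: matrix_transpose_mul G_transpose[OF x] ricci_transpose[OF x] matrix_mul_assoc)
    from trace_lie[OF x this, of \<xi>] show ?thesis by (simp add: GRG T_def)
  qed
  have "(\<Sum>k\<in>UNIV. partial k (\<lambda>y. vol y * (T y *v \<xi> y) $ k) x) =
      (\<Sum>j\<in>UNIV. vol x * \<xi> x $ j * ((\<Sum>k\<in>UNIV. partial k (\<lambda>y. T y $ k $ j) x)
        + (\<Sum>k\<in>UNIV. (\<Sum>i\<in>UNIV. Gam i x $ i $ k) * T x $ k $ j)))
      + vol x * trace (T x ** jac \<xi> x)"
    unfolding pk sum.distrib trace_mult_eq_sum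
    by (subst sum.swap) (simp add: sum.distrib sum_distrib_left ring_distribs)
  then show ?thesis
    unfolding cb tT by (simp add: algebra_simps sum.distrib sum_subtractf
        sum_distrib_left sum_divide_distrib add_divide_distrib diff_divide_distrib)
qed

text \<open>Twice the Ricci operator is subtracted so that \<xi>(S) cancels against the product rule
  for S \<xi>; the result depends on \<xi> only through the Lie derivative of
  \<open>g\<close>.\<close>

lemma divergence_einstein:
  assumes x: "x \<in> U" and \<xi>: "\<And>k. smooth_on (\<lambda>y. \<xi> y $ k) U"
  shows "(\<Sum>k\<in>UNIV. partial k (\<lambda>y. vol y * (local_scalar_curvature g y *\<^sub>R \<xi> y - 2 *\<^sub>R (T y *v \<xi> y)) $ k) x) =
    vol x * (local_scalar_curvature g x * (trace (G x ** lie_derivative_metric \<xi> g x) / 2)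
      - trace (G x ** ricci g x ** G x ** lie_derivative_metric \<xi> g x))"
proof -
  note diff = smooth_on_differentiable[OF _ x]
  have pk: "partial k (\<lambda>y. vol y * (local_scalar_curvature g y *\<^sub>R \<xi> y - 2 *\<^sub>R (T y *v \<xi> y)) $ k) x =
      partial k (\<lambda>y. vol y * (local_scalar_curvature g y * \<xi> y $ k)) x
      - 2 * partial k (\<lambda>y. vol y * (T y *v \<xi> y) $ k) x" for k
  proof -
    have 1: "smooth_on (\<lambda>y. vol y * (local_scalar_curvature g y * \<xi> y $ k)) U"
      by (intro smooth_on_mult[OF open_U] smooth_vol smooth_scalar \<xi>)
    have 2: "smooth_on (\<lambda>y. vol y * (T y *v \<xi> y) $ k) U"
      by (intro smooth_on_mult[OF open_U] smooth_vol mat_smooth_on_mult_vec[OF open_U smooth_T] \<xi>)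
    have "(\<lambda>y. vol y * (local_scalar_curvature g y *\<^sub>R \<xi> y - 2 *\<^sub>R (T y *v \<xi> y)) $ k) =
      (\<lambda>y. vol y * (local_scalar_curvature g y * \<xi> y $ k) - 2 * (vol y * (T y *v \<xi> y) $ k))"
      by (simp add: fun_eq_iff algebra_simps)
    then show ?thesis
      using diff[OF 1] diff[OF 2] diff[OF smooth_on_mult[OF open_U smooth_on_const[of 2] 2]]
      by (simp add: partial_diff partial_cmult)
  qed
  show ?thesis
    unfolding pk sum_subtractf sum_distrib_left[symmetric] divergence_scaled[OF x \<xi> smooth_scalar]
      divergence_ricci[OF x \<xi>]
    by (simp add: algebra_simps)
qed

end

section \<open>Integration in coordinate space\<close>

text \<open>The change of variables theorem of the library needs a well-ordered index type. The type
  \<open>'n wo\<close> is a well-ordered copy of the finite type \<open>'n\<close>, along which we relabel coordinates.\<close>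

typedef ('n::finite) wo = "{..<CARD('n)}"
  by (rule exI[of _ 0]) simp

instantiation wo :: (finite) linorder
begin
definition less_eq_wo :: "'a wo \<Rightarrow> 'a wo \<Rightarrow> bool" where "less_eq_wo x y \<longleftrightarrow> Rep_wo x \<le> Rep_wo y"
definition less_wo :: "'a wo \<Rightarrow> 'a wo \<Rightarrow> bool" where "less_wo x y \<longleftrightarrow> Rep_wo x < Rep_wo y"
instance
  by standard (auto simp: less_eq_wo_def less_wo_def Rep_wo_inject)
end

instance wo :: (finite) wellorder
proof
  fix P :: "'a wo \<Rightarrow> bool" and a
  assume step: "\<And>x. (\<And>y. y < x \<Longrightarrow> P y) \<Longrightarrow> P x"
  show "P a"
  proof (induction a rule: measure_induct_rule[where f = Rep_wo])
    case (less a)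
    show ?case by (rule step) (use less in \<open>simp add: less_wo_def\<close>)
  qed
qed

lemma UNIV_wo: "(UNIV :: 'n::finite wo set) = Abs_wo ` {..<CARD('n)}"
  by (rule type_definition.univ[OF type_definition_wo])

instance wo :: (finite) finite
  by standard (simp add: UNIV_wo)

lemma card_wo: "CARD('n::finite wo) = CARD('n)"
  by (simp add: type_definition.card[OF type_definition_wo])

text \<open>Conjugation by \<open>b\<close> is a sign-preserving bijection between the permutations
  of the two index types, so the Leibniz expansions agree term by term.\<close>

lemma det_relabel:
  fixes A :: "real ^ 'n ^ 'n::finite" and b :: "'m::finite \<Rightarrow> 'n"
  assumes b: "bij b"
  shows "det (\<chi> i j. A $ b i $ b j) = det A"
proof -
  let ?h = "map_permutation UNIV b"
  have inj: "inj b" and surj: "range b = UNIV" using b by (auto simp: bij_def)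
  have h: "?h p (b i) = b (p i)" for p i
    using inj by (simp add: map_permutation_apply)
  have bb: "bij_betw ?h {p. p permutes UNIV} {q. q permutes UNIV}"
  proof (rule bij_betwI[where g = "map_permutation UNIV (inv b)"])
    show "?h \<in> {p. p permutes UNIV} \<rightarrow> {q. q permutes UNIV}"
      using b by (auto intro: map_permutation_permutes)
    show "map_permutation UNIV (inv b) \<in> {p. p permutes UNIV} \<rightarrow> {q. q permutes UNIV}"
      using b by (auto intro!: map_permutation_permutes bij_betw_inv_into)
    show "map_permutation UNIV (inv b) (?h p) = p" if "p \<in> {p. p permutes UNIV}" for p
      using that b by (intro map_permutation_compose_inv) (auto simp: bij_def)
    show "?h (map_permutation UNIV (inv b) q) = q" if "q \<in> {p. p permutes UNIV}" for q
      using that b by (intro map_permutation_compose_inv) (auto simp: bij_imp_bij_inv surj_f_inv_f[OF bij_is_surj])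
  qed
  have "det A = (\<Sum>q\<in>{q. q permutes UNIV}. of_int (sign q) * (\<Prod>i\<in>UNIV. A $ i $ q i))"
    by (simp add: det_def)
  also have "\<dots> = (\<Sum>p\<in>{p. p permutes UNIV}. of_int (sign (?h p)) * (\<Prod>i\<in>UNIV. A $ i $ ?h p i))"
    by (rule sum.reindex_bij_betw[OF bb, symmetric])
  also have "\<dots> = (\<Sum>p\<in>{p. p permutes UNIV}. of_int (sign p) * (\<Prod>i\<in>UNIV. A $ b i $ b (p i)))"
  proof (intro sum.cong refl)
    fix p :: "'m \<Rightarrow> 'm" assume "p \<in> {p. p permutes UNIV}"
    then have "sign (?h p) = sign p" using inj by (intro sign_map_permutation) auto
    moreover have "(\<Prod>i\<in>UNIV. A $ i $ ?h p i) = (\<Prod>i\<in>UNIV. A $ b i $ ?h p (b i))"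
      using prod.reindex_bij_betw[OF b, of "\<lambda>i. A $ i $ ?h p i"] by simp
    ultimately show "of_int (sign (?h p)) * (\<Prod>i\<in>UNIV. A $ i $ ?h p i) =
        of_int (sign p) * (\<Prod>i\<in>UNIV. A $ b i $ b (p i))"
      by (simp add: h)
  qed
  finally show ?thesis by (simp add: det_def)
qed

definition relabel :: "('m \<Rightarrow> 'n) \<Rightarrow> real ^ 'n \<Rightarrow> real ^ 'm" where
  "relabel b x = (\<chi> i. x $ b i)"

lemma linear_relabel: "linear (relabel b)"
  by (rule linearI) (simp_all add: relabel_def vec_eq_iff)

lemma relabel_inv:
  assumes "bij b"
  shows "relabel (inv b) (relabel b x) = x" "relabel b (relabel (inv b) y) = y"
  using assms by (simp_all add: relabel_def vec_eq_iff bij_def surj_f_inv_f)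

lemma relabel_cbox:
  assumes b: "bij b"
  shows "relabel b ` cbox u v = cbox (relabel b u) (relabel b v)"
proof
  show "relabel b ` cbox u v \<subseteq> cbox (relabel b u) (relabel b v)"
    by (auto simp: mem_box_cart relabel_def)
  show "cbox (relabel b u) (relabel b v) \<subseteq> relabel b ` cbox u v"
  proof
    fix y assume y: "y \<in> cbox (relabel b u) (relabel b v)"
    have "relabel (inv b) y \<in> cbox u v"
    proof -
      have "u $ i \<le> y $ inv b i \<and> y $ inv b i \<le> v $ i" for i
        using y b unfolding mem_box_cart relabel_def
        by (metis bij_inv_eq_iff vec_lambda_beta)
      then show ?thesis by (simp add: mem_box_cart relabel_def)
    qed
    then show "y \<in> relabel b ` cbox u v" using relabel_inv(2)[OF b] by (metis imageI)
  qed
qed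

text \<open>Relabelling maps boxes to boxes of the same content, so
  \<open>has_integral_twiddle\<close> applies with scale factor 1.\<close>

lemma integral_relabel:
  fixes f :: "real ^ 'n::finite \<Rightarrow> real" and b :: "'m::finite \<Rightarrow> 'n"
  assumes b: "bij b" and f: "continuous_on UNIV f" and z: "\<And>x. x \<notin> cbox u v \<Longrightarrow> f x = 0"
  shows "integral UNIV (\<lambda>y. f (relabel (inv b) y)) = integral UNIV f"
proof -
  have ib: "bij (inv b)" using b by (rule bij_imp_bij_inv)
  have cont: "continuous (at x) (relabel c)" for x and c :: "'k::finite \<Rightarrow> 'l::finite"
    using linear_relabel linear_continuous_at linear_conv_bounded_linear by blast
  have "(f has_integral integral (cbox u v) f) (cbox u v)"
    using continuous_on_subset[OF f] by (intro integrable_integral integrable_continuous) auto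
  then have "((\<lambda>y. f (relabel (inv b) y)) has_integral (1 / 1) *\<^sub>R integral (cbox u v) f) (relabel b ` cbox u v)"
  proof (rule has_integral_twiddle[rotated -1])
    show "measure lborel (relabel (inv b) ` cbox u v) = 1 * measure lborel (cbox u v)" for u v :: "real ^ 'm"
    proof -
      have e: "cbox (relabel (inv b) u) (relabel (inv b) v) = {} \<longleftrightarrow> cbox u v = {}"
        unfolding relabel_cbox[OF ib, symmetric] by simp
      have "(\<Prod>i\<in>UNIV. relabel (inv b) v $ i - relabel (inv b) u $ i) = (\<Prod>i\<in>UNIV. v $ i - u $ i)"
        using prod.reindex_bij_betw[OF ib, of "\<lambda>i. v $ i - u $ i"] by (simp add: relabel_def)
      then show ?thesis unfolding relabel_cbox[OF ib] content_cbox_if_cart using e by simp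
    qed
    show "\<exists>w z. relabel (inv b) ` cbox u v = cbox w z" for u v :: "real ^ 'm" unfolding relabel_cbox[OF ib] by blast
    show "\<exists>w z. relabel b ` cbox u v = cbox w z" for u v :: "real ^ 'n" unfolding relabel_cbox[OF b] by blast
  qed (auto simp: relabel_inv[OF b] cont)
  then have "((\<lambda>y. f (relabel (inv b) y)) has_integral integral (cbox u v) f) (relabel b ` cbox u v)"
    by simp
  then have "((\<lambda>y. f (relabel (inv b) y)) has_integral integral (cbox u v) f) UNIV"
  proof (rule has_integral_on_superset)
    show "f (relabel (inv b) y) = 0" if "y \<notin> relabel b ` cbox u v" for y
      using that relabel_inv(2)[OF b, of y] by (intro z) (metis imageI)
  qed auto
  moreover have "(f has_integral integral (cbox u v) f) UNIV"
    by (rule has_integral_on_superset[OF integrable_integral[OF integrable_continuous]])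
       (use continuous_on_subset[OF f] z in auto)
  ultimately show ?thesis by (metis integral_unique)
qed

lemma integral_change_of_variables_wellorder:
  fixes f :: "real ^ 'm::{finite,wellorder} \<Rightarrow> real" and h :: "real ^ 'm::_ \<Rightarrow> real ^ 'm::_"
  assumes S: "S \<in> sets lebesgue"
    and der: "\<And>x. x \<in> S \<Longrightarrow> (h has_derivative h' x) (at x within S)"
    and inj: "inj_on h S"
    and f: "f absolutely_integrable_on (h ` S)"
  shows "integral (h ` S) f = integral S (\<lambda>x. \<bar>det (matrix (h' x))\<bar> * f (h x))"
proof -
  \<comment> \<open>The change of variables theorem takes vector-valued integrands, so the scalar
    one is wrapped as a vector of length 1.\<close>
  define F where "F x = (\<chi> i::1. f x)" for x
  have l: "bounded_linear (\<lambda>t::real. (\<chi> i::1. t))"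
    unfolding linear_conv_bounded_linear[symmetric] by (rule linearI) (simp_all add: vec_eq_iff)
  have F: "F absolutely_integrable_on (h ` S)"
    using absolutely_integrable_linear[OF f l] by (simp add: F_def[abs_def] o_def)
  then have D: "(\<lambda>x. \<bar>det (matrix (h' x))\<bar> *\<^sub>R F (h x)) absolutely_integrable_on S"
    using absolutely_integrable_change_of_variables[OF S der inj] by blast
  have "integral (h ` S) F = integral S (\<lambda>x. \<bar>det (matrix (h' x))\<bar> *\<^sub>R F (h x))"
    by (rule integral_change_of_variables[OF S der inj disjI1[OF F]])
  moreover have "integral (h ` S) f = integral (h ` S) F $ 1"
    using F integral_component_eq_cart[of F "h ` S" 1] by (simp add: absolutely_integrable_on_def F_def)
  moreover have "integral S (\<lambda>x. \<bar>det (matrix (h' x))\<bar> * f (h x)) =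
      integral S (\<lambda>x. \<bar>det (matrix (h' x))\<bar> *\<^sub>R F (h x)) $ 1"
    using D integral_component_eq_cart[of "\<lambda>x. \<bar>det (matrix (h' x))\<bar> *\<^sub>R F (h x)" S 1]
    by (simp add: absolutely_integrable_on_def F_def)
  ultimately show ?thesis by simp
qed

text \<open>Continuity on the whole space and vanishing off a box make all integrals over
  \<open>UNIV\<close> well behaved. The computation takes place over the well-ordered copy of the
  index type, reached by \<open>P\<close> and left by \<open>Q\<close>.\<close>

lemma integral_transform:
  fixes \<phi> :: "real ^ 'n::finite \<Rightarrow> real ^ 'n" and f1 f2 :: "real ^ 'n \<Rightarrow> real"
  assumes S: "open S" and der: "\<And>x. x \<in> S \<Longrightarrow> (\<phi> has_derivative \<phi>' x) (at x)" and inj: "inj_on \<phi> S"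
    and f1: "continuous_on UNIV f1" "\<And>x. x \<notin> cbox u1 v1 \<Longrightarrow> f1 x = 0" "\<And>x. x \<notin> S \<Longrightarrow> f1 x = 0"
    and f2: "continuous_on UNIV f2" "\<And>x. x \<notin> cbox u2 v2 \<Longrightarrow> f2 x = 0" "\<And>x. x \<notin> \<phi> ` S \<Longrightarrow> f2 x = 0"
    and eq: "\<And>x. x \<in> S \<Longrightarrow> f1 x = \<bar>det (matrix (\<phi>' x))\<bar> * f2 (\<phi> x)"
  shows "integral UNIV f1 = integral UNIV f2"
proof -
  obtain b :: "'n wo \<Rightarrow> 'n" where b: "bij b"
    using finite_same_card_bij[of "UNIV :: 'n wo set" "UNIV :: 'n set"] card_wo by auto
  define P where "P = relabel b"
  define Q where "Q = relabel (inv b)"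
  have PQ: "P (Q y) = y" and QP: "Q (P x) = x" for x y
    unfolding P_def Q_def by (simp_all add: relabel_inv[OF b])
  have blP: "bounded_linear P" and blQ: "bounded_linear Q"
    unfolding P_def Q_def using linear_relabel linear_conv_bounded_linear by blast+
  define h where "h y = P (\<phi> (Q y))" for y
  define h' where "h' y v = P (\<phi>' (Q y) (Q v))" for y v
  have Q_S: "y \<in> P ` S \<longleftrightarrow> Q y \<in> S" for y using PQ QP by (metis imageE imageI)
  have "P ` S = Q -` S" using Q_S by auto
  then have oS: "open (P ` S)"
    by (simp add: continuous_open_vimage[OF S linear_continuous_at[OF blQ]])
  have dh: "(h has_derivative h' y) (at y within P ` S)" if "y \<in> P ` S" for y
  proof -
    have "((\<lambda>y. \<phi> (Q y)) has_derivative (\<lambda>v. \<phi>' (Q y) (Q v))) (at y)"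
      using that Q_S
      by (intro has_derivative_compose[OF bounded_linear_imp_has_derivative[OF blQ]] der) auto
    from bounded_linear.has_derivative[OF blP this]
    show ?thesis unfolding h_def[abs_def] h'_def[abs_def] by (rule has_derivative_at_withinI)
  qed
  have hinj: "inj_on h (P ` S)"
  proof (rule inj_onI)
    fix y z assume "y \<in> P ` S" "z \<in> P ` S" "h y = h z"
    then have "\<phi> (Q y) = \<phi> (Q z)" "Q y \<in> S" "Q z \<in> S" unfolding h_def using QP Q_S by metis+
    then have "Q y = Q z" using inj by (auto dest: inj_onD)
    then show "y = z" using PQ by metis
  qed
  have det: "det (matrix (h' y)) = det (matrix (\<phi>' (Q y)))" if "y \<in> P ` S" for y
  proof -
    have "matrix (h' y) = (\<chi> i j. matrix (\<phi>' (Q y)) $ b i $ b j)"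
    proof -
      have "inv b i = j \<longleftrightarrow> i = b j" for i j
        using b by (metis bij_inv_eq_iff)
      then have "Q (axis j 1) = axis (b j) 1" for j
        by (simp add: Q_def relabel_def vec_eq_iff axis_def)
      then show ?thesis by (simp add: matrix_def h'_def P_def relabel_def)
    qed
    then show ?thesis using det_relabel[OF b] by simp
  qed
  have f2Q: "continuous_on UNIV (\<lambda>y. f2 (Q y))"
    using continuous_on_compose2[OF f2(1) linear_continuous_on[OF blQ]] by auto
  have im: "h ` P ` S = P ` \<phi> ` S" by (simp add: h_def image_image QP)
  have z: "f2 (Q y) = 0" if "y \<notin> h ` P ` S" for y
    using that f2(3)[of "Q y"] PQ unfolding im by (metis imageI)
  have z': "f2 (Q y) = 0" if "y \<notin> cbox (P u2) (P v2)" for y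
    using that f2(2)[of "Q y"] PQ unfolding P_def relabel_cbox[OF b, symmetric] by (metis imageI)
  have "(\<lambda>y. f2 (Q y)) absolutely_integrable_on cbox (P u2) (P v2)"
    using continuous_on_subset[OF f2Q] by (intro absolutely_integrable_continuous) auto
  then have "(\<lambda>y. if y \<in> cbox (P u2) (P v2) then f2 (Q y) else 0) absolutely_integrable_on UNIV"
    unfolding absolutely_integrable_restrict_UNIV .
  \<comment> \<open>The integrand vanishes off the box as well as off the image, so integrability
    carries over from the former to the latter.\<close>
  also have "(\<lambda>y. if y \<in> cbox (P u2) (P v2) then f2 (Q y) else 0) = (\<lambda>y. if y \<in> h ` P ` S then f2 (Q y) else 0)"
    using z z' by (auto simp: fun_eq_iff)
  finally have ai: "(\<lambda>y. f2 (Q y)) absolutely_integrable_on (h ` P ` S)"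
    unfolding absolutely_integrable_restrict_UNIV .
  have "integral UNIV f2 = integral UNIV (\<lambda>y. f2 (Q y))"
    unfolding Q_def by (rule integral_relabel[OF b f2(1,2), symmetric])
  also have "\<dots> = integral UNIV (\<lambda>y. if y \<in> h ` P ` S then f2 (Q y) else 0)"
    using z by (intro integral_cong) auto
  also have "\<dots> = integral (h ` P ` S) (\<lambda>y. f2 (Q y))"
    by (rule Henstock_Kurzweil_Integration.integral_restrict_UNIV)
  also have "\<dots> = integral (P ` S) (\<lambda>y. \<bar>det (matrix (h' y))\<bar> * f2 (Q (h y)))"
    using oS dh hinj ai by (intro integral_change_of_variables_wellorder) (auto intro: sets_completionI_sets borel_open)
  also have "\<dots> = integral (P ` S) (\<lambda>y. f1 (Q y))"
    using det eq Q_S by (intro integral_cong) (simp add: h_def QP)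
  also have "\<dots> = integral UNIV (\<lambda>y. if y \<in> P ` S then f1 (Q y) else 0)"
    by (rule Henstock_Kurzweil_Integration.integral_restrict_UNIV[symmetric])
  also have "\<dots> = integral UNIV (\<lambda>y. f1 (Q y))"
    using f1(3) Q_S by (intro integral_cong) auto
  also have "\<dots> = integral UNIV f1"
    unfolding Q_def by (rule integral_relabel[OF b f1(1,2)])
  finally show ?thesis ..
qed

text \<open>By translation invariance the integral of F(x + t e) does not depend on t;
  differentiating under the integral sign at t = 0 gives the claim.\<close>

lemma integral_partial_eq_0:
  fixes F :: "real ^ 'n::finite \<Rightarrow> real"
  assumes F: "C_k_on (Suc 0) F UNIV" and z: "\<And>x. x \<notin> cball a r \<Longrightarrow> F x = 0"
  shows "integral UNIV (partial k F) = 0"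
proof -
  define e :: "real ^ 'n" where "e = axis k 1"
  have dF: "(F has_derivative frechet_derivative F (at x)) (at x)" for x
    using C_k_on_Suc_has_derivative[OF F] by simp
  have cF: "continuous_on UNIV F"
    using C_k_on_Suc_D[OF F] by simp
  have cp: "continuous_on UNIV (partial k F)"
    using F unfolding partial_def[abs_def] by simp
  have ct: "continuous_on B (\<lambda>x. F (x + t *\<^sub>R e))" for B t
    by (rule continuous_on_compose2[OF cF]) (auto intro!: continuous_intros)
  \<comment> \<open>The margin 1 keeps all translates with |t| \<le> 1 supported in one fixed
    box.\<close>
  obtain u v where uv: "cball a (r + 1) \<subseteq> cbox u v"
    using bounded_subset_cbox_symmetric[OF bounded_cball] by metis
  have zt: "F (x + t *\<^sub>R e) = 0" if "x \<notin> cbox u v" "\<bar>t\<bar> \<le> 1" for x t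
  proof (rule z)
    have "dist a x > r + 1" using that uv by (auto simp: subset_iff not_le)
    moreover have "dist a x \<le> dist a (x + t *\<^sub>R e) + \<bar>t\<bar>"
      using dist_triangle[of a x "x + t *\<^sub>R e"] by (simp add: dist_norm e_def)
    ultimately show "x + t *\<^sub>R e \<notin> cball a r" using that by simp
  qed
  have int: "integral (cbox u v) (\<lambda>x. F (x + t *\<^sub>R e)) = integral UNIV F" if "\<bar>t\<bar> \<le> 1" for t
  proof -
    let ?I = "integral (cbox u v) (\<lambda>x. F (x + t *\<^sub>R e))"
    have "((\<lambda>x. F (x + t *\<^sub>R e)) has_integral ?I) (cbox u v)"
      by (intro integrable_integral integrable_continuous ct)
    then have "((F \<circ> (+) (t *\<^sub>R e)) has_integral ?I) (cbox u v)"
      by (simp add: o_def add.commute)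
    then have "(F has_integral ?I) (cbox (u + t *\<^sub>R e) (v + t *\<^sub>R e))"
      unfolding has_integral_shift_cbox_iff .
    then have "(F has_integral ?I) UNIV"
    proof (rule has_integral_on_superset)
      fix x assume x: "x \<notin> cbox (u + t *\<^sub>R e) (v + t *\<^sub>R e)"
      have "x - t *\<^sub>R e \<notin> cbox u v"
        using x by (auto simp: mem_box_cart algebra_simps)
      then show "F x = 0" using zt[of "x - t *\<^sub>R e" t] that by simp
    qed auto
    then show ?thesis by (simp add: integral_unique)
  qed
  have "((\<lambda>t. integral (cbox u v) (\<lambda>x. F (x + t *\<^sub>R e))) has_field_derivative
      integral (cbox u v) (\<lambda>x. partial k F (x + 0 *\<^sub>R e))) (at 0 within {-1..1})"
  proof (rule leibniz_rule_field_derivative[where f="\<lambda>t x. F (x + t *\<^sub>R e)"])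
    fix t x
    have "((\<lambda>t. F (x + t *\<^sub>R e)) has_derivative (\<lambda>s. frechet_derivative F (at (x + t *\<^sub>R e)) (s *\<^sub>R e))) (at t)"
      by (rule has_derivative_compose[where f="\<lambda>t. x + t *\<^sub>R e" and g=F, OF _ dF]) (auto intro!: derivative_eq_intros)
    moreover have "frechet_derivative F (at (x + t *\<^sub>R e)) (s *\<^sub>R e) = partial k F (x + t *\<^sub>R e) * s" for s
      using linear_cmul[OF has_derivative_linear[OF dF]] by (simp add: partial_def e_def)
    ultimately show "((\<lambda>t. F (x + t *\<^sub>R e)) has_field_derivative partial k F (x + t *\<^sub>R e)) (at t within {-1..1})"
      by (simp add: has_field_derivative_def has_derivative_at_withinI)
  next
    fix t show "(\<lambda>x. F (x + t *\<^sub>R e)) integrable_on cbox u v"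
      by (intro integrable_continuous ct)
  next
    show "continuous_on ({-1..1} \<times> cbox u v) (\<lambda>(t, x). partial k F (x + t *\<^sub>R e))"
      unfolding split_beta by (rule continuous_on_compose2[OF cp]) (auto intro!: continuous_intros)
  qed auto
  then have "((\<lambda>t. integral UNIV F) has_field_derivative
      integral (cbox u v) (\<lambda>x. partial k F (x + 0 *\<^sub>R e))) (at 0 within {-1..1})"
    by (rule has_field_derivative_transform_within[where d=1]) (auto simp: int dist_real_def)
  moreover have "at (0::real) within {-1..1} = at 0"
    by (rule at_within_interior) simp
  ultimately have "integral (cbox u v) (partial k F) = 0"
    using DERIV_unique[OF _ DERIV_const] by simp
  moreover have "integral UNIV (partial k F) = integral (cbox u v) (partial k F)"
  proof -
    have "(partial k F has_integral integral (cbox u v) (partial k F)) (cbox u v)"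
      using continuous_on_subset[OF cp] by (intro integrable_integral integrable_continuous) auto
    then have "(partial k F has_integral integral (cbox u v) (partial k F)) UNIV"
    proof (rule has_integral_on_superset)
      fix x assume "x \<notin> cbox u v"
      then have "x \<in> - cball a (r + 1)" using uv by auto
      then have "x \<in> - cball a r" by auto
      then have "partial k (\<lambda>x. 0) x = partial k F x"
        by (intro partial_cong[of "- cball a r"]) (auto simp: z)
      then show "partial k F x = 0" by simp
    qed auto
    then show ?thesis by (rule integral_unique)
  qed
  ultimately show ?thesis by simp
qed

lemma continuous_integral_0_nonneg:
  fixes F :: "real ^ 'n::finite \<Rightarrow> real"
  assumes F: "continuous_on UNIV F" and z: "\<And>x. x \<notin> cball a r \<Longrightarrow> F x = 0"
    and nn: "\<And>x. F x \<ge> 0" and 0: "integral UNIV F = 0"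
  shows "F x = 0"
proof -
  \<comment> \<open>Including \<open>x\<close> makes the open box nonempty and a neighbourhood of
    \<open>x\<close>, so that the vanishing of the integral over the box can be read off at
    \<open>x\<close>.\<close>
  obtain w where w: "insert x (cball a r) \<subseteq> box (- w) w"
    using bounded_subset_box_symmetric[of "insert x (cball a r)"] by auto
  then have w': "insert x (cball a r) \<subseteq> cbox (- w) w" using box_subset_cbox by blast
  have c: "continuous_on (cbox (- w) w) F" using F continuous_on_subset by blast
  have "(F has_integral integral (cbox (- w) w) F) UNIV"
  proof (rule has_integral_on_superset[OF integrable_integral[OF integrable_continuous[OF c]]])
    show "F y = 0" if "y \<notin> cbox (- w) w" for y
      using that w' by (intro z) blast
  qed simp
  then have "integral (cbox (- w) w) F = 0" using 0 by (simp add: integral_unique)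
  then show ?thesis
    using integral_cbox_eq_0_iff[OF c] nn w w' by auto
qed

text \<open>Squaring makes the truncation at 0 differentiable, with derivative 2 max 0 t. This C^1
  profile serves for the bump functions, since the divergence argument differentiates them only
  once.\<close>

lemma C_k_on_max_square:
  fixes s :: "'e::real_normed_vector \<Rightarrow> real"
  assumes S: "open S" and s: "C_k_on (Suc 0) s S"
  shows "C_k_on (Suc 0) (\<lambda>y. (max 0 (s y))\<^sup>2) S"
proof -
  have D: "((\<lambda>t::real. (max 0 t)\<^sup>2) has_real_derivative 2 * max 0 t) (at t)" for t
  proof (cases t "0::real" rule: linorder_cases)
    case less
    have "((\<lambda>t::real. 0) has_real_derivative 2 * max 0 t) (at t)" using less by simp
    then show ?thesis
      by (rule has_field_derivative_transform_within_open[where S="{..<0}"]) (use less in auto)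
  next
    case greater
    have "((\<lambda>t::real. t\<^sup>2) has_real_derivative 2 * max 0 t) (at t)"
      using greater by (auto intro!: derivative_eq_intros)
    then show ?thesis
      by (rule has_field_derivative_transform_within_open[where S="{0<..}"]) (use greater in auto)
  next
    case equal
    have "((\<lambda>h::real. (max 0 h)\<^sup>2 / h) \<longlongrightarrow> 0) (at 0)"
    proof (rule Lim_null_comparison)
      show "\<forall>\<^sub>F h in at 0. norm ((max 0 h)\<^sup>2 / h) \<le> \<bar>h::real\<bar>"
        by (auto simp: max_def power2_eq_square intro!: always_eventually)
      show "((\<lambda>h::real. \<bar>h\<bar>) \<longlongrightarrow> 0) (at 0)" by (rule tendsto_eq_intros | simp)+
    qed
    then show ?thesis by (simp add: equal has_field_derivative_iff)
  qed
  have d: "((\<lambda>y. (max 0 (s y))\<^sup>2) has_derivative (\<lambda>v. 2 * max 0 (s x) * frechet_derivative s (at x) v)) (at x)"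
    if "x \<in> S" for x
    using has_derivative_compose[OF C_k_on_Suc_has_derivative[OF s that] D[of "s x", unfolded has_field_derivative_def]] .
  show ?thesis
  proof (rule C_k_on_SucI[OF S d])
    have "continuous_on S s" using C_k_on_Suc_D[OF s] by simp
    then show "C_k_on 0 (\<lambda>x. 2 * max 0 (s x) * frechet_derivative s (at x) v) S" for v
      using s by (auto intro!: continuous_intros)
  qed
qed

lemma C_k_on_Un:
  assumes "open S" "open T" "C_k_on k f S" "C_k_on k f T"
  shows "C_k_on k f (S \<union> T)"
  using assms(3,4)
  by (induction k arbitrary: f) (auto intro: continuous_on_open_Un assms(1,2))

section \<open>Divergences on compact manifolds\<close>

text \<open>Because \<open>K\<close> is closed in the whole space, \<open>I\<close> and the
  complement of \<open>K\<close> are open sets covering everything; the extension is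
  \<open>e\<close> on one and 0 on the other.\<close>

lemma C_k_on_extend_zero:
  assumes "open I" "C_k_on k e I" "closed K" "K \<subseteq> I" "\<And>x. x \<in> I \<Longrightarrow> x \<notin> K \<Longrightarrow> e x = 0"
  shows "C_k_on k (\<lambda>x. if x \<in> I then e x else 0) UNIV"
proof -
  have "C_k_on k (\<lambda>x. if x \<in> I then e x else 0) (I \<union> - K)"
  proof (rule C_k_on_Un)
    show "C_k_on k (\<lambda>x. if x \<in> I then e x else 0) I"
      by (rule C_k_on_cong[OF assms(1) _ assms(2)]) simp
    show "C_k_on k (\<lambda>x. if x \<in> I then e x else 0) (- K)"
      by (rule C_k_on_cong[OF _ _ C_k_on_const[of k 0]]) (use assms in auto)
  qed (use assms in auto)
  moreover have "I \<union> - K = UNIV" using assms(4) by auto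
  ultimately show ?thesis by simp
qed

lemma integrable_on_UNIV_continuous:
  fixes f :: "real ^ 'n::finite \<Rightarrow> real"
  assumes f: "continuous_on UNIV f" and z: "\<And>x. x \<notin> cball a r \<Longrightarrow> f x = 0"
  shows "f integrable_on UNIV"
proof -
  obtain u where u: "cball a r \<subseteq> cbox (- u) u"
    using bounded_subset_cbox_symmetric[OF bounded_cball] by metis
  show ?thesis
  proof (rule integrable_on_superset)
    show "f integrable_on cbox (- u) u"
      using f continuous_on_subset by (intro integrable_continuous) blast
    show "f x = 0" if "x \<notin> cbox (- u) u" for x using that u by (intro z) blast
  qed simp
qed

locale smooth_manifold =
  fixes M :: "'a topology" and A :: "('a, 'n::finite) chart set"
  assumes atlas: "smooth_atlas M A" and hausdorff: "Hausdorff_space M"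
begin

section \<open>Charts, overlaps and transition maps\<close>

lemma chart:
  assumes "c \<in> A"
  shows "openin M (fst c)" "open (chart_image c)"
    "homeomorphic_map (subtopology M (fst c)) (top_of_set (chart_image c)) (snd c)"
    "topspace (subtopology M (fst c)) = fst c"
  using assms atlas openin_subset[of M "fst c"] unfolding smooth_atlas_def is_chart_def by auto

lemma inj_on_chart: "c \<in> A \<Longrightarrow> inj_on (snd c) (fst c)"
  using homeomorphic_imp_injective_map[OF chart(3)] chart(4) by metis

lemma chart_inv_snd: "c \<in> A \<Longrightarrow> p \<in> fst c \<Longrightarrow> chart_inv c (snd c p) = p"
  unfolding chart_inv_def by (simp add: inj_on_chart)

lemma snd_in_chart_image: "p \<in> fst c \<Longrightarrow> snd c p \<in> chart_image c"
  by (simp add: chart_image_def)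

lemma snd_chart_inv: "x \<in> chart_image c \<Longrightarrow> snd c (chart_inv c x) = x"
  unfolding chart_inv_def chart_image_def by (rule f_inv_into_f)

lemma chart_inv_in: "x \<in> chart_image c \<Longrightarrow> chart_inv c x \<in> fst c"
  unfolding chart_inv_def chart_image_def by (rule inv_into_into)

lemma fst_chart_subset: "c \<in> A \<Longrightarrow> fst c \<subseteq> topspace M"
  by (rule openin_subset[OF chart(1)])

lemma open_chart_image:
  assumes c: "c \<in> A" and W: "openin M W" "W \<subseteq> fst c"
  shows "open (snd c ` W)"
proof -
  have "openin (subtopology M (fst c)) W"
    using W chart(1)[OF c] by (simp add: openin_open_subtopology)
  then have "openin (top_of_set (chart_image c)) (snd c ` W)"
    using homeomorphic_imp_open_map[OF chart(3)[OF c]] by (simp add: open_map_def)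
  then show ?thesis using chart(2)[OF c] by (simp add: openin_open_eq)
qed

lemma openin_chart_preimage:
  assumes c: "c \<in> A" and W: "open W"
  shows "openin M {p \<in> fst c. snd c p \<in> W}"
proof -
  have "openin (top_of_set (chart_image c)) (chart_image c \<inter> W)"
    using W by (simp add: openin_open_Int)
  then have "openin (subtopology M (fst c)) {p \<in> topspace (subtopology M (fst c)). snd c p \<in> chart_image c \<inter> W}"
    by (rule openin_continuous_map_preimage[OF homeomorphic_imp_continuous_map[OF chart(3)[OF c]]])
  moreover have "{p \<in> topspace (subtopology M (fst c)). snd c p \<in> chart_image c \<inter> W} = {p \<in> fst c. snd c p \<in> W}"
    unfolding chart(4)[OF c] by (auto simp: chart_image_def)
  ultimately show ?thesis
    using openin_open_subtopology[OF chart(1)[OF c]] by simp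
qed

text \<open>The Hausdorff property enters here: without it a compact coordinate ball might fail to
  be closed in \<open>M\<close>, and extending a bump by zero might be discontinuous.\<close>

lemma closedin_chart_inv_compact:
  assumes c: "c \<in> A" and K: "compact K" "K \<subseteq> chart_image c"
  shows "closedin M (chart_inv c ` K)"
proof -
  have sub: "chart_inv c ` K \<subseteq> topspace (subtopology M (fst c))"
    using K chart_inv_in chart(4)[OF c] by fastforce
  have "snd c (chart_inv c x) = x" if "x \<in> K" for x
    using that K(2) by (intro snd_chart_inv) blast
  then have "snd c ` chart_inv c ` K = K" by (simp add: image_image)
  then have "compactin (top_of_set (chart_image c)) (snd c ` chart_inv c ` K)"
    using K by (simp add: compactin_subtopology)
  then have "compactin (subtopology M (fst c)) (chart_inv c ` K)"
    using homeomorphic_map_compactness[OF chart(3)[OF c] sub] by simp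
  then have "compactin M (chart_inv c ` K)" by (simp add: compactin_subtopology)
  then show ?thesis by (rule compactin_imp_closedin[OF hausdorff])
qed

lemma overlap_iff: "c \<in> A \<Longrightarrow> x \<in> overlap c d \<longleftrightarrow> x \<in> chart_image c \<and> chart_inv c x \<in> fst d"
  unfolding overlap_def
  by (auto simp: chart_inv_snd snd_in_chart_image chart_inv_in snd_chart_inv intro!: image_eqI[of _ _ "chart_inv c x"])

lemma open_overlap: "c \<in> A \<Longrightarrow> d \<in> A \<Longrightarrow> open (overlap c d)"
  unfolding overlap_def by (rule open_chart_image) (auto intro: openin_Int chart(1))

lemma transition_in_overlap:
  assumes "c \<in> A" "d \<in> A" "x \<in> overlap c d"
  shows "transition c d x \<in> overlap d c" "chart_inv d (transition c d x) = chart_inv c x"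
    "transition d c (transition c d x) = x"
  using assms overlap_iff[OF assms(1)] overlap_iff[OF assms(2)]
  by (simp_all add: transition_def snd_in_chart_image chart_inv_snd chart_inv_in snd_chart_inv)

lemma transition_image: "c \<in> A \<Longrightarrow> d \<in> A \<Longrightarrow> transition c d ` overlap c d = overlap d c"
  using transition_in_overlap by (safe; metis imageI)

lemma inj_on_transition: "c \<in> A \<Longrightarrow> d \<in> A \<Longrightarrow> inj_on (transition c d) (overlap c d)"
  by (rule inj_on_inverseI[where g = "transition d c"]) (rule transition_in_overlap(3))

lemma smooth_transition: "c \<in> A \<Longrightarrow> d \<in> A \<Longrightarrow> smooth_on (transition c d) (overlap c d)"
  using atlas unfolding smooth_atlas_def by blast

lemma transition_has_derivative:
  "c \<in> A \<Longrightarrow> d \<in> A \<Longrightarrow> x \<in> overlap c d \<Longrightarrow>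
    (transition c d has_derivative frechet_derivative (transition c d) (at x)) (at x)"
  by (rule smooth_on_has_derivative[OF smooth_transition])

lemma jacobian_transition:
  assumes "c \<in> A" "d \<in> A" "x \<in> overlap c d"
  shows "jacobian (transition c d) (at x) *v v = frechet_derivative (transition c d) (at x) v"
  unfolding jacobian_def
  by (rule matrix_works[OF has_derivative_linear[OF transition_has_derivative[OF assms], folded linear_matrix_vector_mul_eq]])

section \<open>Functions of class C^1, bump functions and partitions of unity\<close>

definition C1_function :: "('a \<Rightarrow> real) \<Rightarrow> bool" where
  "C1_function f \<longleftrightarrow> (\<forall>c\<in>A. C_k_on (Suc 0) (f \<circ> chart_inv c) (chart_image c))"

text \<open>The chain rule, arranged for X(f): together with the transformation law of X it gives
  X(f) the same value in both charts.\<close>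

lemma derivative_transition:
  assumes f: "C1_function f" and c: "c \<in> A" "d \<in> A" "x \<in> overlap c d"
  shows "frechet_derivative (f \<circ> chart_inv c) (at x) v =
    frechet_derivative (f \<circ> chart_inv d) (at (transition c d x)) (jacobian (transition c d) (at x) *v v)"
proof -
  have t: "transition c d differentiable (at x)"
    using transition_has_derivative[OF c] by (rule differentiableI)
  have "transition c d x \<in> chart_image d"
    using transition_in_overlap[OF c] overlap_iff[OF c(2)] by blast
  then have fd: "(f \<circ> chart_inv d) differentiable (at (transition c d x))"
    using f c unfolding C1_function_def by simp
  have "x \<in> chart_image c" using c overlap_iff by blast
  then have fc: "(f \<circ> chart_inv c) differentiable (at x)"
    using f c unfolding C1_function_def by simp
  have "frechet_derivative (f \<circ> chart_inv c) (at x) = frechet_derivative ((f \<circ> chart_inv d) \<circ> transition c d) (at x)"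
    by (rule frechet_derivative_transform_within_open[OF fc open_overlap[OF c(1,2)] c(3)])
       (use transition_in_overlap(2)[OF c(1,2)] in simp)
  also have "\<dots> = frechet_derivative (f \<circ> chart_inv d) (at (transition c d x)) \<circ> frechet_derivative (transition c d) (at x)"
    by (rule frechet_derivative_compose[OF t fd])
  finally show ?thesis using jacobian_transition[OF c] by simp
qed

lemma derivative_zero_off_closed:
  fixes f :: "'a \<Rightarrow> real"
  assumes K: "closedin M K" and f: "\<And>p. p \<in> topspace M \<Longrightarrow> p \<notin> K \<Longrightarrow> f p = 0"
    and c: "c \<in> A" "x \<in> chart_image c" "chart_inv c x \<notin> K"
  shows "frechet_derivative (f \<circ> chart_inv c) (at x) v = 0"
proof -
  let ?W = "snd c ` (fst c - K)"
  have W: "open ?W" by (rule open_chart_image[OF c(1)]) (auto intro: openin_diff chart(1) c K)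
  have x: "x \<in> ?W" using c chart_inv_in snd_chart_inv by (metis DiffI imageI)
  have "frechet_derivative (\<lambda>x. 0 :: real) (at x) = frechet_derivative (f \<circ> chart_inv c) (at x)"
    by (rule frechet_derivative_transform_within_open[OF _ W x])
       (use f chart_inv_snd[OF c(1)] fst_chart_subset[OF c(1)] in \<open>auto simp: subset_iff\<close>)
  then show ?thesis by (metis frechet_derivative_const)
qed

text \<open>The index holds a chart, a centre and a radius in coordinates. For r > 0 the profile is
  positive exactly on the open ball; the squared distance is spelled out as a polynomial in the
  coordinates, so its smoothness in other charts follows from that of the transition maps.\<close>

definition bump :: "('a, 'n) chart \<times> (real ^ 'n) \<times> real \<Rightarrow> 'a \<Rightarrow> real" where
  "bump t p = (case t of (c, a, r) \<Rightarrow>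
     if p \<in> fst c then (max 0 (r\<^sup>2 - (\<Sum>i\<in>UNIV. (snd c p $ i - a $ i)\<^sup>2)))\<^sup>2 else 0)"

definition bump_support :: "('a, 'n) chart \<times> (real ^ 'n) \<times> real \<Rightarrow> 'a set" where
  "bump_support t = (case t of (c, a, r) \<Rightarrow> chart_inv c ` cball a r)"

definition bump_index :: "('a, 'n) chart \<times> (real ^ 'n) \<times> real \<Rightarrow> bool" where
  "bump_index t \<longleftrightarrow> (case t of (c, a, r) \<Rightarrow> c \<in> A \<and> 0 < r \<and> cball a r \<subseteq> chart_image c)"

lemma sum_squares_dist: "(\<Sum>i\<in>UNIV. (x $ i - a $ i)\<^sup>2) = (dist a x)\<^sup>2" for x a :: "real ^ 'n"
  by (simp add: dist_vec_def L2_set_def dist_real_def sum_nonneg power2_commute[of "a $ _"])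

lemma bump_nonneg: "bump t p \<ge> 0"
  by (simp add: bump_def split: prod.split)

lemma bump_pos:
  assumes "bump_index (c, a, r)" "p \<in> fst c" "snd c p \<in> ball a r"
  shows "bump (c, a, r) p > 0"
proof -
  have "(dist a (snd c p))\<^sup>2 < r\<^sup>2"
    using assms by (intro power_strict_mono) (auto simp: bump_index_def)
  then show ?thesis using assms(2) by (simp add: bump_def sum_squares_dist)
qed

lemma bump_zero:
  assumes t: "bump_index t" and p: "p \<notin> bump_support t"
  shows "bump t p = 0"
proof -
  obtain c a r where [simp]: "t = (c, a, r)" by (cases t)
  have c: "c \<in> A" "0 < r" using t by (auto simp: bump_index_def)
  show ?thesis
  proof (cases "p \<in> fst c")
    case True
    have "snd c p \<notin> cball a r"
      using p chart_inv_snd[OF c(1) True] by (auto simp: bump_support_def) (metis imageI mem_cball)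
    then have "r\<^sup>2 \<le> (dist a (snd c p))\<^sup>2" using c by (intro power_mono) auto
    then show ?thesis by (simp add: bump_def sum_squares_dist)
  qed (simp add: bump_def)
qed

lemma closedin_bump_support: "bump_index t \<Longrightarrow> closedin M (bump_support t)"
  using closedin_chart_inv_compact by (auto simp: bump_index_def bump_support_def split: prod.splits)

lemma bump_support_subset: "bump_index (c, a, r) \<Longrightarrow> bump_support (c, a, r) \<subseteq> fst c"
  by (auto simp: bump_index_def bump_support_def intro!: chart_inv_in)

text \<open>In another chart \<open>d\<close> two open sets cover the image: the overlap with the
  chart of the bump, where the defining formula applies, and the complement of the closed support,
  where the bump is 0.\<close>

lemma C1_bump:
  assumes t: "bump_index t"
  shows "C1_function (bump t)"
  unfolding C1_function_def
proof
  fix d assume d: "d \<in> A"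
  obtain c a r where t_eq [simp]: "t = (c, a, r)" by (cases t)
  have c: "c \<in> A" "0 < r" "cball a r \<subseteq> chart_image c" using t by (auto simp: bump_index_def)
  let ?W = "snd d ` (fst d - bump_support t)"
  have W: "open ?W"
    by (rule open_chart_image[OF d]) (auto intro: openin_diff chart(1) d closedin_bump_support t simp del: t_eq)
  note O = open_overlap[OF d c(1)]
  have "C_k_on (Suc 0) (bump t \<circ> chart_inv d) (overlap d c \<union> ?W)"
  proof (rule C_k_on_Un[OF O W])
    have "smooth_on (\<lambda>y. r\<^sup>2 - (\<Sum>i\<in>UNIV. (transition d c y $ i - a $ i) * (transition d c y $ i - a $ i))) (overlap d c)"
      by (intro smooth_on_diff smooth_on_sum smooth_on_mult smooth_on_const smooth_on_component O
          smooth_transition d c)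
    then have "C_k_on (Suc 0) (\<lambda>y. (max 0 (r\<^sup>2 - (\<Sum>i\<in>UNIV. (transition d c y $ i - a $ i)\<^sup>2)))\<^sup>2) (overlap d c)"
      unfolding power2_eq_square[of "_ $ _ - _"] smooth_on_def by (intro C_k_on_max_square O) blast
    then show "C_k_on (Suc 0) (bump t \<circ> chart_inv d) (overlap d c)"
      by (rule C_k_on_cong[OF O, rotated]) (auto simp: bump_def overlap_iff d transition_def)
    show "C_k_on (Suc 0) (bump t \<circ> chart_inv d) ?W"
    proof (rule C_k_on_cong[OF W _ C_k_on_const])
      show "0 = (bump t \<circ> chart_inv d) x" if "x \<in> ?W" for x
        using that bump_zero[OF t] chart_inv_snd[OF d] by (auto simp del: t_eq)
    qed
  qed
  moreover have "chart_image d \<subseteq> overlap d c \<union> ?W"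
  proof
    fix x assume x: "x \<in> chart_image d"
    have "bump_support t \<subseteq> fst c" using t bump_support_subset by simp
    then show "x \<in> overlap d c \<union> ?W"
      using x chart_inv_in[OF x] snd_chart_inv[OF x] overlap_iff[OF d]
      by (metis DiffI UnI1 UnI2 imageI subsetD)
  qed
  ultimately show "C_k_on (Suc 0) (bump t \<circ> chart_inv d) (chart_image d)"
    by (rule C_k_on_subset)
qed

text \<open>Finitely many bumps with positive sum are divided by that sum. A bump in the given chart
  \<open>c0\<close> that is positive at \<open>p0\<close> is added to the finite cover; it allows a
  conclusion at \<open>p0\<close> from an integral in that very chart.\<close>

lemma partition_of_unity:
  assumes comp: "compact_space M" and c0: "c0 \<in> A" "p0 \<in> fst c0"
  obtains J \<eta> a r where "finite J" "\<And>t. t \<in> J \<Longrightarrow> bump_index t" "\<And>t. t \<in> J \<Longrightarrow> C1_function (\<eta> t)"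
    "\<And>t p. t \<in> J \<Longrightarrow> \<eta> t p \<ge> 0" "\<And>t p. t \<in> J \<Longrightarrow> p \<notin> bump_support t \<Longrightarrow> \<eta> t p = 0"
    "\<And>p. p \<in> topspace M \<Longrightarrow> (\<Sum>t\<in>J. \<eta> t p) = 1" "(c0, a, r) \<in> J" "\<eta> (c0, a, r) p0 > 0"
proof -
  define V where "V t = (case t of (c, a, r) \<Rightarrow> {p \<in> fst c. snd c p \<in> ball a r})"
    for t :: "('a, 'n) chart \<times> (real ^ 'n) \<times> real"
  have nbhd: "\<exists>a r. bump_index (c, a, r) \<and> p \<in> V (c, a, r)" if cp: "c \<in> A" "p \<in> fst c" for c p
  proof -
    obtain r where "0 < r" "cball (snd c p) r \<subseteq> chart_image c"
      using chart(2)[OF cp(1)] snd_in_chart_image[OF cp(2)] open_contains_cball by blast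
    then show ?thesis using cp by (intro exI[of _ "snd c p"] exI[of _ r]) (simp add: bump_index_def V_def)
  qed
  have "openin M U" if "U \<in> V ` Collect bump_index" for U
    using that openin_chart_preimage by (auto simp: V_def bump_index_def simp del: mem_ball)
  moreover have "topspace M \<subseteq> \<Union> (V ` Collect bump_index)"
  proof
    fix p assume "p \<in> topspace M"
    then obtain c where "c \<in> A" "p \<in> fst c" using atlas unfolding smooth_atlas_def by blast
    then show "p \<in> \<Union> (V ` Collect bump_index)" using nbhd by blast
  qed
  ultimately obtain F where F: "finite F" "F \<subseteq> V ` Collect bump_index" "topspace M \<subseteq> \<Union> F"
    using comp unfolding compact_space_alt by (metis (no_types, lifting))
  obtain J0 where J0: "J0 \<subseteq> Collect bump_index" "finite J0" "F = V ` J0"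
    using finite_subset_image[OF F(1,2)] by blast
  obtain a r where ar: "bump_index (c0, a, r)" "p0 \<in> V (c0, a, r)" using nbhd[OF c0] by blast
  define J where "J = insert (c0, a, r) J0"
  have J: "finite J" "\<And>t. t \<in> J \<Longrightarrow> bump_index t" using J0 ar by (auto simp: J_def)
  define \<sigma> where "\<sigma> p = (\<Sum>t\<in>J. bump t p)" for p
  define \<eta> where "\<eta> t p = bump t p * inverse (\<sigma> p)" for t p
  have pos: "bump t p > 0" if "bump_index t" "p \<in> V t" for t p
    using that bump_pos by (cases t) (auto simp: V_def simp del: mem_ball)
  have \<sigma>: "\<sigma> p > 0" if p: "p \<in> topspace M" for p
  proof -
    obtain t where "t \<in> J0" "p \<in> V t" using p F(3) J0(3) by blast
    then have "t \<in> J" "bump t p > 0" using pos[of t p] J0 by (auto simp: J_def)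
    then show ?thesis unfolding \<sigma>_def using J(1) bump_nonneg by (intro sum_pos2) auto
  qed
  have \<sigma>0: "\<sigma> p \<ge> 0" for p unfolding \<sigma>_def by (simp add: sum_nonneg bump_nonneg)
  show thesis
  proof (rule that[of J \<eta> a r])
    show "C1_function (\<eta> t)" if "t \<in> J" for t
      unfolding C1_function_def
    proof
      fix c assume c: "c \<in> A"
      have b: "C_k_on (Suc 0) (\<lambda>x. bump s (chart_inv c x)) (chart_image c)" if "s \<in> J" for s
        using C1_bump[OF J(2)[OF that]] c unfolding C1_function_def o_def by blast
      have n: "(\<Sum>s\<in>J. bump s (chart_inv c x)) \<noteq> 0" if "x \<in> chart_image c" for x
        using \<sigma>[of "chart_inv c x"] chart_inv_in[OF that] fst_chart_subset[OF c] by (auto simp: \<sigma>_def)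
      have "C_k_on (Suc 0) (\<lambda>x. bump t (chart_inv c x) * inverse (\<Sum>s\<in>J. bump s (chart_inv c x))) (chart_image c)"
        using n by (intro C_k_on_mult C_k_on_inverse C_k_on_sum b chart(2) c that)
      then show "C_k_on (Suc 0) (\<eta> t \<circ> chart_inv c) (chart_image c)"
        by (simp only: \<eta>_def \<sigma>_def o_def)
    qed
    show "\<eta> t p \<ge> 0" for t p using bump_nonneg \<sigma>0 by (simp add: \<eta>_def)
    show "\<eta> t p = 0" if "t \<in> J" "p \<notin> bump_support t" for t p
      using bump_zero[OF J(2)] that by (simp add: \<eta>_def)
    show "(\<Sum>t\<in>J. \<eta> t p) = 1" if "p \<in> topspace M" for p
      using \<sigma>[OF that] unfolding \<eta>_def sum_distrib_right[symmetric] \<sigma>_def[symmetric] by simp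
    show "\<eta> (c0, a, r) p0 > 0"
      using pos[OF ar] \<sigma>[of p0] c0(2) subsetD[OF fst_chart_subset[OF c0(1)]] by (simp add: \<eta>_def)
  qed (use J in \<open>auto simp: J_def\<close>)
qed

text \<open>Only nonnegative divergences are considered, so no invariance of the divergence under changes
  of charts is needed: with a partition of unity \<open>\<eta>\<close>, the integrals of \<open>\<eta>\<^sub>t div X\<close> sum up to
  minus those of \<open>X(\<eta>\<^sub>t)\<close>, and only the latter are compared in different charts.\<close>

theorem divergence_nonneg_imp_zero:
  fixes X :: "('a, 'n) chart \<Rightarrow> real ^ 'n \<Rightarrow> real ^ 'n" and w :: "('a, 'n) chart \<Rightarrow> real ^ 'n \<Rightarrow> real"
  assumes comp: "compact_space M"
    and w: "\<And>c. c \<in> A \<Longrightarrow> C_k_on (Suc 0) (w c) (chart_image c)"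
    and w_law: "\<And>c d x. c \<in> A \<Longrightarrow> d \<in> A \<Longrightarrow> x \<in> overlap c d \<Longrightarrow>
      w c x = \<bar>det (jacobian (transition c d) (at x))\<bar> * w d (transition c d x)"
    and X: "\<And>c k. c \<in> A \<Longrightarrow> C_k_on (Suc 0) (\<lambda>x. X c x $ k) (chart_image c)"
    and X_law: "\<And>c d x. c \<in> A \<Longrightarrow> d \<in> A \<Longrightarrow> x \<in> overlap c d \<Longrightarrow>
      X d (transition c d x) = jacobian (transition c d) (at x) *v X c x"
    and nonneg: "\<And>c x. c \<in> A \<Longrightarrow> x \<in> chart_image c \<Longrightarrow>
      0 \<le> (\<Sum>k\<in>UNIV. partial k (\<lambda>y. w c y * X c y $ k) x)"
    and c0: "c0 \<in> A" "x0 \<in> chart_image c0"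
  shows "(\<Sum>k\<in>UNIV. partial k (\<lambda>y. w c0 y * X c0 y $ k) x0) = 0"
proof -
  obtain J \<eta> a0 r0 where J: "finite J" "\<And>t. t \<in> J \<Longrightarrow> bump_index t"
    and C1: "\<And>t. t \<in> J \<Longrightarrow> C1_function (\<eta> t)"
    and \<eta>0: "\<And>t p. t \<in> J \<Longrightarrow> \<eta> t p \<ge> 0"
    and \<eta>z: "\<And>t p. t \<in> J \<Longrightarrow> p \<notin> bump_support t \<Longrightarrow> \<eta> t p = 0"
    and \<eta>1: "\<And>p. p \<in> topspace M \<Longrightarrow> (\<Sum>t\<in>J. \<eta> t p) = 1"
    and t0: "(c0, a0, r0) \<in> J" "\<eta> (c0, a0, r0) (chart_inv c0 x0) > 0"
    by (rule partition_of_unity[OF comp c0(1) chart_inv_in[OF c0(2)]]) (rule that; assumption)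
  define dv where "dv c x = (\<Sum>k\<in>UNIV. partial k (\<lambda>y. w c y * X c y $ k) x)" for c x
  define fd where "fd c t x = frechet_derivative (\<eta> t \<circ> chart_inv c) (at x) (X c x)" for c t x
  define ext where "ext c e x = (if x \<in> chart_image c then e x else 0)"
    for c :: "('a, 'n) chart" and e :: "real ^ 'n \<Rightarrow> real" and x
  define E where "E c t = ext c (\<lambda>x. \<eta> t (chart_inv c x) * dv c x)" for c t
  \<comment> \<open>The integrand \<eta>_s w X(\<eta>_t) in chart \<open>c\<close>, extended by
    zero. It vanishes off the supports of both \<open>t\<close> and \<open>s\<close>, so it can be
    integrated in the chart of either.\<close>
  define F where "F c t s = ext c (\<lambda>x. \<eta> s (chart_inv c x) * (w c x * fd c t x))" for c t s
  have inJ: "c \<in> A" "0 < r" "cball a r \<subseteq> chart_image c" if "(c, a, r) \<in> J" for c a r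
    using J(2)[OF that] by (auto simp: bump_index_def)
  have \<eta>C: "C_k_on (Suc 0) (\<lambda>x. \<eta> t (chart_inv c x)) (chart_image c)" if "t \<in> J" "c \<in> A" for t c
    using C1[OF that(1)] that(2) unfolding C1_function_def o_def by blast
  have \<eta>d: "(\<eta> t \<circ> chart_inv c) differentiable (at x)" if "t \<in> J" "c \<in> A" "x \<in> chart_image c" for t c x
    using C1[OF that(1)] that(2,3) unfolding C1_function_def by simp
  have wX: "C_k_on (Suc 0) (\<lambda>x. w c x * X c x $ k) (chart_image c)" if "c \<in> A" for c k
    using that by (intro C_k_on_mult chart(2) w X)
  have fd_eq: "fd c t x = (\<Sum>k\<in>UNIV. X c x $ k * partial k (\<eta> t \<circ> chart_inv c) x)"
    if "t \<in> J" "c \<in> A" "x \<in> chart_image c" for t c x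
    unfolding fd_def by (rule frechet_derivative_eq_sum_partial[OF \<eta>d[OF that]])
  have cont_fd: "continuous_on (chart_image c) (fd c t)" if "t \<in> J" "c \<in> A" for c t
  proof -
    have "continuous_on (chart_image c) (\<lambda>x. X c x $ k)" for k
      using C_k_on_Suc_D[OF X[OF that(2)]] by simp
    moreover have "continuous_on (chart_image c) (partial k (\<eta> t \<circ> chart_inv c))" for k
      using C1[OF that(1)] that(2) unfolding C1_function_def partial_def[abs_def] by simp
    ultimately have "continuous_on (chart_image c) (\<lambda>x. \<Sum>k\<in>UNIV. X c x $ k * partial k (\<eta> t \<circ> chart_inv c) x)"
      by (intro continuous_on_sum continuous_on_mult)
    moreover have "continuous_on (chart_image c) (fd c t) \<longleftrightarrow>
        continuous_on (chart_image c) (\<lambda>x. \<Sum>k\<in>UNIV. X c x $ k * partial k (\<eta> t \<circ> chart_inv c) x)"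
      by (rule continuous_on_cong[OF refl fd_eq[OF that]])
    ultimately show ?thesis by (rule iffD2[rotated])
  qed
  have cont_w: "continuous_on (chart_image c) (w c)" if "c \<in> A" for c
    using C_k_on_Suc_D[OF w[OF that]] by simp
  have cont_\<eta>: "continuous_on (chart_image c) (\<lambda>x. \<eta> t (chart_inv c x))" if "t \<in> J" "c \<in> A" for c t
    using C_k_on_Suc_D[OF \<eta>C[OF that]] by simp
  have cont_dv: "continuous_on (chart_image c) (dv c)" if "c \<in> A" for c
    using wX[OF that] unfolding dv_def[abs_def] partial_def by (intro continuous_on_sum) simp
  have outside: "chart_inv c x \<notin> bump_support (c, a, r)" if "x \<in> chart_image c" "x \<notin> cball a r"
    "cball a r \<subseteq> chart_image c" for c a r x
  proof
    assume "chart_inv c x \<in> bump_support (c, a, r)"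
    then obtain z where z: "z \<in> cball a r" "chart_inv c x = chart_inv c z"
      unfolding bump_support_def prod.case by (rule imageE)
    then have "x = z" using snd_chart_inv[OF that(1)] snd_chart_inv[of z c] that(3) by auto
    then show False using z that(2) by simp
  qed
  have fd_zero: "fd c t x = 0" if "t \<in> J" "c \<in> A" "x \<in> chart_image c" "chart_inv c x \<notin> bump_support t" for c t x
    unfolding fd_def
    by (rule derivative_zero_off_closed[OF closedin_bump_support[OF J(2)[OF that(1)]] \<eta>z[OF that(1)] that(2-4)])
  have extC: "C_k_on k (ext c e) UNIV \<and> (\<forall>x. x \<notin> cball a r \<longrightarrow> ext c e x = 0)"
    if "(c, a, r) \<in> J" "C_k_on k e (chart_image c)"
      "\<And>x. x \<in> chart_image c \<Longrightarrow> chart_inv c x \<notin> bump_support (c, a, r) \<Longrightarrow> e x = 0" for c a r e k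
  proof -
    note j = inJ[OF that(1)]
    have z: "e x = 0" if "x \<in> chart_image c" "x \<notin> cball a r" for x
      using \<open>\<And>x. x \<in> chart_image c \<Longrightarrow> chart_inv c x \<notin> bump_support (c, a, r) \<Longrightarrow> e x = 0\<close> that outside j by blast
    have "C_k_on k (ext c e) UNIV"
      unfolding ext_def[abs_def]
      by (rule C_k_on_extend_zero[OF chart(2)[OF j(1)] that(2) closed_cball j(3) z])
    then show ?thesis using z by (auto simp: ext_def)
  qed
  have ext_cont: "continuous_on UNIV (ext c e)" and ext_zero: "x \<notin> cball a r \<Longrightarrow> ext c e x = 0"
    and ext_int: "ext c e integrable_on UNIV"
    if "(c, a, r) \<in> J" "continuous_on (chart_image c) e"
      "\<And>x. x \<in> chart_image c \<Longrightarrow> chart_inv c x \<notin> bump_support (c, a, r) \<Longrightarrow> e x = 0" for c a r e x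
    using extC[of c a r 0 e] that integrable_on_UNIV_continuous[of "ext c e" a r] by auto
  have E_props: "continuous_on UNIV (E c (c, a, r))" "\<And>x. x \<notin> cball a r \<Longrightarrow> E c (c, a, r) x = 0"
      "E c (c, a, r) integrable_on UNIV" if t: "(c, a, r) \<in> J" for c a r
  proof -
    have e: "continuous_on (chart_image c) (\<lambda>x. \<eta> (c, a, r) (chart_inv c x) * dv c x)"
      using inJ[OF t] t by (intro continuous_on_mult cont_\<eta> cont_dv)
    show "continuous_on UNIV (E c (c, a, r))" "\<And>x. x \<notin> cball a r \<Longrightarrow> E c (c, a, r) x = 0"
      "E c (c, a, r) integrable_on UNIV"
      unfolding E_def using ext_cont[OF t e] ext_zero[OF t e] ext_int[OF t e] \<eta>z[OF t] by auto
  qed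
  have F_cont: "continuous_on (chart_image c) (\<lambda>x. \<eta> s (chart_inv c x) * (w c x * fd c t x))"
    if "t \<in> J" "s \<in> J" "c \<in> A" for c t s
    using that by (intro continuous_on_mult cont_\<eta> cont_w cont_fd)
  have F_props: "continuous_on UNIV (F c t s)" "\<And>x. x \<notin> cball a r \<Longrightarrow> F c t s x = 0"
      "F c t s integrable_on UNIV"
    if ts: "t \<in> J" "s \<in> J" and or: "t = (c, a, r) \<or> s = (c, a, r)" for c a r t s
  proof -
    have j: "(c, a, r) \<in> J" using ts or by auto
    note e = F_cont[OF ts inJ(1)[OF j]]
    have z: "\<eta> s (chart_inv c x) * (w c x * fd c t x) = 0"
      if "x \<in> chart_image c" "chart_inv c x \<notin> bump_support (c, a, r)" for x
      using or \<eta>z[OF ts(2)] fd_zero[OF ts(1) inJ(1)[OF j] that(1)] that(2) by auto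
    show "continuous_on UNIV (F c t s)" "\<And>x. x \<notin> cball a r \<Longrightarrow> F c t s x = 0" "F c t s integrable_on UNIV"
      unfolding F_def using ext_cont[OF j e] ext_zero[OF j e] ext_int[OF j e] z by auto
  qed
  \<comment> \<open>The compactly supported field \<eta>_t w X has a coordinate divergence with
    integral 0. The product rule splits off w X(\<eta>_t), and inserting the sum of all \<eta>_s,
    which is 1, distributes this term over the indices \<open>s\<close>.\<close>
  have stokes: "integral UNIV (E c t) = - (\<Sum>s\<in>J. integral UNIV (F c t s))"
    if t: "t \<in> J" and t_eq: "t = (c, a, r)" for c a r t
  proof -
    have t': "(c, a, r) \<in> J" using t t_eq by simp
    note j = inJ[OF t']
    define Y where "Y k = ext c (\<lambda>x. \<eta> t (chart_inv c x) * (w c x * X c x $ k))" for k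
    have Y: "C_k_on (Suc 0) (Y k) UNIV" "\<And>x. x \<notin> cball a r \<Longrightarrow> Y k x = 0" for k
    proof -
      have "C_k_on (Suc 0) (\<lambda>x. \<eta> t (chart_inv c x) * (w c x * X c x $ k)) (chart_image c)"
        by (intro C_k_on_mult \<eta>C wX chart(2) j t)
      from extC[OF t' this] \<eta>z[OF t] t_eq
      show "C_k_on (Suc 0) (Y k) UNIV" "\<And>x. x \<notin> cball a r \<Longrightarrow> Y k x = 0" by (auto simp: Y_def)
    qed
    have Yz: "partial k (Y k) x = 0" if "x \<notin> cball a r" for k x
    proof -
      have "partial k (\<lambda>x. 0) x = partial k (Y k) x"
        by (rule partial_cong[of "- cball a r"]) (use that Y(2) in auto)
      then show ?thesis by simp
    qed
    have Yc: "continuous_on UNIV (partial k (Y k))" for k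
      using Y(1)[of k] unfolding partial_def[abs_def] by simp
    have sum_eq: "(\<Sum>k\<in>UNIV. partial k (Y k) x) = E c t x + (\<Sum>s\<in>J. F c t s x)" for x
    proof (cases "x \<in> chart_image c")
      case True
      have "partial k (Y k) x = partial k (\<eta> t \<circ> chart_inv c) x * (w c x * X c x $ k)
          + \<eta> t (chart_inv c x) * partial k (\<lambda>y. w c y * X c y $ k) x" for k
      proof -
        have dw: "(\<lambda>y. w c y * X c y $ k) differentiable (at x)"
          using wX[OF j(1)] True by simp
        have "partial k (Y k) x = partial k (\<lambda>x. (\<eta> t \<circ> chart_inv c) x * (w c x * X c x $ k)) x"
          by (rule partial_cong[OF chart(2)[OF j(1)] True]) (use Y(1)[of k] in \<open>auto simp: Y_def ext_def\<close>)
        also have "\<dots> = partial k (\<eta> t \<circ> chart_inv c) x * (w c x * X c x $ k)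
          + (\<eta> t \<circ> chart_inv c) x * partial k (\<lambda>y. w c y * X c y $ k) x"
          by (rule partial_mult[OF \<eta>d[OF t j(1) True] dw])
        finally show ?thesis by simp
      qed
      then have "(\<Sum>k\<in>UNIV. partial k (Y k) x) = w c x * fd c t x + \<eta> t (chart_inv c x) * dv c x"
        by (simp add: fd_eq[OF t j(1) True] dv_def sum.distrib sum_distrib_left ac_simps)
      moreover have "(\<Sum>s\<in>J. F c t s x) = w c x * fd c t x"
        using True \<eta>1[of "chart_inv c x"] chart_inv_in[OF True] fst_chart_subset[OF j(1)]
        by (simp add: F_def ext_def sum_distrib_right[symmetric] subset_iff)
      ultimately show ?thesis using True by (simp add: E_def ext_def)
    next
      case False
      then have "x \<notin> cball a r" using j(3) by blast
      then show ?thesis using Yz False by (simp add: E_def F_def ext_def)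
    qed
    have "0 = (\<Sum>k\<in>UNIV. integral UNIV (partial k (Y k)))"
      using integral_partial_eq_0[OF Y] by simp
    also have "\<dots> = integral UNIV (\<lambda>x. \<Sum>k\<in>UNIV. partial k (Y k) x)"
      by (rule integral_sum[symmetric]) (use integrable_on_UNIV_continuous[OF Yc Yz] in auto)
    also have "\<dots> = integral UNIV (E c t) + (\<Sum>s\<in>J. integral UNIV (F c t s))"
      unfolding sum_eq using E_props(3)[OF t'] F_props(3)[OF t _ disjI1[OF t_eq]] J(1) t_eq
      by (simp add: integral_add integral_sum integrable_sum)
    finally show ?thesis by simp
  qed
  \<comment> \<open>As \<open>w\<close> transforms like a density and X(\<eta>_t) is chart
    independent, the change of variables along the transition map moves the integral from the chart
    of \<open>t\<close> to that of \<open>s\<close>.\<close>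
  have swap: "integral UNIV (F (fst t) t s) = integral UNIV (F (fst s) t s)" if ts: "t \<in> J" "s \<in> J" for t s
  proof -
    obtain c a r where t: "t = (c, a, r)" by (cases t)
    obtain d b q where s: "s = (d, b, q)" by (cases s)
    have c: "c \<in> A" and d: "d \<in> A" using inJ ts t s by blast+
    have supp_t: "bump_support t \<subseteq> fst c" and supp_s: "bump_support s \<subseteq> fst d"
      using J(2) ts bump_support_subset unfolding t s by blast+
    obtain u1 where u1: "cball a r \<subseteq> cbox (- u1) u1"
      using bounded_subset_cbox_symmetric[OF bounded_cball] by metis
    obtain u2 where u2: "cball b q \<subseteq> cbox (- u2) u2"
      using bounded_subset_cbox_symmetric[OF bounded_cball] by metis
    have "integral UNIV (F c t s) = integral UNIV (F d t s)"
    proof (rule integral_transform[OF open_overlap[OF c d] transition_has_derivative[OF c d] inj_on_transition[OF c d]])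
      show "continuous_on UNIV (F c t s)" by (rule F_props(1)[OF ts disjI1[OF t]])
      show "continuous_on UNIV (F d t s)" by (rule F_props(1)[OF ts disjI2[OF s]])
      show "F c t s x = 0" if "x \<notin> cbox (- u1) u1" for x
        using that u1 by (intro F_props(2)[OF ts disjI1[OF t]]) blast
      show "F d t s x = 0" if "x \<notin> cbox (- u2) u2" for x
        using that u2 by (intro F_props(2)[OF ts disjI2[OF s]]) blast
      show "F c t s x = 0" if "x \<notin> overlap c d" for x
        using that \<eta>z[OF ts(2)] supp_s unfolding overlap_iff[OF c] F_def ext_def by auto
      show "F d t s x = 0" if "x \<notin> transition c d ` overlap c d" for x
        using that fd_zero[OF ts(1) d] supp_t
        unfolding transition_image[OF c d] overlap_iff[OF d] F_def ext_def by auto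
      show "F c t s x = \<bar>det (matrix (frechet_derivative (transition c d) (at x)))\<bar> * F d t s (transition c d x)"
        if x: "x \<in> overlap c d" for x
      proof -
        have 1: "x \<in> chart_image c" "transition c d x \<in> chart_image d"
          using x overlap_iff c d transition_in_overlap(1) by blast+
        have "fd c t x = fd d t (transition c d x)"
          unfolding fd_def X_law[OF c d x] by (rule derivative_transition[OF C1[OF ts(1)] c d x])
        then show ?thesis
          using 1 w_law[OF c d x] transition_in_overlap(2)[OF c d x]
          by (simp add: F_def ext_def jacobian_def)
      qed
    qed
    then show ?thesis by (simp add: t s)
  qed
  \<comment> \<open>In the fixed chart of \<open>s\<close> the \<eta>_t add up to the constant 1, so
    the X(\<eta>_t) add up to 0.\<close>
  have zero: "(\<Sum>t\<in>J. integral UNIV (F (fst s) t s)) = 0" if s: "s \<in> J" for s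
  proof -
    obtain d b q where s_eq: "s = (d, b, q)" by (cases s)
    have d: "d \<in> A" using inJ s s_eq by blast
    have "(\<Sum>t\<in>J. F d t s x) = 0" for x
    proof (cases "x \<in> chart_image d")
      case True
      have "((\<lambda>y. \<Sum>t\<in>J. (\<eta> t \<circ> chart_inv d) y) has_derivative
          (\<lambda>v. \<Sum>t\<in>J. frechet_derivative (\<eta> t \<circ> chart_inv d) (at x) v)) (at x)"
        by (rule has_derivative_sum) (use \<eta>d[OF _ d True] in \<open>simp only: frechet_derivative_works\<close>)
      moreover have "((\<lambda>y. \<Sum>t\<in>J. (\<eta> t \<circ> chart_inv d) y) has_derivative (\<lambda>v. 0)) (at x)"
      proof (rule has_derivative_transform_within_open[OF has_derivative_const chart(2)[OF d] True])
        show "1 = (\<Sum>t\<in>J. (\<eta> t \<circ> chart_inv d) y)" if "y \<in> chart_image d" for y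
          using \<eta>1[of "chart_inv d y"] chart_inv_in[OF that] fst_chart_subset[OF d] by auto
      qed
      ultimately have "(\<lambda>v. \<Sum>t\<in>J. frechet_derivative (\<eta> t \<circ> chart_inv d) (at x) v) = (\<lambda>v. 0)"
        by (rule has_derivative_unique)
      then have "(\<Sum>t\<in>J. fd d t x) = 0" unfolding fd_def by (rule fun_cong)
      then show ?thesis using True by (simp add: F_def ext_def sum_distrib_left[symmetric])
    qed (simp add: F_def ext_def)
    then have "integral UNIV (\<lambda>x. \<Sum>t\<in>J. F d t s x) = 0" by simp
    then show ?thesis
      using F_props(3)[OF _ s disjI2[OF s_eq]] J(1) by (simp add: s_eq integral_sum)
  qed
  have "integral UNIV (E (fst t) t) = - (\<Sum>s\<in>J. integral UNIV (F (fst t) t s))" if "t \<in> J" for t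
    using stokes[OF that, of "fst t" "fst (snd t)" "snd (snd t)"] by simp
  then have "(\<Sum>t\<in>J. integral UNIV (E (fst t) t)) = - (\<Sum>t\<in>J. \<Sum>s\<in>J. integral UNIV (F (fst t) t s))"
    by (simp add: sum_negf)
  also have "(\<Sum>t\<in>J. \<Sum>s\<in>J. integral UNIV (F (fst t) t s)) = (\<Sum>s\<in>J. \<Sum>t\<in>J. integral UNIV (F (fst s) t s))"
    by (subst sum.swap) (simp add: swap)
  also have "\<dots> = 0" using zero by simp
  finally have sum0: "(\<Sum>t\<in>J. integral UNIV (E (fst t) t)) = 0" by simp
  have E0: "E c t x \<ge> 0" if "t \<in> J" "c \<in> A" for c t x
    using \<eta>0[OF that(1)] nonneg[OF that(2)] by (simp add: E_def ext_def dv_def)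
  have "integral UNIV (E (fst t) t) \<ge> 0" if "t \<in> J" for t
    using E_props(3)[of "fst t" "fst (snd t)" "snd (snd t)"] E0[OF that] inJ(1)[of "fst t" "fst (snd t)" "snd (snd t)"] that
    by (intro integral_nonneg) auto
  \<comment> \<open>Nonnegative integrals with sum zero vanish individually; the member of the
    partition that is positive at the given point then forces the divergence there to be 0.\<close>
  then have "integral UNIV (E c0 (c0, a0, r0)) = 0"
    using sum0 t0(1) J(1) by (subst (asm) sum_nonneg_eq_0_iff) force+
  then have "E c0 (c0, a0, r0) x0 = 0"
    using continuous_integral_0_nonneg[OF E_props(1,2)[OF t0(1)] E0[OF t0(1) c0(1)]] by blast
  then show ?thesis using t0(2) c0(2) by (simp add: E_def ext_def dv_def)
qed

end

section \<open>The Lie derivative of the metric under changes of charts\<close>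

text \<open>The transformation law of the inverse metric; \<open>J\<close> is invertible because det
  J divides det B \<noteq> 0.\<close>

lemma matrix_inv_congruence:
  fixes B C J :: "real ^ 'n ^ 'n::finite"
  assumes B: "B = transpose J ** C ** J" and d: "det B \<noteq> 0"
  shows "J ** matrix_inv B ** transpose J = matrix_inv C"
proof -
  have dJ: "det J \<noteq> 0" using d unfolding B by (auto simp: det_mul)
  then have dJt: "det (transpose J) \<noteq> 0" by simp
  define K where "K = matrix_inv (transpose J)"
  have C: "C = K ** B ** matrix_inv J"
  proof -
    have "K ** B ** matrix_inv J = (K ** transpose J) ** C ** (J ** matrix_inv J)"
      unfolding B by (simp add: matrix_mul_assoc)
    then show ?thesis by (simp add: K_def matrix_inv_right_left[OF dJ] matrix_inv_right_left[OF dJt])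
  qed
  have "C ** (J ** matrix_inv B ** transpose J) = K ** B ** (matrix_inv J ** J) ** matrix_inv B ** transpose J"
    unfolding C by (simp add: matrix_mul_assoc)
  also have "\<dots> = K ** (B ** matrix_inv B) ** transpose J"
    by (simp add: matrix_inv_right_left[OF dJ] matrix_mul_assoc)
  also have "\<dots> = mat 1"
    by (simp add: matrix_inv_right_left[OF d] matrix_inv_right_left[OF dJt] K_def)
  finally show ?thesis by (rule matrix_inv_eqI[symmetric])
qed

text \<open>Cyclicity of the trace moves \<open>J\<close> round to the inverse metric. This is what
  makes the scalar curvature chart independent.\<close>

lemma trace_congruence:
  fixes B C J R S :: "real ^ 'n ^ 'n::finite"
  assumes "B = transpose J ** C ** J" "det B \<noteq> 0" "R = transpose J ** S ** J"
  shows "trace (matrix_inv B ** R) = trace (matrix_inv C ** S)"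
proof -
  have "trace (matrix_inv B ** R) = trace ((matrix_inv B ** transpose J ** S) ** J)"
    by (simp add: assms(3) matrix_mul_assoc)
  also have "\<dots> = trace (J ** (matrix_inv B ** transpose J ** S))" by (rule trace_mul_sym)
  also have "\<dots> = trace ((J ** matrix_inv B ** transpose J) ** S)" by (simp add: matrix_mul_assoc)
  finally show ?thesis by (simp add: matrix_inv_congruence[OF assms(1,2)])
qed

definition mat_directional ::
  "real ^ 'n::finite \<Rightarrow> (real ^ 'n \<Rightarrow> real ^ 'm ^ 'm::finite) \<Rightarrow> real ^ 'n \<Rightarrow> real ^ 'm ^ 'm" where
  "mat_directional v A x = (\<Sum>k\<in>UNIV. v $ k *\<^sub>R mat_partial k A x)"

lemma mat_directional_nth: "mat_directional v A x $ a $ b = (\<Sum>k\<in>UNIV. v $ k * partial k (\<lambda>y. A y $ a $ b) x)"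
  by (simp add: mat_directional_def mat_partial_def)

lemma mat_directional_mult:
  assumes "open U" "x \<in> U" "mat_smooth_on A U" "mat_smooth_on B U"
  shows "mat_directional v (\<lambda>y. A y ** B y) x = mat_directional v A x ** B x + A x ** mat_directional v B x"
proof -
  have "(\<Sum>k\<in>K. v $ k *\<^sub>R (mat_partial k A x ** B x + A x ** mat_partial k B x)) =
     (\<Sum>k\<in>K. v $ k *\<^sub>R mat_partial k A x) ** B x + A x ** (\<Sum>k\<in>K. v $ k *\<^sub>R mat_partial k B x)"
    if "finite K" for K
    using that by induction
      (simp_all add: mat_mult_zero mat_mult_add_left mat_mult_add_right mat_mult_scaleR_left
        mat_mult_scaleR_right scaleR_add_right algebra_simps)
  then show ?thesis
    unfolding mat_directional_def mat_partial_mult[OF assms] by simp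
qed

lemma mat_directional_cong:
  assumes "open U" "x \<in> U" "mat_smooth_on A U" "\<And>y. y \<in> U \<Longrightarrow> A y = B y"
  shows "mat_directional v A x = mat_directional v B x"
  unfolding mat_directional_def using mat_partial_cong[OF assms] by simp

lemma mat_directional_transpose:
  "mat_directional v (\<lambda>y. transpose (A y)) x = transpose (mat_directional v A x)"
  by (simp add: vec_eq_iff mat_directional_nth transpose_def)

lemma lie_derivative_directional:
  "lie_derivative_metric \<xi> g x = mat_directional (\<xi> x) g x + transpose (jac \<xi> x) ** g x + g x ** jac \<xi> x"
  unfolding lie_derivative_eq mat_directional_def ..

lemma jacobian_nth:
  assumes "f differentiable (at x)"
  shows "jacobian f (at x) $ a $ b = partial b (\<lambda>y. f y $ a) x"
proof -
  have "(f has_derivative frechet_derivative f (at x)) (at x)"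
    using assms by (simp add: frechet_derivative_works)
  then have "((\<lambda>y. f y $ a) has_derivative (\<lambda>v. frechet_derivative f (at x) v $ a)) (at x)"
    by (rule bounded_linear.has_derivative[OF bounded_linear_vec_nth])
  from partial_eqI[OF this] show ?thesis by (simp add: jacobian_def matrix_def)
qed

lemma frechet_derivative_chain:
  fixes h :: "real ^ 'm::finite \<Rightarrow> real" and f :: "real ^ 'n::finite \<Rightarrow> real ^ 'm"
  assumes f: "f differentiable (at x)" and h: "h differentiable (at (f x))"
  shows "(\<Sum>k\<in>UNIV. v $ k * partial k (\<lambda>y. h (f y)) x) =
    (\<Sum>m\<in>UNIV. (jacobian f (at x) *v v) $ m * partial m h (f x))"
proof -
  have hf: "(h \<circ> f) differentiable (at x)" using f h by (rule differentiable_chain_at)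
  have J: "jacobian f (at x) *v v = frechet_derivative f (at x) v"
    unfolding jacobian_def by (rule matrix_works) (use linear_frechet_derivative[OF f] in \<open>simp add: linear_matrix_vector_mul_eq\<close>)
  have "(\<Sum>k\<in>UNIV. v $ k * partial k (h \<circ> f) x) = frechet_derivative (h \<circ> f) (at x) v"
    by (rule frechet_derivative_eq_sum_partial[OF hf, symmetric])
  also have "\<dots> = frechet_derivative h (at (f x)) (jacobian f (at x) *v v)"
    by (simp add: frechet_derivative_compose[OF f h] J)
  also have "\<dots> = (\<Sum>m\<in>UNIV. (jacobian f (at x) *v v) $ m * partial m h (f x))"
    by (rule frechet_derivative_eq_sum_partial[OF h])
  finally show ?thesis by (simp add: o_def)
qed

lemma smooth_lie_derivative:
  assumes U: "open U" and g: "mat_smooth_on g U" and \<xi>: "\<And>k. smooth_on (\<lambda>y. \<xi> y $ k) U"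
  shows "mat_smooth_on (lie_derivative_metric \<xi> g) U"
  unfolding mat_smooth_on_def lie_derivative_metric_def
  using \<xi> mat_smooth_onD[OF g]
  by (auto intro!: smooth_on_sum[OF U] smooth_on_add[OF U] smooth_on_mult[OF U] smooth_on_partial)

text \<open>Naturality of the Lie derivative under a change of coordinates \<phi>. The derivative
  \<open>DJ\<close> of the Jacobian along \<xi> arises both from the pulled back metric and, in
  \<open>N\<close>, from the field law; substituting \<open>N\<close> absorbs every second
  derivative of \<phi>.\<close>

lemma lie_derivative_pullback:
  fixes \<phi> :: "real ^ 'n::finite \<Rightarrow> real ^ 'n"
  assumes W: "open W" and x: "x \<in> W" and \<phi>: "smooth_on \<phi> W"
    and V: "open V" "\<And>y. y \<in> W \<Longrightarrow> \<phi> y \<in> V"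
    and g': "mat_smooth_on g' V" and \<xi>': "\<And>k. smooth_on (\<lambda>y. \<xi>' y $ k) V"
    and g: "mat_smooth_on g W" and \<xi>: "\<And>k. smooth_on (\<lambda>y. \<xi> y $ k) W"
    and det: "\<And>y. y \<in> W \<Longrightarrow> det (g y) \<noteq> 0"
    and g_law: "\<And>y. y \<in> W \<Longrightarrow>
      g y = transpose (jacobian \<phi> (at y)) ** g' (\<phi> y) ** jacobian \<phi> (at y)"
    and \<xi>_law: "\<And>y. y \<in> W \<Longrightarrow> \<xi>' (\<phi> y) = jacobian \<phi> (at y) *v \<xi> y"
  shows "lie_derivative_metric \<xi> g x = transpose (jacobian \<phi> (at x))
    ** lie_derivative_metric \<xi>' g' (\<phi> x) ** jacobian \<phi> (at x)"
proof -
  define J where "J y = jacobian \<phi> (at y)" for y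
  have d\<phi>: "\<phi> differentiable (at y)" if "y \<in> W" for y
    using smooth_on_differentiable[OF \<phi> that] .
  have J_nth: "J y $ a $ b = partial b (\<lambda>y. \<phi> y $ a) y" if "y \<in> W" for y a b
    unfolding J_def by (rule jacobian_nth[OF d\<phi>[OF that]])
  have J: "mat_smooth_on J W"
    unfolding mat_smooth_on_def
  proof (intro allI)
    fix a b
    show "smooth_on (\<lambda>y. J y $ a $ b) W"
      by (rule smooth_on_cong[OF W _ smooth_on_partial[OF smooth_on_component[OF W \<phi>]]])
         (rule J_nth[symmetric])
  qed
  have gl: "g y = transpose (J y) ** g' (\<phi> y) ** J y" if "y \<in> W" for y
    unfolding J_def by (rule g_law[OF that])
  have dJ: "det (J y) \<noteq> 0" if "y \<in> W" for y
    using det[OF that] unfolding gl[OF that] by (auto simp: det_mul)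
  have Jt: "mat_smooth_on (\<lambda>y. transpose (J y)) W" by (rule mat_smooth_on_transpose[OF J])
  \<comment> \<open>Smoothness of g' composed with \<phi> is read off from the metric law, solved
    for this matrix, rather than from a chain rule of all orders.\<close>
  have g'\<phi>: "mat_smooth_on (\<lambda>y. g' (\<phi> y)) W"
  proof (rule mat_smooth_on_cong[OF W])
    show "mat_smooth_on (\<lambda>y. matrix_inv (transpose (J y)) ** g y ** matrix_inv (J y)) W"
      using dJ by (intro mat_smooth_on_mult mat_smooth_on_matrix_inv W J Jt g) auto
    show "matrix_inv (transpose (J y)) ** g y ** matrix_inv (J y) = g' (\<phi> y)" if "y \<in> W" for y
    proof -
      have dJt: "det (transpose (J y)) \<noteq> 0" using dJ[OF that] by simp
      have "matrix_inv (transpose (J y)) ** g y ** matrix_inv (J y) =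
          (matrix_inv (transpose (J y)) ** transpose (J y)) ** g' (\<phi> y) ** (J y ** matrix_inv (J y))"
        unfolding gl[OF that] by (simp add: matrix_mul_assoc)
      then show ?thesis by (simp add: matrix_inv_right_left[OF dJ[OF that]] matrix_inv_right_left[OF dJt])
    qed
  qed
  have Dg': "mat_directional (\<xi> x) (\<lambda>y. g' (\<phi> y)) x = mat_directional (\<xi>' (\<phi> x)) g' (\<phi> x)"
    unfolding vec_eq_iff mat_directional_nth \<xi>_law[OF x]
    by (intro allI frechet_derivative_chain d\<phi> x smooth_on_differentiable[OF mat_smooth_onD[OF g']] V)
  define DJ where "DJ = mat_directional (\<xi> x) J x"
  \<comment> \<open>The derivative of the field law; second derivatives of \<phi> commute, which
    turns the j-th derivative of \<open>J\<close> applied to \<xi> into a derivative of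
    \<open>J\<close> along \<xi>.\<close>
  have N: "jac \<xi>' (\<phi> x) ** J x = DJ + J x ** jac \<xi> x"
  proof -
    have "(jac \<xi>' (\<phi> x) ** J x) $ a $ j = (DJ + J x ** jac \<xi> x) $ a $ j" for a j
    proof -
      have \<xi>'d: "(\<lambda>y. \<xi>' y $ a) differentiable (at (\<phi> x))"
        by (rule smooth_on_differentiable[OF \<xi>' V(2)[OF x]])
      have "(jac \<xi>' (\<phi> x) ** J x) $ a $ j = (\<Sum>m\<in>UNIV. (J x *v axis j 1) $ m * partial m (\<lambda>y. \<xi>' y $ a) (\<phi> x))"
        by (simp add: matrix_matrix_mult_def jac_def matrix_vector_mult_basis column_def mult.commute)
      also have "\<dots> = (\<Sum>k\<in>UNIV. axis j 1 $ k * partial k (\<lambda>y. \<xi>' (\<phi> y) $ a) x)"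
        unfolding J_def by (rule frechet_derivative_chain[OF d\<phi>[OF x] \<xi>'d, symmetric])
      also have "\<dots> = partial j (\<lambda>y. \<xi>' (\<phi> y) $ a) x"
        by (simp add: axis_def if_distrib[of "\<lambda>z. z * _"] cong: if_cong)
      also have "\<dots> = partial j (\<lambda>y. \<Sum>b\<in>UNIV. J y $ a $ b * \<xi> y $ b) x"
      proof (rule partial_cong[OF W x, symmetric])
        show "(\<Sum>b\<in>UNIV. J y $ a $ b * \<xi> y $ b) = \<xi>' (\<phi> y) $ a" if "y \<in> W" for y
          by (simp add: \<xi>_law[OF that] J_def matrix_vector_mult_def)
        show "(\<lambda>y. \<Sum>b\<in>UNIV. J y $ a $ b * \<xi> y $ b) differentiable (at x)"
          by (intro smooth_on_differentiable[OF _ x] smooth_on_sum[OF W] smooth_on_mult[OF W] mat_smooth_onD[OF J] \<xi>)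
      qed
      also have "\<dots> = (\<Sum>b\<in>UNIV. partial j (\<lambda>y. J y $ a $ b) x * \<xi> x $ b) + (\<Sum>b\<in>UNIV. J x $ a $ b * jac \<xi> x $ b $ j)"
        using mat_smooth_onD[OF J] \<xi>
        by (simp add: partial_sum partial_mult smooth_on_differentiable[OF _ x] smooth_on_mult[OF W] sum.distrib jac_def)
      finally have ch: "(jac \<xi>' (\<phi> x) ** J x) $ a $ j =
        (\<Sum>b\<in>UNIV. partial j (\<lambda>y. J y $ a $ b) x * \<xi> x $ b) + (\<Sum>b\<in>UNIV. J x $ a $ b * jac \<xi> x $ b $ j)" .
      have cm: "partial j (\<lambda>y. J y $ a $ b) x = partial b (\<lambda>y. J y $ a $ j) x" for b
      proof -
        have e: "partial i (\<lambda>y. J y $ a $ k) x = partial i (partial k (\<lambda>y. \<phi> y $ a)) x" for i k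
          by (rule partial_cong[OF W x J_nth smooth_on_differentiable[OF mat_smooth_onD[OF J] x]])
        show ?thesis
          unfolding e by (rule partial_commute[OF W smooth_on_component[OF W \<phi>] x])
      qed
      show ?thesis
        unfolding ch cm by (simp add: DJ_def mat_directional_nth matrix_matrix_mult_def mult.commute)
    qed
    then show ?thesis by (simp add: vec_eq_iff)
  qed
  have JJ: "transpose DJ + transpose (jac \<xi> x) ** transpose (J x) = transpose (J x) ** transpose (jac \<xi>' (\<phi> x))"
    using arg_cong[OF N, of transpose] by (simp add: transpose_add matrix_transpose_mul)
  have "mat_directional (\<xi> x) g x = mat_directional (\<xi> x) (\<lambda>y. transpose (J y) ** g' (\<phi> y) ** J y) x"
    by (rule mat_directional_cong[OF W x g gl])
  also have "\<dots> = transpose DJ ** g' (\<phi> x) ** J x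
      + transpose (J x) ** mat_directional (\<xi>' (\<phi> x)) g' (\<phi> x) ** J x + transpose (J x) ** g' (\<phi> x) ** DJ"
    by (simp add: mat_directional_mult[OF W x mat_smooth_on_mult[OF W Jt g'\<phi>] J]
        mat_directional_mult[OF W x Jt g'\<phi>] mat_directional_transpose Dg' DJ_def mat_mult_add_right)
  finally have "lie_derivative_metric \<xi> g x =
      (transpose DJ + transpose (jac \<xi> x) ** transpose (J x)) ** g' (\<phi> x) ** J x
      + transpose (J x) ** mat_directional (\<xi>' (\<phi> x)) g' (\<phi> x) ** J x
      + transpose (J x) ** g' (\<phi> x) ** (DJ + J x ** jac \<xi> x)"
    unfolding lie_derivative_directional gl[OF x] by (simp add: matrix_ring_simps algebra_simps)
  then show ?thesis
    unfolding JJ N[symmetric] lie_derivative_directional J_def[symmetric]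
    by (simp add: matrix_ring_simps algebra_simps)
qed

section \<open>Compact almost Ricci-Bourguignon solitons\<close>

text \<open>A vanishing derivative makes \<open>f\<close> constant on coordinate balls, so level
  sets and their complements are both open.\<close>

lemma (in smooth_manifold) constant_on_connected:
  fixes f :: "'a \<Rightarrow> real"
  assumes conn: "connected_space M"
    and d: "\<And>c x. c \<in> A \<Longrightarrow> x \<in> chart_image c \<Longrightarrow> ((f \<circ> chart_inv c) has_derivative (\<lambda>v. 0)) (at x)"
  shows "f constant_on topspace M"
proof -
  have nbhd: "\<exists>W. openin M W \<and> p \<in> W \<and> (\<forall>q\<in>W. f q = f p)" if p: "p \<in> topspace M" for p
  proof -
    obtain c where c: "c \<in> A" "p \<in> fst c" using p atlas unfolding smooth_atlas_def by blast
    obtain r where r: "0 < r" "ball (snd c p) r \<subseteq> chart_image c"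
      using chart(2)[OF c(1)] snd_in_chart_image[OF c(2)] open_contains_ball by blast
    have "((f \<circ> chart_inv c) has_derivative (\<lambda>v. 0)) (at y within ball (snd c p) r)"
      if "y \<in> ball (snd c p) r" for y
      by (rule has_derivative_at_withinI[OF d[OF c(1)]]) (use that r(2) in blast)
    from has_derivative_zero_constant[OF convex_ball this]
    have "(f \<circ> chart_inv c) x = (f \<circ> chart_inv c) (snd c p)" if "x \<in> ball (snd c p) r" for x
      using that r(1) by force
    then have "f q = f p" if "q \<in> fst c" "snd c q \<in> ball (snd c p) r" for q
      using that c chart_inv_snd by (metis comp_apply)
    moreover have "p \<in> {q \<in> fst c. snd c q \<in> ball (snd c p) r}" using c r by simp
    ultimately show ?thesis
      using openin_chart_preimage[OF c(1) open_ball, of "snd c p" r] by blast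
  qed
  \<comment> \<open>The arbitrary predicate covers a level set and its complement at once.\<close>
  have op: "openin M {q \<in> topspace M. P (f q)}" for P
  proof (subst openin_subopen, intro ballI)
    fix p assume "p \<in> {q \<in> topspace M. P (f q)}"
    then have p: "p \<in> topspace M" "P (f p)" by auto
    from nbhd[OF p(1)] obtain W where W: "openin M W" "p \<in> W" "\<forall>q\<in>W. f q = f p"
      by (elim exE conjE)
    have "P (f q)" if "q \<in> W" for q
      using bspec[OF W(3) that] p(2) by simp
    then have "W \<subseteq> {q \<in> topspace M. P (f q)}" using openin_subset[OF W(1)] by blast
    then show "\<exists>T. openin M T \<and> p \<in> T \<and> T \<subseteq> {q \<in> topspace M. P (f q)}" using W by blast
  qed
  show ?thesis
  proof (rule ccontr)
    assume "\<not> ?thesis"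
    then obtain p q where pq: "p \<in> topspace M" "q \<in> topspace M" "f q \<noteq> f p"
      unfolding constant_on_def by blast
    have "topspace M \<subseteq> {z \<in> topspace M. f z = f p} \<union> {z \<in> topspace M. f z \<noteq> f p}" by auto
    moreover have "{z \<in> topspace M. f z = f p} \<inter> {z \<in> topspace M. f z \<noteq> f p} = {}" by auto
    ultimately show False
      using conn op[of "\<lambda>t. t = f p"] op[of "\<lambda>t. t \<noteq> f p"] pq unfolding connected_space_def by blast
  qed
qed

locale almost_RB =
  fixes M :: "'a topology"
    and A :: "('a, 'n::finite) chart set"
    and g :: "('a, 'n) chart \<Rightarrow> real ^ 'n \<Rightarrow> real ^ 'n ^ 'n"
    and \<xi> :: "('a, 'n) chart \<Rightarrow> real ^ 'n \<Rightarrow> real ^ 'n"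
    and lam :: "'a \<Rightarrow> real"
    and \<rho> :: real
  assumes soliton: "almost_RB_soliton M A g \<xi> lam \<rho>"
begin

sublocale smooth_manifold M A
proof
  show "smooth_atlas M A" "Hausdorff_space M"
    using soliton unfolding almost_RB_soliton_def connected_smooth_manifold_def by blast+
qed

abbreviation S :: "'a \<Rightarrow> real" where "S \<equiv> scalar_curvature A g"

abbreviation L :: "('a, 'n) chart \<Rightarrow> real ^ 'n \<Rightarrow> real ^ 'n ^ 'n" where
  "L c \<equiv> lie_derivative_metric (\<xi> c) (g c)"

definition h :: "'a \<Rightarrow> real" where
  "h p = real CARD('n) * (lam p + \<rho> * S p) - S p"

section \<open>Transformation laws of the soliton data\<close>

lemma local_metric: "c \<in> A \<Longrightarrow> local_metric (chart_image c) (g c)"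
proof -
  assume c: "c \<in> A"
  have "riemannian_metric A g" using soliton unfolding almost_RB_soliton_def by blast
  then show "local_metric (chart_image c) (g c)"
    using c chart(2)[OF c] smooth_on_imp_mat_smooth_on[OF chart(2)[OF c]]
    unfolding riemannian_metric_def local_metric_def by blast
qed

lemma smooth_field: "c \<in> A \<Longrightarrow> smooth_on (\<lambda>y. \<xi> c y $ k) (chart_image c)"
  using soliton smooth_on_component[OF chart(2)] unfolding almost_RB_soliton_def smooth_vector_field_def
  by blast

lemma field_law: "c \<in> A \<Longrightarrow> d \<in> A \<Longrightarrow> x \<in> overlap c d \<Longrightarrow>
    \<xi> d (transition c d x) = jacobian (transition c d) (at x) *v \<xi> c x"
  using soliton unfolding almost_RB_soliton_def smooth_vector_field_def by blast

lemma metric_law: "c \<in> A \<Longrightarrow> d \<in> A \<Longrightarrow> x \<in> overlap c d \<Longrightarrow>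
    g c x = transpose (jacobian (transition c d) (at x)) ** g d (transition c d x)
      ** jacobian (transition c d) (at x)"
  using soliton unfolding almost_RB_soliton_def riemannian_metric_def by blast

lemma ricci_soliton:
  assumes "c \<in> A" "x \<in> chart_image c"
  shows "ricci (g c) x = (lam (chart_inv c x) + \<rho> * S (chart_inv c x)) *\<^sub>R g c x - (1 / 2) *\<^sub>R L c x"
proof -
  have "chart_inv c x \<in> fst c" "snd c (chart_inv c x) = x"
    using assms by (auto simp: chart_inv_in snd_chart_inv)
  then have "ricci (g c) x + (1 / 2) *\<^sub>R L c x = (lam (chart_inv c x) + \<rho> * S (chart_inv c x)) *\<^sub>R g c x"
    using soliton assms(1) unfolding almost_RB_soliton_def by metis
  then show ?thesis by (simp add: algebra_simps)
qed

lemma overlap_subset: "c \<in> A \<Longrightarrow> x \<in> overlap c d \<Longrightarrow> x \<in> chart_image c"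
  by (simp add: overlap_iff)

lemma lie_law:
  assumes "c \<in> A" "d \<in> A" "x \<in> overlap c d"
  shows "L c x = transpose (jacobian (transition c d) (at x)) ** L d (transition c d x)
    ** jacobian (transition c d) (at x)"
proof (rule lie_derivative_pullback[OF open_overlap[OF assms(1,2)] assms(3) smooth_transition[OF assms(1,2)]
        chart(2)[OF assms(2)]])
  have sub: "overlap c d \<subseteq> chart_image c" using overlap_subset assms(1) by blast
  show "transition c d y \<in> chart_image d" if "y \<in> overlap c d" for y
    using transition_in_overlap(1)[OF assms(1,2) that] overlap_subset[OF assms(2)] by blast
  show "mat_smooth_on (g d) (chart_image d)"
    by (rule local_metric.smooth_g[OF local_metric[OF assms(2)]])
  show "smooth_on (\<lambda>y. \<xi> d y $ k) (chart_image d)" for k by (rule smooth_field[OF assms(2)])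
  show "smooth_on (\<lambda>y. \<xi> c y $ k) (overlap c d)" for k
    by (rule smooth_on_subset[OF smooth_field[OF assms(1)] sub])
  show "mat_smooth_on (g c) (overlap c d)"
    using mat_smooth_onD[OF local_metric.smooth_g[OF local_metric[OF assms(1)]]] smooth_on_subset sub
    unfolding mat_smooth_on_def by blast
  show "det (g c y) \<noteq> 0" if "y \<in> overlap c d" for y
    using local_metric.det_g[OF local_metric[OF assms(1)]] sub that by blast
qed (use assms metric_law field_law in auto)

text \<open>The soliton equation expresses the Ricci tensor by tensors whose transformation laws are
  already known, so that the naturality of the curvature need not be proved.\<close>

lemma ricci_law:
  assumes "c \<in> A" "d \<in> A" "x \<in> overlap c d"
  shows "ricci (g c) x = transpose (jacobian (transition c d) (at x)) ** ricci (g d) (transition c d x)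
    ** jacobian (transition c d) (at x)"
proof -
  have "x \<in> chart_image c" "transition c d x \<in> chart_image d"
    using overlap_subset assms transition_in_overlap(1) by blast+
  then show ?thesis
    using transition_in_overlap(2)[OF assms]
    by (simp add: ricci_soliton assms(1,2) metric_law[OF assms] lie_law[OF assms]
        mat_mult_diff_left mat_mult_diff_right mat_mult_scaleR_left mat_mult_scaleR_right)
qed

lemma scalar_law:
  assumes "c \<in> A" "d \<in> A" "x \<in> overlap c d"
  shows "local_scalar_curvature (g c) x = local_scalar_curvature (g d) (transition c d x)"
proof -
  have x: "x \<in> chart_image c" "transition c d x \<in> chart_image d"
    using overlap_subset assms transition_in_overlap(1) by blast+
  show ?thesis
    unfolding local_metric.local_scalar_curvature_eq[OF local_metric[OF assms(1)] x(1)]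
      local_metric.local_scalar_curvature_eq[OF local_metric[OF assms(2)] x(2)]
      local_metric.G_def[OF local_metric[OF assms(1)]] local_metric.G_def[OF local_metric[OF assms(2)]]
    by (rule trace_congruence[OF metric_law[OF assms] local_metric.det_g[OF local_metric[OF assms(1)] x(1)]
          ricci_law[OF assms]])
qed

text \<open>\<open>scalar_curvature\<close> evaluates in a chart picked by \<open>SOME\<close>; by
  \<open>scalar_law\<close> every chart around the point gives the same value, which opens S to
  calculus in any chart.\<close>

lemma scalar_curvature_chart:
  assumes c: "c \<in> A" "x \<in> chart_image c"
  shows "S (chart_inv c x) = local_scalar_curvature (g c) x"
proof -
  define d where "d = (SOME d. d \<in> A \<and> chart_inv c x \<in> fst d)"
  have "d \<in> A \<and> chart_inv c x \<in> fst d"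
    unfolding d_def by (rule someI[of _ c]) (use c chart_inv_in in blast)
  then have "d \<in> A" "x \<in> overlap c d" using c overlap_iff by auto
  then show ?thesis
    using scalar_law[OF c(1)] by (simp add: scalar_curvature_def d_def[symmetric] Let_def transition_def)
qed

lemma h_chart:
  assumes c: "c \<in> A" "x \<in> chart_image c"
  shows "h (chart_inv c x) = trace (matrix_inv (g c x) ** L c x) / 2"
proof -
  interpret local_metric "chart_image c" "g c" by (rule local_metric[OF c(1)])
  have "local_scalar_curvature (g c) x =
      real CARD('n) * (lam (chart_inv c x) + \<rho> * S (chart_inv c x)) - trace (matrix_inv (g c x) ** L c x) / 2"
    using G_g[OF c(2)]
    by (simp add: local_scalar_curvature_eq[OF c(2)] ricci_soliton[OF c] G_def mat_mult_diff_left
        mat_mult_scaleR_left trace_sub trace_scaleR trace_I)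
  then show ?thesis by (simp add: h_def scalar_curvature_chart[OF c])
qed

lemma smooth_lie: "c \<in> A \<Longrightarrow> mat_smooth_on (L c) (chart_image c)"
  by (intro smooth_lie_derivative chart(2) smooth_field local_metric.smooth_g[OF local_metric])

lemma smooth_h: "c \<in> A \<Longrightarrow> smooth_on (h \<circ> chart_inv c) (chart_image c)"
proof -
  assume c: "c \<in> A"
  interpret local_metric "chart_image c" "g c" by (rule local_metric[OF c])
  have "smooth_on (\<lambda>x. trace (G x ** L c x) * (1 / 2)) (chart_image c)"
    by (intro smooth_on_mult smooth_on_const smooth_on_trace mat_smooth_on_mult smooth_G smooth_lie c open_U)
  then show ?thesis
    by (rule smooth_on_cong[OF open_U, rotated]) (simp add: h_chart[OF c] G_def)
qed

text \<open>The determinant of J^T g J is (det J)^2 det g, and the root turns the square into an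
  absolute value.\<close>

lemma volume_law:
  assumes "c \<in> A" "d \<in> A" "x \<in> overlap c d"
  shows "volume_density (g c x) =
    \<bar>det (jacobian (transition c d) (at x))\<bar> * volume_density (g d (transition c d x))"
  unfolding metric_law[OF assms]
  by (simp add: volume_density_def det_mul abs_mult real_sqrt_mult)

text \<open>The divergence theorem as it is applied to solitons: \<open>D\<close> is the Riemannian
  divergence of X, with the positive density factored out.\<close>

lemma divergence_zero:
  assumes comp: "compact_space M"
    and X: "\<And>c k. c \<in> A \<Longrightarrow> smooth_on (\<lambda>x. X c x $ k) (chart_image c)"
    and X_law: "\<And>c d x. c \<in> A \<Longrightarrow> d \<in> A \<Longrightarrow> x \<in> overlap c d \<Longrightarrow>
      X d (transition c d x) = jacobian (transition c d) (at x) *v X c x"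
    and D: "\<And>c x. c \<in> A \<Longrightarrow> x \<in> chart_image c \<Longrightarrow>
      (\<Sum>k\<in>UNIV. partial k (\<lambda>y. volume_density (g c y) * X c y $ k) x) = volume_density (g c x) * D c x"
    and nonneg: "\<And>c x. c \<in> A \<Longrightarrow> x \<in> chart_image c \<Longrightarrow> D c x \<ge> 0"
    and c: "c \<in> A" "x \<in> chart_image c"
  shows "D c x = 0"
proof -
  have pos: "volume_density (g c x) > 0" if "c \<in> A" "x \<in> chart_image c" for c x
    by (rule local_metric.vol_pos[OF local_metric[OF that(1)] that(2)])
  have "(\<Sum>k\<in>UNIV. partial k (\<lambda>y. volume_density (g c y) * X c y $ k) x) = 0"
  proof (rule divergence_nonneg_imp_zero[OF comp _ volume_law _ X_law _ c])
    show "C_k_on (Suc 0) (\<lambda>y. volume_density (g c y)) (chart_image c)" if "c \<in> A" for c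
      using local_metric.smooth_vol[OF local_metric[OF that]] unfolding smooth_on_def by blast
    show "C_k_on (Suc 0) (\<lambda>y. X c y $ k) (chart_image c)" if "c \<in> A" for c k
      using X[OF that] unfolding smooth_on_def by blast
    show "0 \<le> (\<Sum>k\<in>UNIV. partial k (\<lambda>y. volume_density (g c y) * X c y $ k) x)"
      if "c \<in> A" "x \<in> chart_image c" for c x
      using D[OF that] nonneg[OF that] pos[OF that] by simp
  qed
  then show ?thesis using D[OF c] pos[OF c] by simp
qed

lemma h_zero:
  assumes comp: "compact_space M" and const: "constant_on_integral_curves A \<xi> h"
    and c: "c \<in> A" "x \<in> chart_image c"
  shows "h (chart_inv c x) = 0"
proof -
  have "h (chart_inv c x) * h (chart_inv c x) = 0"
  proof (rule divergence_zero[OF comp, where X = "\<lambda>c x. h (chart_inv c x) *\<^sub>R \<xi> c x"])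
    fix c k assume c: "c \<in> A"
    show "smooth_on (\<lambda>x. (h (chart_inv c x) *\<^sub>R \<xi> c x) $ k) (chart_image c)"
      using smooth_on_mult[OF chart(2)[OF c] smooth_h[OF c] smooth_field[OF c, of k]] by simp
  next
    fix c d x assume cd: "c \<in> A" "d \<in> A" "x \<in> overlap c d"
    show "h (chart_inv d (transition c d x)) *\<^sub>R \<xi> d (transition c d x) =
        jacobian (transition c d) (at x) *v (h (chart_inv c x) *\<^sub>R \<xi> c x)"
      by (simp add: transition_in_overlap(2)[OF cd] field_law[OF cd] linear_cmul[OF matrix_vector_mul_linear])
  next
    fix c x assume c: "c \<in> A" "x \<in> chart_image c"
    interpret local_metric "chart_image c" "g c" by (rule local_metric[OF c(1)])
    have "(\<Sum>k\<in>UNIV. \<xi> c x $ k * partial k (h \<circ> chart_inv c) x) = 0"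
      using const c frechet_derivative_eq_sum_partial[OF smooth_on_differentiable[OF smooth_h[OF c(1)] c(2)]]
      unfolding constant_on_integral_curves_def by metis
    then show "(\<Sum>k\<in>UNIV. partial k (\<lambda>y. volume_density (g c y) * (h (chart_inv c y) *\<^sub>R \<xi> c y) $ k) x) =
        volume_density (g c x) * (h (chart_inv c x) * h (chart_inv c x))"
      using divergence_scaled[OF c(2) smooth_field[OF c(1)] smooth_h[OF c(1)]]
      by (simp add: G_def h_chart[OF c])
  qed (use c in auto)
  then show ?thesis by simp
qed

text \<open>The Ricci operator commutes with the Jacobian, because the inverse metric and the Ricci
  tensor transform oppositely; so these components define a vector field on the manifold.\<close>

lemma einstein_law:
  assumes "c \<in> A" "d \<in> A" "x \<in> overlap c d"
  shows "local_scalar_curvature (g d) (transition c d x) *\<^sub>R \<xi> d (transition c d x)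
      - 2 *\<^sub>R (local_metric.T (g d) (transition c d x) *v \<xi> d (transition c d x)) =
    jacobian (transition c d) (at x) *v (local_scalar_curvature (g c) x *\<^sub>R \<xi> c x
      - 2 *\<^sub>R (local_metric.T (g c) x *v \<xi> c x))"
proof -
  define J where "J = jacobian (transition c d) (at x)"
  have x: "x \<in> chart_image c" using overlap_subset assms by blast
  have "J ** local_metric.T (g c) x = J ** matrix_inv (g c x) ** transpose J ** ricci (g d) (transition c d x) ** J"
    unfolding local_metric.T_def[OF local_metric[OF assms(1)]] local_metric.G_def[OF local_metric[OF assms(1)]]
      ricci_law[OF assms] J_def[symmetric] by (simp add: matrix_mul_assoc)
  also have "\<dots> = local_metric.T (g d) (transition c d x) ** J"
    unfolding local_metric.T_def[OF local_metric[OF assms(2)]] local_metric.G_def[OF local_metric[OF assms(2)]]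
    by (simp only: matrix_inv_congruence[OF metric_law[OF assms, folded J_def] local_metric.det_g[OF local_metric[OF assms(1)] x]])
  finally have "local_metric.T (g d) (transition c d x) *v (J *v \<xi> c x) = J *v (local_metric.T (g c) x *v \<xi> c x)"
    by (simp add: matrix_vector_mul_assoc)
  then show ?thesis
    unfolding scalar_law[OF assms, symmetric] field_law[OF assms] J_def[symmetric]
    by (simp add: linear_diff[OF matrix_vector_mul_linear] linear_cmul[OF matrix_vector_mul_linear])
qed

lemma ricci_if_h_zero:
  assumes "c \<in> A" "x \<in> chart_image c" "h (chart_inv c x) = 0"
  shows "ricci (g c) x = (local_scalar_curvature (g c) x / real CARD('n)) *\<^sub>R g c x - (1 / 2) *\<^sub>R L c x"
proof -
  have "lam (chart_inv c x) + \<rho> * S (chart_inv c x) = local_scalar_curvature (g c) x / real CARD('n)"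
    using assms(3) by (simp add: h_def scalar_curvature_chart[OF assms(1,2)] field_simps)
  then show ?thesis unfolding ricci_soliton[OF assms(1,2)] by simp
qed

text \<open>The vector field \<open>S \<xi> - 2 Ric(\<xi>)\<close> has divergence \<open>\<bar>L\<bar>\<^sup>2 / 2\<close> once \<open>div \<xi> = 0\<close>.\<close>

lemma lie_zero:
  assumes comp: "compact_space M" and const: "constant_on_integral_curves A \<xi> h"
    and c: "c \<in> A" "x \<in> chart_image c"
  shows "L c x = 0"
proof -
  have sq: "transpose (matrix_inv (g c x)) = matrix_inv (g c x)" "transpose (L c x) = L c x"
      "\<And>v. v \<noteq> 0 \<Longrightarrow> v \<bullet> (matrix_inv (g c x) *v v) > 0"
    if c: "c \<in> A" "x \<in> chart_image c" for c x
  proof -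
    interpret local_metric "chart_image c" "g c" by (rule local_metric[OF c(1)])
    show "transpose (matrix_inv (g c x)) = matrix_inv (g c x)" "\<And>v. v \<noteq> 0 \<Longrightarrow> v \<bullet> (matrix_inv (g c x) *v v) > 0"
      using G_transpose[OF c(2)] G_posdef[OF c(2)] by (simp_all add: G_def)
    \<comment> \<open>L inherits its symmetry from Ric and g through the soliton equation.\<close>
    have "L c x = 2 *\<^sub>R ((lam (chart_inv c x) + \<rho> * S (chart_inv c x)) *\<^sub>R g c x - ricci (g c) x)"
      by (simp add: ricci_soliton[OF c] algebra_simps)
    moreover have "transpose (g c x) = g c x" "transpose (ricci (g c) x) = ricci (g c) x"
      using g_transpose ricci_transpose c by auto
    ultimately show "transpose (L c x) = L c x"
      by (simp add: transpose_diff transpose_def vec_eq_iff)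
  qed
  have "1 / 2 * trace (matrix_inv (g c x) ** L c x ** matrix_inv (g c x) ** L c x) = 0"
  proof (rule divergence_zero[OF comp, where X = "\<lambda>c x. local_scalar_curvature (g c) x *\<^sub>R \<xi> c x
      - 2 *\<^sub>R (local_metric.T (g c) x *v \<xi> c x)"])
    fix c k assume c: "c \<in> A"
    interpret local_metric "chart_image c" "g c" by (rule local_metric[OF c])
    have "smooth_on (\<lambda>x. local_scalar_curvature (g c) x * \<xi> c x $ k - 2 * (T x *v \<xi> c x) $ k) (chart_image c)"
      by (intro smooth_on_diff smooth_on_mult smooth_on_const smooth_scalar smooth_field[OF c]
          mat_smooth_on_mult_vec smooth_T open_U)
    then show "smooth_on (\<lambda>x. (local_scalar_curvature (g c) x *\<^sub>R \<xi> c x - 2 *\<^sub>R (T x *v \<xi> c x)) $ k) (chart_image c)"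
      by simp
  next
    fix c d x assume "c \<in> A" "d \<in> A" "x \<in> overlap c d"
    then show "local_scalar_curvature (g d) (transition c d x) *\<^sub>R \<xi> d (transition c d x)
        - 2 *\<^sub>R (local_metric.T (g d) (transition c d x) *v \<xi> d (transition c d x)) =
      jacobian (transition c d) (at x) *v (local_scalar_curvature (g c) x *\<^sub>R \<xi> c x
        - 2 *\<^sub>R (local_metric.T (g c) x *v \<xi> c x))"
      by (rule einstein_law)
  next
    fix c x assume c: "c \<in> A" "x \<in> chart_image c"
    interpret local_metric "chart_image c" "g c" by (rule local_metric[OF c(1)])
    have tr0: "trace (G x ** L c x) = 0"
      using h_zero[OF comp const c] h_chart[OF c] by (simp add: G_def)
    \<comment> \<open>The metric part of Ric contributes a multiple of the trace of G L, which
      vanishes by \<open>tr0\<close>; what remains is -1 / 2 times the squared norm of L.\<close>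
    have "G x ** ricci (g c) x ** G x ** L c x =
        (local_scalar_curvature (g c) x / real CARD('n)) *\<^sub>R (G x ** g c x ** G x ** L c x)
        - (1 / 2) *\<^sub>R (G x ** L c x ** G x ** L c x)"
      unfolding ricci_if_h_zero[OF c h_zero[OF comp const c]]
      by (simp add: mat_mult_diff_left mat_mult_diff_right mat_mult_scaleR_left mat_mult_scaleR_right)
    then have "trace (G x ** ricci (g c) x ** G x ** L c x) = - (1 / 2) * trace (G x ** L c x ** G x ** L c x)"
      using G_g[OF c(2)] by (simp add: trace_sub trace_scaleR tr0)
    then show "(\<Sum>k\<in>UNIV. partial k (\<lambda>y. volume_density (g c y) * (local_scalar_curvature (g c) y *\<^sub>R \<xi> c y
          - 2 *\<^sub>R (T y *v \<xi> c y)) $ k) x) =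
        volume_density (g c x) * (1 / 2 * trace (matrix_inv (g c x) ** L c x ** matrix_inv (g c x) ** L c x))"
      unfolding divergence_einstein[OF c(2) smooth_field[OF c(1)]] by (simp add: tr0[unfolded G_def] G_def)
  next
    fix c x assume "c \<in> A" "x \<in> chart_image c"
    note trace_square_metric(1)[OF sq(1,3)[OF this] sq(2)[OF this]]
    then show "0 \<le> 1 / 2 * trace (matrix_inv (g c x) ** L c x ** matrix_inv (g c x) ** L c x)" by simp
  qed (use c in auto)
  then show ?thesis
    by (intro trace_square_metric(2)[OF sq(1,3)[OF c] sq(2)[OF c]]) auto
qed

text \<open>Schur's lemma, by comparing two expressions for the divergence of the Einstein tensor applied
  to a coordinate vector field.\<close>

lemma scalar_partial_zero:
  assumes n: "CARD('n) > 2" and c: "c \<in> A" "x \<in> chart_image c"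
    and h0: "\<And>y. y \<in> chart_image c \<Longrightarrow> h (chart_inv c y) = 0"
    and L0: "\<And>y. y \<in> chart_image c \<Longrightarrow> L c y = 0"
  shows "partial k (local_scalar_curvature (g c)) x = 0"
proof -
  interpret local_metric "chart_image c" "g c" by (rule local_metric[OF c(1)])
  \<comment> \<open>A field with constant components in this chart; the argument is local, so it is
    not extended to the manifold. The number \<open>\<tau>\<close> is its divergence at
    \<open>x\<close>.\<close>
  define e where "e = (\<lambda>y :: real ^ 'n. axis k 1 :: real ^ 'n)"
  define \<tau> where "\<tau> = trace (G x ** lie_derivative_metric e (g c) x) / 2"
  define s where "s = local_scalar_curvature (g c)"
  let ?n = "real CARD('n)"
  have e: "smooth_on (\<lambda>y. e y $ j) (chart_image c)" for j unfolding e_def by (rule smooth_on_const)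
  have ricci: "ricci (g c) y = (s y / ?n) *\<^sub>R g c y" if "y \<in> chart_image c" for y
    using ricci_if_h_zero[OF c(1) that h0[OF that]] L0[OF that] by (simp add: s_def)
  \<comment> \<open>As \<open>T\<close> is a multiple of the identity, s e - 2 T e equals ((n - 2) /
    n) s e. Its divergence is computed once by \<open>divergence_scaled\<close> and once by
    \<open>divergence_einstein\<close>.\<close>
  have T: "T y = (s y / ?n) *\<^sub>R mat 1" if "y \<in> chart_image c" for y
    using G_g[OF that] by (simp add: T_def ricci[OF that] mat_mult_scaleR_left)
  have sn: "smooth_on (\<lambda>y. (?n - 2) / ?n * s y) (chart_image c)"
    unfolding s_def by (intro smooth_on_mult smooth_on_const smooth_scalar open_U)
  have "(\<Sum>j\<in>UNIV. partial j (\<lambda>y. vol y * (s y *\<^sub>R e y - 2 *\<^sub>R (T y *v e y)) $ j) x) =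
      (\<Sum>j\<in>UNIV. partial j (\<lambda>y. vol y * ((?n - 2) / ?n * s y * e y $ j)) x)"
  proof (intro sum.cong refl partial_cong[OF open_U c(2), symmetric])
    fix j
    show "vol y * ((?n - 2) / ?n * s y * e y $ j) = vol y * (s y *\<^sub>R e y - 2 *\<^sub>R (T y *v e y)) $ j"
      if "y \<in> chart_image c" for y
      by (simp add: T[OF that] scaleR_matrix_vector_assoc[symmetric] field_simps)
    show "(\<lambda>y. vol y * ((?n - 2) / ?n * s y * e y $ j)) differentiable (at x)"
      by (rule smooth_on_differentiable[OF _ c(2)]) (intro smooth_on_mult smooth_vol sn e open_U)
  qed
  also have "\<dots> = vol x * ((?n - 2) / ?n * s x * \<tau> + partial k (\<lambda>y. (?n - 2) / ?n * s y) x)"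
    unfolding divergence_scaled[OF c(2) e sn] \<tau>_def
    by (simp add: e_def axis_def if_distrib[of "\<lambda>z. z * _"] cong: if_cong)
  also have "partial k (\<lambda>y. (?n - 2) / ?n * s y) x = (?n - 2) / ?n * partial k s x"
    unfolding s_def by (rule partial_cmult[OF smooth_on_differentiable[OF smooth_scalar c(2)]])
  finally have "(\<Sum>j\<in>UNIV. partial j (\<lambda>y. vol y * (s y *\<^sub>R e y - 2 *\<^sub>R (T y *v e y)) $ j) x) =
      vol x * ((?n - 2) / ?n * s x * \<tau> + (?n - 2) / ?n * partial k s x)" .
  moreover have "trace (G x ** ricci (g c) x ** G x ** lie_derivative_metric e (g c) x) = s x / ?n * (2 * \<tau>)"
    using G_g[OF c(2)]
    by (simp add: ricci[OF c(2)] mat_mult_scaleR_left mat_mult_scaleR_right trace_scaleR \<tau>_def)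
  ultimately have "vol x * ((?n - 2) / ?n * s x * \<tau> + (?n - 2) / ?n * partial k s x) =
      vol x * (s x * \<tau> - s x / ?n * (2 * \<tau>))"
    using divergence_einstein[OF c(2) e] by (simp add: s_def \<tau>_def)
  then have "(?n - 2) / ?n * s x * \<tau> + (?n - 2) / ?n * partial k s x = s x * \<tau> - s x / ?n * (2 * \<tau>)"
    using vol_pos[OF c(2)] by simp
  \<comment> \<open>So the terms with \<open>\<tau>\<close> agree on both sides, and (n - 2) / n
    times the derivative of \<open>s\<close> is 0.\<close>
  moreover have "s x * \<tau> - s x / ?n * (2 * \<tau>) = (?n - 2) / ?n * s x * \<tau>"
    by (simp add: field_simps)
  ultimately show ?thesis using n by (simp add: s_def)
qed

theorem trivial_iff:
  assumes comp: "compact_space M" and n: "CARD('n) > 2"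
  shows "trivial_RB_soliton M A g \<xi> lam \<rho> \<longleftrightarrow> constant_on_integral_curves A \<xi> h"
proof
  assume "trivial_RB_soliton M A g \<xi> lam \<rho>"
  then have L0: "L c x = 0" if "c \<in> A" "x \<in> chart_image c" for c x
    using that unfolding trivial_RB_soliton_def killing_field_def by blast
  show "constant_on_integral_curves A \<xi> h"
    unfolding constant_on_integral_curves_def
  proof (intro ballI)
    fix c x assume c: "c \<in> A" "x \<in> chart_image c"
    \<comment> \<open>By \<open>h_chart\<close>, h vanishes throughout the chart when L does, so its
      derivative is that of the zero function.\<close>
    have "frechet_derivative (\<lambda>x. 0 :: real) (at x) = frechet_derivative (h \<circ> chart_inv c) (at x)"
      by (rule frechet_derivative_transform_within_open[OF _ chart(2)[OF c(1)] c(2)])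
         (simp_all add: h_chart[OF c(1)] L0[OF c(1)] mat_mult_zero trace_def)
    then show "frechet_derivative (h \<circ> chart_inv c) (at x) (\<xi> c x) = 0"
      by (metis frechet_derivative_const)
  qed
next
  assume const: "constant_on_integral_curves A \<xi> h"
  note h0 = h_zero[OF comp const] and L0 = lie_zero[OF comp const]
  have "S constant_on topspace M"
  proof (rule constant_on_connected)
    show "connected_space M"
      using soliton unfolding almost_RB_soliton_def connected_smooth_manifold_def by blast
    fix c x assume c: "c \<in> A" "x \<in> chart_image c"
    interpret local_metric "chart_image c" "g c" by (rule local_metric[OF c(1)])
    have d: "local_scalar_curvature (g c) differentiable (at x)"
      by (rule smooth_on_differentiable[OF smooth_scalar c(2)])
    have "frechet_derivative (local_scalar_curvature (g c)) (at x) v = 0" for v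
      using scalar_partial_zero[OF n c h0[OF c(1)] L0[OF c(1)]]
      by (simp add: frechet_derivative_eq_sum_partial[OF d])
    then have "(local_scalar_curvature (g c) has_derivative (\<lambda>v. 0)) (at x)"
      using d unfolding frechet_derivative_works by (metis ext)
    then show "((S \<circ> chart_inv c) has_derivative (\<lambda>v. 0)) (at x)"
      by (rule has_derivative_transform_within_open[OF _ open_U c(2)])
         (simp add: scalar_curvature_chart[OF c(1)])
  qed
  then obtain s where s: "\<And>p. p \<in> topspace M \<Longrightarrow> S p = s" unfolding constant_on_def by blast
  \<comment> \<open>The equation h = 0, solved for the soliton function with S replaced by its
    constant value.\<close>
  have "lam p = s / real CARD('n) - \<rho> * s" if p: "p \<in> topspace M" for p
  proof -
    obtain c where c: "c \<in> A" "p \<in> fst c" using p atlas unfolding smooth_atlas_def by blast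
    have "h p = 0"
      using h0[OF c(1) snd_in_chart_image[OF c(2)]] by (simp add: chart_inv_snd[OF c])
    then show ?thesis using s[OF p] by (simp add: h_def field_simps)
  qed
  then have "lam constant_on topspace M" unfolding constant_on_def by blast
  moreover have "smooth_vector_field A \<xi>" using soliton unfolding almost_RB_soliton_def by blast
  ultimately show "trivial_RB_soliton M A g \<xi> lam \<rho>"
    using soliton L0 by (simp add: trivial_RB_soliton_def RB_soliton_def killing_field_def)
qed

end

theorem theorem4p1:
  fixes M :: "'a topology"
    and A :: "('a, 'n::finite) chart set"
    and g :: "('a, 'n) chart \<Rightarrow> real ^ 'n \<Rightarrow> real ^ 'n ^ 'n"
    and \<xi> :: "('a, 'n) chart \<Rightarrow> real ^ 'n \<Rightarrow> real ^ 'n"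
    and lam :: "'a \<Rightarrow> real"
    and \<rho> :: real
  assumes "almost_RB_soliton M A g \<xi> lam \<rho>"
    and "compact_space M"
    and "CARD('n) > 2"
  shows "trivial_RB_soliton M A g \<xi> lam \<rho> \<longleftrightarrow>
    constant_on_integral_curves A \<xi>
      (\<lambda>p. real CARD('n) * (lam p + \<rho> * scalar_curvature A g p) - scalar_curvature A g p)"
proof -
  interpret almost_RB M A g \<xi> lam \<rho> by unfold_locales (rule assms(1))
  show ?thesis using trivial_iff[OF assms(2,3)] unfolding h_def[abs_def] .
qed

end
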